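(* Let $p\in[2,\infty)$, $\frac1p+\frac1q=1$, and let $d\mu_p=\frac{e^{-\beta d^p}}{Z}d\lambda$ be a probability measure on $\mathbb{R}^N$, $\beta\in(0,\infty)$. Suppose $0<\frac1\sigma\le|\nabla d|\le1$ for some $\sigma\in[1,\infty)$, and $\Delta d\le K+\beta p\,\varepsilon\, d^{p-1}$ outside the unit ball $\{d<1\}$ for some $K\in[0,\infty)$, $\varepsilon\in[0,\frac1{\sigma^2})$, and let $C,D\in(0,\infty)$ be constants such that $$\int|f|^qd^{p}\,d\mu_p\le C\int|\nabla f|^q\,d\mu_p+D\int|f|^q\,d\mu_p\qquad\text{for all }f\in\mathcal{L}.$$ Let $d\mu=\frac{e^{-W-V}}{Z'}d\mu_p$ be a probability measure defined with a differentiable potential $W$ satisfying $$|\nabla W|^q\le\delta d^p+\gamma_\delta$$ with some constants $\delta$, $\gamma_\delta\in(0,\infty)$ such that $\delta\,2^{q-1}q^{-q}C<1$, and suppose that $V$ is a measurable function such that $\mathrm{osc}(V)\equiv\max V-\min V<\infty$. Then there exist constants $C',D'\in(0,\infty)$ such that for every $f\in\mathcal{L}$ $$\int|f|^qd^p\,d\mu\le C'\int|\nabla f|^q\,d\mu+D'\int|f|^q\,d\mu .$$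
   Context: Setting. $\lambda$ is Lebesgue measure on $\mathbb{R}^N$. $\nabla=(X_1,\dots,X_k)$ is a finite collection of smooth, possibly noncommuting, vector fields on $\mathbb{R}^N$, each with zero divergence with respect to $\lambda$; $\nabla f=(X_1f,\dots,X_kf)$, $|\nabla f|=(\sum_i (X_if)^2)^{1/2}$ and $\Delta=\sum_i X_i^2$. $\mathcal{L}$ denotes the class of continuous functions $f:\mathbb{R}^N\to\mathbb{R}$ whose distributional derivatives $X_if$ are all in $L^\infty_{loc}$. $d:\mathbb{R}^N\to[0,\infty)$ is the distance from a fixed point (the origin) in some metric; it is assumed that $d\in\mathcal{L}$ and that the balls $\{d\le R\}$ are compact. Bounds on $|\nabla d|$ are understood almost everywhere, and the upper bound on $\Delta d$ in the sense of distributions on $\{d>1\}$. $Z,Z'$ are normalisation constants. Integrals on the right-hand side are allowed to be $+\infty$. *)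

theory Defs
  imports "HOL-Probability.Probability_Measure"
begin

primrec Ck :: "nat \<Rightarrow> ('a::euclidean_space \<Rightarrow> 'b::real_normed_vector) \<Rightarrow> bool" where
  "Ck 0 f \<longleftrightarrow> continuous_on UNIV f"
| "Ck (Suc m) f \<longleftrightarrow> (\<forall>x. f differentiable (at x)) \<and>
     (\<forall>b\<in>Basis. Ck m (\<lambda>x. frechet_derivative f (at x) b))"

definition smooth :: "('a::euclidean_space \<Rightarrow> 'b::real_normed_vector) \<Rightarrow> bool" where
  "smooth f \<longleftrightarrow> (\<forall>m. Ck m f)"

definition test_fun :: "'a::euclidean_space set \<Rightarrow> ('a \<Rightarrow> real) \<Rightarrow> bool" where
  "test_fun U \<phi> \<longleftrightarrow> smooth \<phi> \<and> compact (closure {x. \<phi> x \<noteq> 0}) \<and> closure {x. \<phi> x \<noteq> 0} \<subseteq> U"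

text \<open>Classical action of a vector field on a differentiable function.\<close>

definition vf_deriv :: "('a::euclidean_space \<Rightarrow> 'a) \<Rightarrow> ('a \<Rightarrow> real) \<Rightarrow> 'a \<Rightarrow> real" where
  "vf_deriv Y f x = frechet_derivative f (at x) (Y x)"

definition classical_grad ::
    "('k::finite \<Rightarrow> 'a::euclidean_space \<Rightarrow> 'a) \<Rightarrow> ('a \<Rightarrow> real) \<Rightarrow> 'a \<Rightarrow> real ^ 'k" where
  "classical_grad X f x = (\<chi> i. vf_deriv (X i) f x)"

definition divergence :: "('a::euclidean_space \<Rightarrow> 'a) \<Rightarrow> 'a \<Rightarrow> real" where
  "divergence Y x = (\<Sum>b\<in>Basis. frechet_derivative Y (at x) b \<bullet> b)"

text \<open>
  For a vector field \<open>Y\<close> of zero divergence the formal adjoint with respect to Lebesgue measure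
  is \<open>-Y\<close>; the distributional derivative below is meant for such fields only.
\<close>

definition has_weak_deriv ::
    "('a::euclidean_space \<Rightarrow> 'a) \<Rightarrow> ('a \<Rightarrow> real) \<Rightarrow> ('a \<Rightarrow> real) \<Rightarrow> bool" where
  "has_weak_deriv Y f g \<longleftrightarrow>
     (\<forall>K. compact K \<longrightarrow> g absolutely_integrable_on K) \<and>
     (\<forall>\<phi>. test_fun UNIV \<phi> \<longrightarrow>
        (\<integral>x. g x * \<phi> x \<partial>lebesgue) = - (\<integral>x. f x * vf_deriv Y \<phi> x \<partial>lebesgue))"

definition Linf_loc :: "('a::euclidean_space \<Rightarrow> real) \<Rightarrow> bool" where
  "Linf_loc g \<longleftrightarrow> g \<in> borel_measurable lebesgue \<and>
     (\<forall>K. compact K \<longrightarrow> (\<exists>M. AE x in lebesgue. x \<in> K \<longrightarrow> \<bar>g x\<bar> \<le> M))"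

definition class_L :: "('k::finite \<Rightarrow> 'a::euclidean_space \<Rightarrow> 'a) \<Rightarrow> ('a \<Rightarrow> real) set" where
  "class_L X = {f. continuous_on UNIV f \<and> (\<forall>i. \<exists>g. Linf_loc g \<and> has_weak_deriv (X i) f g)}"

text \<open>
  Weak derivatives are unique up to null sets, so the choice of a representative is immaterial
  in integrals and almost-everywhere statements. The norm on \<open>real ^ 'k\<close> is the Euclidean one.
\<close>

definition weak_grad ::
    "('k::finite \<Rightarrow> 'a::euclidean_space \<Rightarrow> 'a) \<Rightarrow> ('a \<Rightarrow> real) \<Rightarrow> 'a \<Rightarrow> real ^ 'k" where
  "weak_grad X f x = (\<chi> i. (SOME g. has_weak_deriv (X i) f g) x)"

text \<open>
  The inequality \<open>\<Delta> f \<le> h\<close> in the sense of distributions on \<open>U\<close>, where \<open>\<Delta>\<close> is the sum of the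
  squares of the fields \<open>X i\<close>, which is formally self-adjoint when these have zero divergence.
\<close>

definition weak_laplacian_le ::
    "('k::finite \<Rightarrow> 'a::euclidean_space \<Rightarrow> 'a) \<Rightarrow> 'a set \<Rightarrow> ('a \<Rightarrow> real) \<Rightarrow> ('a \<Rightarrow> real) \<Rightarrow> bool" where
  "weak_laplacian_le X U f h \<longleftrightarrow>
     (\<forall>\<phi>. test_fun U \<phi> \<and> (\<forall>x. 0 \<le> \<phi> x) \<longrightarrow>
        (\<integral>x. f x * (\<Sum>i\<in>UNIV. vf_deriv (X i) (vf_deriv (X i) \<phi>) x) \<partial>lebesgue)
          \<le> (\<integral>x. h x * \<phi> x \<partial>lebesgue))"

text \<open>Oscillation, with supremum and infimum taken in the extended reals.\<close>

definition osc :: "('a \<Rightarrow> real) \<Rightarrow> ereal" where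
  "osc V = (SUP x. ereal (V x)) - (INF x. ereal (V x))"

end

(*
  The bound for mu_p is applied to h = f exp(-W/q). Since grad h = exp(-W/q) (grad f - f grad W / q),
  convexity of t^q gives
    |grad h|^q <= 2^(q-1) exp(-W) (|grad f|^q + q^(-q) |f|^q |grad W|^q),
  and |grad W|^q <= delta d^p + gamma produces delta 2^(q-1) q^(-q) C < 1 times the left-hand side,
  which is absorbed. The bounded potential V changes only the constants. To absorb, the left-hand side
  must be finite, so f is first cut off by functions of d, using |grad d| <= 1, and the cutoff is
  removed by monotone convergence.

  The product rule behind this has to be proved for f with weak derivatives only and for W that is
  merely differentiable, its derivatives along the fields being locally bounded. For everywhere
  differentiable functions integration by parts follows from a divergence theorem of gauge-integral
  type; it passes to weakly differentiable f by Friedrichs mollification.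
*)
theory Submission
  imports Defs "HOL-Analysis.Analysis"
begin

section \<open>The divergence theorem for differentiable vector fields\<close>

text \<open>The obstacle is regularity. A bound on the derivatives of \<open>W\<close> along the
  fields \<open>X i\<close> says nothing about its other partial derivatives, so
  \<open>exp (- W / q)\<close> need not be locally Lipschitz. What survives is that for a
  divergence-free field \<open>Y\<close> and a differentiable \<open>g\<close> the divergence of
  \<open>g Y\<close> is \<open>Y g\<close>, which is bounded on bounded sets. A divergence theorem
  that asks only for differentiability everywhere and an integrable divergence therefore applies.
  The other factor \<open>f\<close> is merely continuous, with \<open>Y f\<close> existing weakly.
  Its mollifications are differentiable, and applying \<open>Y\<close> to them differs from
  mollifying the weak derivative by a commutator controlled by the Lipschitz constant of
  \<open>Y\<close> and the oscillation of \<open>f\<close> alone. No derivative of \<open>f\<close>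
  enters, so continuity of \<open>f\<close> makes the commutator vanish in the limit. The same
  estimate yields the cutoffs. A profile of \<open>d\<close> itself need not be differentiable,
  since \<open>d\<close> is only in the class L; \<open>d\<close> is replaced by a mollification so
  fine that the commutator is at most 1, which keeps the derivatives bounded by a constant
  independent of the sublevel.\<close>

abbreviation cube :: "'a::euclidean_space \<Rightarrow> real \<Rightarrow> 'a set" where
  "cube c s \<equiv> cbox c (c + s *\<^sub>R One)"

lemma norm_diff_cube_le:
  fixes x y :: "'a::euclidean_space" and s :: real
  assumes "x \<in> cube c s" "y \<in> cube c s"
  shows "norm (y - x) \<le> DIM('a) * s"
proof -
  have "norm (y - x) \<le> (\<Sum>b\<in>Basis. \<bar>(y - x) \<bullet> b\<bar>)" by (rule norm_le_l1)
  also have "\<dots> \<le> (\<Sum>b\<in>(Basis::'a set). s::real)"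
  proof (rule sum_mono)
    fix b :: 'a assume b: "b \<in> Basis"
    show "\<bar>(y - x) \<bullet> b\<bar> \<le> s"
      using assms b unfolding mem_box by (force simp: inner_diff_left inner_add_left)
  qed
  finally show ?thesis by simp
qed

text \<open>Cousin's lemma with all boxes cubes: a differentiable field controls the flux only through
  boxes of bounded eccentricity, so the bisection halves every side at once.\<close>

lemma cousin_cubes:
  fixes a :: "'a::euclidean_space" and l :: real
  assumes l: "0 < l"
    and G: "\<And>x. \<exists>r>0. \<forall>c s. 0 < s \<and> x \<in> cube c s \<and> cube c s \<subseteq> ball x r
               \<longrightarrow> G x (cube c s)"
  shows "\<exists>p. p tagged_division_of cube a l \<and> (\<forall>(x,k)\<in>p. G x k)"
proof (rule ccontr)
  \<comment> \<open>\<open>P\<close> speaks of arbitrary boxes: the sides are halved one coordinate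
    at a time, and the intermediate boxes are not cubes.\<close>
  define P where "P c e \<longleftrightarrow> (\<exists>p. p tagged_division_of cbox c e \<and> (\<forall>(x,k)\<in>p. G x k))" for c e :: 'a
  assume "\<not> ?thesis"
  then have nP: "\<not> P a (a + l *\<^sub>R One)" by (simp add: P_def)
  have split: "P c e" if "P c e1" "P c1 e" and i: "i \<in> Basis"
    and e1: "\<And>j. j \<in> Basis \<Longrightarrow> e1 \<bullet> j = (if j = i then (c \<bullet> i + e \<bullet> i) / 2 else e \<bullet> j)"
    and c1: "\<And>j. j \<in> Basis \<Longrightarrow> c1 \<bullet> j = (if j = i then (c \<bullet> i + e \<bullet> i) / 2 else c \<bullet> j)"
    and le: "c \<bullet> i \<le> e \<bullet> i"
    for c e c1 e1 i
  proof -
    obtain p1 where p1: "p1 tagged_division_of cbox c e1" "\<forall>(x,k)\<in>p1. G x k"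
      using \<open>P c e1\<close> by (auto simp: P_def)
    obtain p2 where p2: "p2 tagged_division_of cbox c1 e" "\<forall>(x,k)\<in>p2. G x k"
      using \<open>P c1 e\<close> by (auto simp: P_def)
    have s1: "cbox c e1 = cbox c e \<inter> {x. x \<bullet> i \<le> (c \<bullet> i + e \<bullet> i) / 2}"
    proof -
      have "e1 = (\<Sum>j\<in>Basis. (if j = i then min (e \<bullet> i) ((c \<bullet> i + e \<bullet> i) / 2) else e \<bullet> j) *\<^sub>R j)"
        by (rule euclidean_eqI) (use i e1 le in \<open>auto simp: min_def\<close>)
      then show ?thesis unfolding interval_split[OF i] by (rule arg_cong)
    qed
    have s2: "cbox c1 e = cbox c e \<inter> {x. x \<bullet> i \<ge> (c \<bullet> i + e \<bullet> i) / 2}"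
    proof -
      have "c1 = (\<Sum>j\<in>Basis. (if j = i then max (c \<bullet> i) ((c \<bullet> i + e \<bullet> i) / 2) else c \<bullet> j) *\<^sub>R j)"
        by (rule euclidean_eqI) (use i c1 le in \<open>auto simp: max_def\<close>)
      then show ?thesis unfolding interval_split[OF i] by (rule arg_cong)
    qed
    have "(p1 \<union> p2) tagged_division_of cbox c e"
      using tagged_division_Un_interval[OF _ _ i] p1(1) p2(1) unfolding s1 s2 by blast
    then show ?thesis unfolding P_def using p1(2) p2(2) by blast
  qed
  \<comment> \<open>Induction over the set \<open>S\<close> of coordinates already halved. At each
    coordinate one of the two halves must still fail \<open>P\<close>, because \<open>split\<close>
    would glue good divisions of both. For \<open>S = Basis\<close> a cube is again a cube of half
    the side.\<close>
  have halve: "\<exists>c' e'. \<not> P c' e' \<and> (\<forall>i\<in>Basis. c \<bullet> i \<le> c' \<bullet> i \<and> e' \<bullet> i \<le> e \<bullet> i \<and>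
       e' \<bullet> i - c' \<bullet> i = (if i \<in> S then (e \<bullet> i - c \<bullet> i) / 2 else e \<bullet> i - c \<bullet> i))"
    if "finite S" "S \<subseteq> Basis" "\<not> P c e" "\<forall>i\<in>Basis. c \<bullet> i \<le> e \<bullet> i" for S c e
    using that
  proof (induction S)
    case empty
    then show ?case by auto
  next
    case (insert i S)
    then obtain c' e' where *: "\<not> P c' e'" "\<forall>j\<in>Basis. c \<bullet> j \<le> c' \<bullet> j \<and> e' \<bullet> j \<le> e \<bullet> j \<and>
       e' \<bullet> j - c' \<bullet> j = (if j \<in> S then (e \<bullet> j - c \<bullet> j) / 2 else e \<bullet> j - c \<bullet> j)"
      by auto
    have i: "i \<in> Basis" "i \<notin> S" using insert by auto
    have len: "e' \<bullet> i - c' \<bullet> i = e \<bullet> i - c \<bullet> i" using * i by auto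
    have cei: "c \<bullet> i \<le> e \<bullet> i" using insert i by auto
    define e1 where "e1 = e' - ((e' \<bullet> i - c' \<bullet> i) / 2) *\<^sub>R i"
    define c1 where "c1 = c' + ((e' \<bullet> i - c' \<bullet> i) / 2) *\<^sub>R i"
    have e1: "e1 \<bullet> j = (if j = i then (c' \<bullet> i + e' \<bullet> i) / 2 else e' \<bullet> j)" if "j \<in> Basis" for j
      using that i by (auto simp: e1_def inner_diff_left inner_Basis field_simps)
    have c1: "c1 \<bullet> j = (if j = i then (c' \<bullet> i + e' \<bullet> i) / 2 else c' \<bullet> j)" if "j \<in> Basis" for j
      using that i by (auto simp: c1_def inner_add_left inner_Basis field_simps)
    have "\<not> P c' e1 \<or> \<not> P c1 e'"
      using split[of c' e1 c1 e' i] * i e1 c1 len cei by auto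
    then show ?case
    proof
      assume "\<not> P c' e1"
      moreover have "c \<bullet> j \<le> c' \<bullet> j \<and> e1 \<bullet> j \<le> e \<bullet> j \<and>
          e1 \<bullet> j - c' \<bullet> j = (if j \<in> insert i S then (e \<bullet> j - c \<bullet> j) / 2 else e \<bullet> j - c \<bullet> j)"
        if "j \<in> Basis" for j
        using *(2)[rule_format, OF that] e1[OF that] i len cei by (auto simp: field_simps)
      ultimately show ?thesis by blast
    next
      assume "\<not> P c1 e'"
      moreover have "c \<bullet> j \<le> c1 \<bullet> j \<and> e' \<bullet> j \<le> e \<bullet> j \<and>
          e' \<bullet> j - c1 \<bullet> j = (if j \<in> insert i S then (e \<bullet> j - c \<bullet> j) / 2 else e \<bullet> j - c \<bullet> j)"
        if "j \<in> Basis" for j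
        using *(2)[rule_format, OF that] c1[OF that] i len cei by (auto simp: field_simps)
      ultimately show ?thesis by blast
    qed
  qed
  have step: "\<exists>c'. \<not> P c' (c' + (s/2) *\<^sub>R One) \<and> cube c' (s/2) \<subseteq> cube c s"
    if nP: "\<not> P c (c + s *\<^sub>R One)" and s: "0 < s" for c s
  proof -
    have "\<forall>i\<in>Basis. c \<bullet> i \<le> (c + s *\<^sub>R One) \<bullet> i"
      using s by (simp add: inner_add_left)
    with halve[of Basis c "c + s *\<^sub>R One"] nP obtain c' e' where *: "\<not> P c' e'"
      "\<forall>i\<in>Basis. c \<bullet> i \<le> c' \<bullet> i \<and> e' \<bullet> i \<le> (c + s *\<^sub>R One) \<bullet> i \<and>
        e' \<bullet> i - c' \<bullet> i = ((c + s *\<^sub>R One) \<bullet> i - c \<bullet> i) / 2"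
      by auto
    have e': "e' = c' + (s/2) *\<^sub>R One"
      by (rule euclidean_eqI) (use * in \<open>auto simp: inner_add_left algebra_simps\<close>)
    have "cbox c' e' \<subseteq> cube c s"
      using *(2) by (auto simp: mem_box) (meson order_trans)+
    with *(1) e' show ?thesis by auto
  qed
  define sd where "sd n = l / 2 ^ n" for n :: nat
  have sd_pos: "0 < sd n" for n using l by (simp add: sd_def)
  have "\<exists>f. \<forall>n. (\<not> P (f n) (f n + sd n *\<^sub>R One)) \<and>
      cube (f (Suc n)) (sd (Suc n)) \<subseteq> cube (f n) (sd n)"
  proof (rule dependent_nat_choice)
    show "\<exists>x. \<not> P x (x + sd 0 *\<^sub>R One)" using nP by (auto simp: sd_def)
  next
    fix x n assume "\<not> P x (x + sd n *\<^sub>R One)"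
    from step[OF this sd_pos] show "\<exists>y. \<not> P y (y + sd (Suc n) *\<^sub>R One) \<and>
         cube y (sd (Suc n)) \<subseteq> cube x (sd n)"
      by (simp add: sd_def mult.commute)
  qed
  then obtain f where f: "\<And>n. \<not> P (f n) (f n + sd n *\<^sub>R One)"
      "\<And>n. cube (f (Suc n)) (sd (Suc n)) \<subseteq> cube (f n) (sd n)"
    by blast
  define Q where "Q n = cube (f n) (sd n)" for n
  have "\<exists>x. \<forall>n. x \<in> Q n"
  proof (rule bounded_closed_nest)
    show "\<And>n. closed (Q n)" by (simp add: Q_def closed_cbox)
    show "\<And>n. Q n \<noteq> {}" using sd_pos by (auto simp: Q_def box_ne_empty inner_add_left less_imp_le)
    show "Q n \<subseteq> Q m" if "m \<le> n" for m n
      using lift_Suc_antimono_le[of Q, OF _ that] f(2) by (auto simp: Q_def)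
    show "bounded (Q 0)" by (simp add: Q_def)
  qed auto
  then obtain x where x: "\<And>n. x \<in> Q n" by blast
  obtain r where r: "r > 0" and Gr: "\<And>c s. 0 < s \<Longrightarrow> x \<in> cube c s \<Longrightarrow>
      cube c s \<subseteq> ball x r \<Longrightarrow> G x (cube c s)"
    using G[of x] by blast
  have "(\<lambda>n. real DIM('a) * sd n) \<longlonglongrightarrow> real DIM('a) * 0"
    unfolding sd_def by (intro tendsto_intros LIMSEQ_divide_realpow_zero) auto
  then have "eventually (\<lambda>n. DIM('a) * sd n < r) sequentially"
    using r by (intro order_tendstoD(2)) auto
  then obtain n where n: "DIM('a) * sd n < r" by (meson eventually_sequentially order_refl)
  have "Q n \<subseteq> ball x r"
  proof
    fix y assume y: "y \<in> Q n"
    have "norm (y - x) \<le> DIM('a) * sd n"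
      using norm_diff_cube_le[of x "f n" "sd n" y] x[of n] y by (simp add: Q_def)
    then show "y \<in> ball x r" using n by (simp add: dist_norm norm_minus_commute)
  qed
  \<comment> \<open>The common point \<open>x\<close> of the nested cubes may lie anywhere in
    \<open>Q n\<close>. Once the cube is small it is, with the tag \<open>x\<close>, a good division
    of itself, which contradicts its choice.\<close>
  then have "G x (Q n)" using Gr[of "sd n" "f n"] x[of n] sd_pos by (auto simp: Q_def)
  moreover have "{(x, Q n)} tagged_division_of Q n"
    unfolding Q_def by (rule tagged_division_of_self) (use x[of n] in \<open>simp add: Q_def\<close>)
  ultimately have "P (f n) (f n + sd n *\<^sub>R One)" unfolding P_def Q_def by blast
  with f(1) show False by blast
qed

text \<open>Translating \<open>g\<close> amounts to translating the cube, so the two integrals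
  cancel on the overlap of the cube with its translate. There remain two slabs of thickness
  \<open>h\<close>, each of volume \<open>h / s\<close> times that of the cube, on which
  \<open>g\<close> is bounded by \<open>M\<close>.\<close>

lemma slab_bound:
  fixes g :: "'a::euclidean_space \<Rightarrow> real"
  assumes g: "continuous_on UNIV g" and i: "i \<in> Basis" and h: "0 < h" "h \<le> s"
    and M: "\<And>y. y \<in> cube c s \<Longrightarrow> \<bar>g y\<bar> \<le> M"
           "\<And>y. y \<in> cube c s \<Longrightarrow> \<bar>g (y + h *\<^sub>R i)\<bar> \<le> M"
  shows "\<bar>integral (cube c s) (\<lambda>y. g (y + h *\<^sub>R i) - g y)\<bar>
           \<le> 2 * M * (h / s) * measure lborel (cube c s)"
proof -
  define Q where "Q = cube c s"
  define R where "R = cbox (c + h *\<^sub>R i) (c + s *\<^sub>R One + h *\<^sub>R i)"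
  define T where "T = cbox (c + h *\<^sub>R i) (c + s *\<^sub>R One)"
  have s: "0 < s" using h by simp
  have QR: "Q \<inter> R = T"
    using i h by (auto simp: Q_def R_def T_def mem_box inner_add_left inner_Basis
        split: if_splits; force)
  have cQ: "measure lborel Q = s ^ DIM('a)"
    unfolding Q_def using s by (subst content_cbox) (auto simp: inner_add_left)
  have cR: "measure lborel R = s ^ DIM('a)"
    unfolding R_def using s by (subst content_cbox) (auto simp: inner_add_left)
  have cT: "measure lborel T = s ^ DIM('a) * (1 - h / s)"
  proof -
    have "measure lborel T = (\<Prod>j\<in>Basis. (c + s *\<^sub>R One) \<bullet> j - (c + h *\<^sub>R i) \<bullet> j)"
      unfolding T_def using s h i by (subst content_cbox) (auto simp: inner_add_left inner_Basis)
    also have "\<dots> = (\<Prod>j\<in>Basis. s * (if j = i then 1 - h / s else 1))"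
      by (rule prod.cong) (use i s in \<open>auto simp: inner_add_left inner_Basis field_simps\<close>)
    also have "\<dots> = s ^ DIM('a) * (1 - h / s)"
      using i by (simp add: prod.distrib)
    finally show ?thesis .
  qed
  have ints: "integrable lborel (\<lambda>x. indicator Q x * g x)" "integrable lborel (\<lambda>x. indicator R x * g x)"
    using borel_integrable_compact[of Q g] borel_integrable_compact[of R g] continuous_on_subset[OF g]
    by (auto simp: Q_def R_def indicator_scaleR_eq_if if_distrib indicator_def mult.commute cong: if_cong)
  have gi: "g integrable_on Q" "g integrable_on R"
    using continuous_on_subset[OF g] by (auto simp: Q_def R_def intro!: integrable_continuous)
  have gsh: "(\<lambda>y. g (y + h *\<^sub>R i)) integrable_on Q"
    unfolding Q_def by (intro integrable_continuous continuous_on_compose2[OF g] continuous_intros) auto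
  have shift: "integral Q (\<lambda>y. g (y + h *\<^sub>R i)) = integral R g"
    using integral_shift_cbox_plus[of c "c + s *\<^sub>R One" g "h *\<^sub>R i"]
    by (simp add: Q_def R_def add_ac o_def)
  have leb: "integral Q g = (\<integral>x. indicator Q x * g x \<partial>lborel)" "integral R g = (\<integral>x. indicator R x * g x \<partial>lborel)"
    using set_borel_integral_eq_integral(2)[of Q g] set_borel_integral_eq_integral(2)[of R g] ints
    by (auto simp: set_lebesgue_integral_def set_integrable_def)
  have iQ: "integrable lborel (\<lambda>x. indicator Q x :: real)" "integrable lborel (\<lambda>x. indicator R x :: real)"
       "integrable lborel (\<lambda>x. indicator T x :: real)"
    unfolding Q_def R_def T_def by (auto intro!: integrable_real_indicator simp: emeasure_lborel_cbox_eq)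
  have M0: "0 \<le> M" using M(1)[of c] s by (force simp: mem_box inner_add_left)
  have gR: "\<bar>g y\<bar> \<le> M" if "y \<in> R" for y
    using M(2)[of "y - h *\<^sub>R i"] that by (auto simp: R_def mem_box inner_add_left inner_diff_left algebra_simps)
  have "\<bar>(\<integral>x. indicator R x * g x \<partial>lborel) - (\<integral>x. indicator Q x * g x \<partial>lborel)\<bar>
      = \<bar>\<integral>x. indicator R x * g x - indicator Q x * g x \<partial>lborel\<bar>"
    using ints by simp
  also have "\<dots> \<le> (\<integral>x. \<bar>indicator R x * g x - indicator Q x * g x\<bar> \<partial>lborel)"
    by (rule integral_abs_bound)
  \<comment> \<open>\<open>T\<close> is the intersection of \<open>Q\<close> and \<open>R\<close>,
    so the combination of indicators is the indicator of their symmetric difference.\<close>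
  also have "\<dots> \<le> (\<integral>x. M * (indicator R x + indicator Q x - 2 * indicator T x) \<partial>lborel)"
  proof (rule integral_mono)
    show "integrable lborel (\<lambda>x. \<bar>indicator R x * g x - indicator Q x * g x\<bar>)"
      using ints by (intro integrable_abs Bochner_Integration.integrable_diff)
    show "integrable lborel (\<lambda>x. M * (indicator R x + indicator Q x - 2 * indicator T x))"
      using iQ by (intro integrable_mult_right Bochner_Integration.integrable_diff Bochner_Integration.integrable_add)
    show "\<bar>indicator R x * g x - indicator Q x * g x\<bar> \<le> M * (indicator R x + indicator Q x - 2 * indicator T x)" for x
      unfolding QR[symmetric] using gR[of x] M(1)[of x] M0 by (auto simp: indicator_def Q_def[symmetric])
  qed
  also have "\<dots> = M * (measure lborel R + measure lborel Q - 2 * measure lborel T)"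
    using iQ by (simp add: Q_def R_def T_def)
  also have "\<dots> = 2 * M * (h / s) * measure lborel Q"
    unfolding cQ cR cT by (simp add: algebra_simps)
  finally show ?thesis
    unfolding Q_def[symmetric] using shift gsh gi leb by (simp add: Henstock_Kurzweil_Integration.integral_diff)
qed


text \<open>The flux through the boundary of a cube is replaced by the integral of a difference quotient,
  which needs no surface measure and is additive over tagged divisions for every fixed \<open>h\<close>.\<close>

lemma local_flux:
  fixes F :: "'a::euclidean_space \<Rightarrow> 'a"
  assumes cont: "continuous_on UNIV F" and der: "(F has_derivative A) (at x)" and e: "0 < e"
  shows "\<exists>r>0. \<forall>c s. 0 < s \<and> x \<in> cube c s \<and> cube c s \<subseteq> ball x r \<longrightarrow>
     (\<forall>\<^sub>F h in at_right 0. \<bar>integral (cube c s) (\<lambda>y. \<Sum>b\<in>Basis. ((F (y + h *\<^sub>R b) - F y) \<bullet> b) / h)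
        - measure lborel (cube c s) * (\<Sum>b\<in>Basis. A b \<bullet> b)\<bar>
        \<le> e * measure lborel (cube c s))"
proof -
  define N where "N = real DIM('a)"
  have N: "1 \<le> N" unfolding N_def using DIM_positive[where 'a='a] by linarith
  \<comment> \<open>Each of the \<open>N\<close> directions will contribute at most
    \<open>4 * N * \<eta>\<close> times the volume: a factor 2 from the two slabs, and the bound
    \<open>\<eta> * (2 * N * s)\<close> for the remainder, whose \<open>s\<close> cancels against
    the slab thickness.\<close>
  define \<eta> where "\<eta> = e / (4 * N\<^sup>2)"
  have \<eta>: "0 < \<eta>" using e N by (simp add: \<eta>_def)
  \<comment> \<open>The linear part of \<open>F\<close> contributes the trace of \<open>A\<close>
    exactly, for every \<open>h\<close>; only this first-order remainder has to be
    estimated.\<close>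
  define G where "G y = F y - F x - A (y - x)" for y
  have A: "bounded_linear A" using der by (rule has_derivative_bounded_linear)
  interpret A: bounded_linear A by fact
  \<comment> \<open>The cubes are taken inside the ball of radius \<open>r0 / 2\<close> and
    \<open>h\<close> below \<open>r0 / 2\<close>, so that the shifted points \<open>y + h b\<close>
    are still within \<open>r0\<close> of \<open>x\<close>. Likewise \<open>h\<close> below
    \<open>s\<close> makes their distance from \<open>x\<close> at most
    \<open>2 * N * s\<close>.\<close>
  obtain r0 where r0: "0 < r0" "\<And>y. norm (y - x) < r0 \<Longrightarrow> norm (G y) \<le> \<eta> * norm (y - x)"
    using der[unfolded has_derivative_at_alt] \<eta> unfolding G_def by blast
  have Gc: "continuous_on UNIV G"
    unfolding G_def using cont
    by (intro continuous_on_diff continuous_on_compose2[OF linear_continuous_on[OF A, of UNIV]] continuous_intros) auto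
  have "\<forall>\<^sub>F h in at_right 0. \<bar>integral (cube c s) (\<lambda>y. \<Sum>b\<in>Basis. ((F (y + h *\<^sub>R b) - F y) \<bullet> b) / h)
        - measure lborel (cube c s) * (\<Sum>b\<in>Basis. A b \<bullet> b)\<bar>
        \<le> e * measure lborel (cube c s)"
    if s: "0 < s" and xQ: "x \<in> cube c s" and sub: "cube c s \<subseteq> ball x (r0/2)" for c s
  proof -
    define Q where "Q = cube c s"
    have "\<bar>integral Q (\<lambda>y. \<Sum>b\<in>Basis. ((F (y + h *\<^sub>R b) - F y) \<bullet> b) / h)
        - measure lborel Q * (\<Sum>b\<in>Basis. A b \<bullet> b)\<bar> \<le> e * measure lborel Q"
      if h: "0 < h" "h < min s (r0/2)" for h
    proof -
      let ?g = "\<lambda>b y. G (y + h *\<^sub>R b) \<bullet> b - G y \<bullet> b"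
      have Gb: "\<bar>integral Q (?g b)\<bar> \<le> 2 * (\<eta> * (2 * N * s)) * (h / s) * measure lborel Q"
        if b: "b \<in> Basis" for b
        unfolding Q_def
      proof (rule slab_bound)
        show "continuous_on UNIV (\<lambda>y. G y \<bullet> b)" by (intro continuous_intros Gc)
        show "0 < h" "h \<le> s" "b \<in> Basis" using h b by auto
        fix y assume y: "y \<in> cube c s"
        have ny: "norm (y - x) \<le> N * s" unfolding N_def using xQ y by (rule norm_diff_cube_le)
        have ny2: "norm (y - x) < r0 / 2" using y sub by (auto simp: dist_norm norm_minus_commute)
        have nyh: "norm (y + h *\<^sub>R b - x) \<le> norm (y - x) + h"
          using norm_triangle_ineq[of "y - x" "h *\<^sub>R b"] h b by (simp add: algebra_simps)
        have Ns: "s \<le> N * s" "2 * N * s = N * s + N * s" using N s by simp_all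
        have "norm (G y) \<le> \<eta> * norm (y - x)" using r0 ny2 by auto
        also have "\<dots> \<le> \<eta> * (2 * N * s)" using \<eta> ny Ns s by (intro mult_left_mono) linarith+
        finally show "\<bar>G y \<bullet> b\<bar> \<le> \<eta> * (2 * N * s)" using Basis_le_norm[OF b, of "G y"] by linarith
        have "norm (G (y + h *\<^sub>R b)) \<le> \<eta> * norm (y + h *\<^sub>R b - x)" using r0(2)[of "y + h *\<^sub>R b"] ny2 nyh h by auto
        also have "\<dots> \<le> \<eta> * (2 * N * s)" using \<eta> ny nyh Ns s h by (intro mult_left_mono) linarith+
        finally show "\<bar>G (y + h *\<^sub>R b) \<bullet> b\<bar> \<le> \<eta> * (2 * N * s)"
          using Basis_le_norm[OF b, of "G (y + h *\<^sub>R b)"] by linarith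
      qed
      have eq: "((F (y + h *\<^sub>R b) - F y) \<bullet> b) / h = ?g b y / h + A b \<bullet> b" for y b
      proof -
        have "A (y + h *\<^sub>R b - x) = A (y - x) + h *\<^sub>R A b"
          by (simp add: A.add A.diff A.scaleR)
        then show ?thesis using h by (simp add: G_def inner_diff_left inner_add_left field_simps)
      qed
      have Gint: "(?g b) integrable_on Q" for b
        unfolding Q_def by (intro integrable_continuous continuous_intros continuous_on_compose2[OF Gc]) auto
      have "integral Q (\<lambda>y. \<Sum>b\<in>Basis. ((F (y + h *\<^sub>R b) - F y) \<bullet> b) / h)
          = (\<Sum>b\<in>Basis. integral Q (\<lambda>y. ?g b y / h + A b \<bullet> b))"
        unfolding eq by (rule integral_sum)
          (use Gint in \<open>auto simp: Q_def intro!: integrable_add integrable_on_divide integrable_const\<close>)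
      also have "\<dots> = (\<Sum>b\<in>Basis. integral Q (?g b) / h + measure lborel Q * (A b \<bullet> b))"
      proof (rule sum.cong[OF refl])
        fix b :: 'a
        have "integral Q (\<lambda>y. ?g b y / h + A b \<bullet> b)
           = integral Q (\<lambda>y. ?g b y / h) + integral Q (\<lambda>y. A b \<bullet> b)"
          using Gint by (intro Henstock_Kurzweil_Integration.integral_add)
             (auto simp: Q_def intro!: integrable_on_divide integrable_const)
        also have "integral Q (\<lambda>y. A b \<bullet> b) = measure lborel Q * (A b \<bullet> b)"
          by (simp add: Q_def)
        finally show "integral Q (\<lambda>y. ?g b y / h + A b \<bullet> b)
           = integral Q (?g b) / h + measure lborel Q * (A b \<bullet> b)"
          by (simp only: integral_divide)
      qed
      also have "\<dots> = (\<Sum>b\<in>Basis. integral Q (?g b) / h) + measure lborel Q * (\<Sum>b\<in>Basis. A b \<bullet> b)"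
        by (simp add: sum.distrib sum_distrib_left)
      finally have "\<bar>integral Q (\<lambda>y. \<Sum>b\<in>Basis. ((F (y + h *\<^sub>R b) - F y) \<bullet> b) / h)
          - measure lborel Q * (\<Sum>b\<in>Basis. A b \<bullet> b)\<bar>
          = \<bar>\<Sum>b\<in>Basis. integral Q (?g b) / h\<bar>" by simp
      also have "\<dots> \<le> (\<Sum>b\<in>Basis. \<bar>integral Q (?g b) / h\<bar>)"
        by (rule sum_abs)
      also have "\<dots> \<le> (\<Sum>b\<in>(Basis::'a set). 4 * N * \<eta> * measure lborel Q)"
      proof (rule sum_mono)
        fix b :: 'a assume b: "b \<in> Basis"
        have "\<bar>integral Q (?g b) / h\<bar>
           = \<bar>integral Q (?g b)\<bar> / h" using h by simp
        also have "\<dots> \<le> (2 * (\<eta> * (2 * N * s)) * (h / s) * measure lborel Q) / h"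
          using Gb[OF b] h by (intro divide_right_mono) auto
        also have "\<dots> = 4 * N * \<eta> * measure lborel Q" using h s by (simp add: field_simps)
        finally show "\<bar>integral Q (?g b) / h\<bar> \<le> 4 * N * \<eta> * measure lborel Q" .
      qed
      also have "\<dots> = 4 * N\<^sup>2 * \<eta> * measure lborel Q" by (simp add: N_def power2_eq_square)
      also have "\<dots> = e * measure lborel Q" using N by (simp add: \<eta>_def)
      finally show ?thesis .
    qed
    then show ?thesis unfolding Q_def
      by (intro eventually_at_rightI[of 0 "min s (r0/2)"]) (use s r0 in auto)
  qed
  then show ?thesis using r0(1) by (intro exI[of _ "r0/2"]) auto
qed

text \<open>The field is merely differentiable everywhere, with an integrable divergence; this is needed
  because only the derivatives of \<open>W\<close> along the fields \<open>X i\<close> are known to be locally bounded.\<close>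

theorem integral_divergence_eq_0:
  fixes F :: "'a::euclidean_space \<Rightarrow> 'a"
  assumes dF: "\<And>x. F differentiable (at x)" and supp: "bounded {x. F x \<noteq> 0}"
    and int: "divergence F integrable_on UNIV"
  shows "integral UNIV (divergence F) = 0"
proof -
  have Fc: "continuous_on UNIV F"
    using dF by (meson continuous_at_imp_continuous_on differentiable_imp_continuous_within)
  obtain R where R: "0 < R" "{x. F x \<noteq> 0} \<subseteq> ball 0 R"
    using supp bounded_subset_ballD by blast
  have F0: "F x = 0" if "R \<le> norm x" for x using R that by force
  \<comment> \<open>The margin 1 around the support keeps it inside every translate of
    \<open>Q\<close> by \<open>h < 1\<close>. The upper corner is written as lower corner plus side
    times \<open>One\<close> to match the form of \<open>cube\<close>.\<close>
  define Q where "Q = cbox (- (R+1) *\<^sub>R One) (- (R+1) *\<^sub>R One + (2*(R+1)) *\<^sub>R One :: 'a)"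
  have Qeq: "Q = {x. \<forall>b\<in>Basis. \<bar>x \<bullet> b\<bar> \<le> R + 1}"
  proof -
    have "(- (R+1) *\<^sub>R One) \<bullet> b \<le> x \<bullet> b \<and> x \<bullet> b \<le> (- (R+1) *\<^sub>R One + (2*(R+1)) *\<^sub>R One) \<bullet> b
        \<longleftrightarrow> \<bar>x \<bullet> b\<bar> \<le> R + 1" if "b \<in> Basis" for b x :: 'a
      using that by (simp only: inner_add_left inner_scaleR_left inner_sum_left_Basis) auto
    then show ?thesis unfolding Q_def cbox_def by blast
  qed
  have ballQ: "x \<in> Q" if "norm x \<le> R + 1" for x
    unfolding Qeq using that order_trans[OF Basis_le_norm] by auto
  have div0: "divergence F x = 0" if "x \<notin> Q" for x
  proof -
    have xR: "R < norm x" using ballQ[of x] that by (rule_tac ccontr) auto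
    have "(F has_derivative (\<lambda>_. 0)) (at x)"
    proof (rule has_derivative_transform_within_open[where f = "\<lambda>_. 0" and s = "- cball 0 R"])
      show "\<And>y. y \<in> - cball 0 R \<Longrightarrow> 0 = F y" using F0 by auto
    qed (use xR in auto)
    then have "frechet_derivative F (at x) = (\<lambda>_. 0)" using frechet_derivative_at by metis
    then show ?thesis by (simp add: divergence_def)
  qed
  define I where "I = integral UNIV (divergence F)"
  have "((divergence F) has_integral I) UNIV" using int by (simp add: I_def integrable_integral)
  then have hI: "((divergence F) has_integral I) Q"
  proof -
    have "(\<lambda>x. if x \<in> Q then divergence F x else 0) = divergence F" using div0 by auto
    then show ?thesis using \<open>((divergence F) has_integral I) UNIV\<close> has_integral_restrict_UNIV[of Q "divergence F" I] by simp
  qed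
  define D where "D h y = (\<Sum>b\<in>Basis. ((F (y + h *\<^sub>R b) - F y) \<bullet> b) / h)" for h y
  have Dc: "continuous_on UNIV (D h)" for h
    unfolding D_def divide_inverse by (intro continuous_intros continuous_on_compose2[OF Fc]) auto
  \<comment> \<open>Both terms of each difference quotient integrate the whole of a compactly
    supported function, so they cancel.\<close>
  have Dint: "integral Q (D h) = 0" if h: "0 < h" "h < 1" for h
  proof -
    have "integral Q (\<lambda>y. F (y + h *\<^sub>R b) \<bullet> b - F y \<bullet> b) = 0" if b: "b \<in> Basis" for b
    proof -
      have cF: "continuous_on UNIV (\<lambda>y. F y \<bullet> b)" by (intro continuous_intros Fc)
      have 1: "((\<lambda>y. F y \<bullet> b) has_integral J) S"
        if "((\<lambda>y. F y \<bullet> b) has_integral J) UNIV" "\<And>x. norm x < R \<Longrightarrow> x \<in> S" for S J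
      proof -
        have eq: "(\<lambda>y. if y \<in> S then F y \<bullet> b else 0) = (\<lambda>y. F y \<bullet> b)"
        proof
          fix y show "(if y \<in> S then F y \<bullet> b else 0) = F y \<bullet> b"
            using that(2)[of y] F0[of y] by (cases "norm y < R") auto
        qed
        show ?thesis using that(1) by (subst has_integral_restrict_UNIV[symmetric]) (simp only: eq)
      qed
      obtain J where J: "((\<lambda>y. F y \<bullet> b) has_integral J) UNIV"
      proof -
        have "(\<lambda>y. F y \<bullet> b) integrable_on Q"
          unfolding Q_def by (intro integrable_continuous continuous_on_subset[OF cF]) auto
        then obtain J where "((\<lambda>y. F y \<bullet> b) has_integral J) Q" by blast
        moreover have "(\<lambda>y. if y \<in> Q then F y \<bullet> b else 0) = (\<lambda>y. F y \<bullet> b)"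
        proof
          fix y show "(if y \<in> Q then F y \<bullet> b else 0) = F y \<bullet> b"
            using ballQ[of y] F0[of y] by (cases "norm y < R") auto
        qed
        ultimately have "((\<lambda>y. F y \<bullet> b) has_integral J) UNIV"
          by (subst (asm) has_integral_restrict_UNIV[symmetric]) (simp only:)
        then show ?thesis using that by blast
      qed
      have "((\<lambda>y. F y \<bullet> b) has_integral J) Q" using 1[OF J] ballQ by force
      moreover have "((\<lambda>y. F (y + h *\<^sub>R b) \<bullet> b) has_integral J) Q"
      proof -
        have "((\<lambda>y. F y \<bullet> b) has_integral J)
            (cbox (h *\<^sub>R b + (- (R+1) *\<^sub>R One)) (h *\<^sub>R b + (- (R+1) *\<^sub>R One + (2*(R+1)) *\<^sub>R One)))"
        proof (rule 1[OF J])
          fix x :: 'a assume x: "norm x < R"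
          have "\<bar>x \<bullet> j\<bar> \<le> R" if "j \<in> Basis" for j using Basis_le_norm[OF that, of x] x by linarith
          then have "(h *\<^sub>R b + (- (R+1) *\<^sub>R One)) \<bullet> j \<le> x \<bullet> j \<and>
              x \<bullet> j \<le> (h *\<^sub>R b + (- (R+1) *\<^sub>R One + (2*(R+1)) *\<^sub>R One)) \<bullet> j" if "j \<in> Basis" for j
            using h b that R by (fastforce simp: inner_add_left inner_Basis abs_le_iff)
          then show "x \<in> cbox (h *\<^sub>R b + (- (R+1) *\<^sub>R One)) (h *\<^sub>R b + (- (R+1) *\<^sub>R One + (2*(R+1)) *\<^sub>R One))"
            unfolding mem_box by blast
        qed
        then show ?thesis
          unfolding Q_def
          using has_integral_shift_cbox_iff[of "\<lambda>y. F y \<bullet> b" "h *\<^sub>R b" J "- (R+1) *\<^sub>R One" "- (R+1) *\<^sub>R One + (2*(R+1)) *\<^sub>R One"]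
          unfolding o_def add.commute[of "h *\<^sub>R b"] by blast
      qed
      ultimately have "((\<lambda>y. F (y + h *\<^sub>R b) \<bullet> b - F y \<bullet> b) has_integral (J - J)) Q"
        by (rule has_integral_diff[rotated])
      then show ?thesis by (simp add: integral_unique)
    qed note z = this
    have "integral Q (D h) = (\<Sum>b\<in>Basis. integral Q (\<lambda>y. (F (y + h *\<^sub>R b) \<bullet> b - F y \<bullet> b) / h))"
      unfolding D_def inner_diff_left
      by (rule integral_sum) (auto simp: Q_def divide_inverse
          intro!: integrable_continuous continuous_intros continuous_on_compose2[OF Fc])
    also have "\<dots> = 0" using z by simp
    finally show ?thesis .
  qed
  have "\<bar>I\<bar> \<le> e * (1 + measure lborel Q)" if e: "0 < e" for e
  proof -
    obtain \<gamma> where \<gamma>: "gauge \<gamma>" "\<And>p. p tagged_division_of Q \<Longrightarrow> \<gamma> fine p \<Longrightarrow>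
        norm ((\<Sum>(x, k)\<in>p. measure lborel k *\<^sub>R divergence F x) - I) < e"
    proof -
      have "\<exists>\<gamma>. gauge \<gamma> \<and> (\<forall>p. p tagged_division_of Q \<and> \<gamma> fine p \<longrightarrow>
        norm ((\<Sum>(x, k)\<in>p. measure lborel k *\<^sub>R divergence F x) - I) < e)"
        using hI[unfolded Q_def has_integral, THEN spec, THEN mp, OF e] unfolding Q_def .
      then show ?thesis using that by blast
    qed
    \<comment> \<open>The two demands on a tagged cube are joined: fineness for the gauge of the
      integral of the divergence, and the flux estimate. The latter holds only for small
      \<open>h\<close>, with a threshold depending on the cube.\<close>
    define G where "G x k \<longleftrightarrow> k \<subseteq> \<gamma> x \<and>
       (\<forall>\<^sub>F h in at_right 0. \<bar>integral k (D h) - measure lborel k * divergence F x\<bar> \<le> e * measure lborel k)" for x k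
    have "\<exists>p. p tagged_division_of Q \<and> (\<forall>(x,k)\<in>p. G x k)"
      unfolding Q_def
    proof (rule cousin_cubes)
      show "0 < 2 * (R + 1)" using R by simp
      fix x
      obtain r1 where r1: "r1 > 0" "ball x r1 \<subseteq> \<gamma> x"
        using \<gamma>(1) unfolding gauge_def by (meson openE)
      have "(F has_derivative frechet_derivative F (at x)) (at x)"
        using dF frechet_derivative_works by blast
      from local_flux[OF Fc this e] obtain r2 where r2: "r2 > 0"
        "\<And>c s. 0 < s \<Longrightarrow> x \<in> cube c s \<Longrightarrow> cube c s \<subseteq> ball x r2 \<Longrightarrow>
     (\<forall>\<^sub>F h in at_right 0. \<bar>integral (cube c s) (D h)
        - measure lborel (cube c s) * divergence F x\<bar>
        \<le> e * measure lborel (cube c s))"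
        unfolding divergence_def D_def by blast
      show "\<exists>r>0. \<forall>c s. 0 < s \<and> x \<in> cube c s \<and> cube c s \<subseteq> ball x r
               \<longrightarrow> G x (cube c s)"
      proof (intro exI[of _ "min r1 r2"] conjI allI impI)
        show "0 < min r1 r2" using r1 r2 by simp
        fix c :: 'a and s :: real
        assume *: "0 < s \<and> x \<in> cube c s \<and> cube c s \<subseteq> ball x (min r1 r2)"
        have "ball x (min r1 r2) \<subseteq> ball x r1" "ball x (min r1 r2) \<subseteq> ball x r2" by (auto intro: subset_ball)
        with * r1 r2(2)[of s c] show "G x (cube c s)" unfolding G_def by blast
      qed
    qed
    then obtain p where p: "p tagged_division_of Q" "\<And>x k. (x,k) \<in> p \<Longrightarrow> G x k" by blast
    have fin: "finite p" using p(1) by (rule tagged_division_of_finite)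
    have "\<gamma> fine p" using p(2) by (auto simp: fine_def G_def)
    with \<gamma>(2) p(1) have near: "\<bar>(\<Sum>(x, k)\<in>p. measure lborel k * divergence F x) - I\<bar> < e" by fastforce
    have "\<forall>\<^sub>F h in at_right 0. \<forall>z\<in>p. (case z of (x,k) \<Rightarrow>
        \<bar>integral k (D h) - measure lborel k * divergence F x\<bar> \<le> e * measure lborel k)"
      using p(2) fin by (intro eventually_ball_finite) (auto simp: G_def)
    moreover have "\<forall>\<^sub>F h in at_right (0::real). 0 < h \<and> h < 1"
      by (intro eventually_at_rightI[of 0 1]) auto
    ultimately have "\<forall>\<^sub>F h in at_right (0::real). 0 < h \<and> h < 1 \<and> (\<forall>z\<in>p. (case z of (x,k) \<Rightarrow>
        \<bar>integral k (D h) - measure lborel k * divergence F x\<bar> \<le> e * measure lborel k))"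
      by eventually_elim auto
    \<comment> \<open>\<open>h\<close> is chosen last. The division is already fixed and finite, so
      one \<open>h\<close> serves all its pieces.\<close>
    then obtain h where h: "0 < h" "h < 1" "\<And>x k. (x,k) \<in> p \<Longrightarrow>
        \<bar>integral k (D h) - measure lborel k * divergence F x\<bar> \<le> e * measure lborel k"
      by (force dest!: eventually_happens'[rotated])
    \<comment> \<open>The total flux is zero and splits over the division. Replacing each piece by
      its Riemann term costs \<open>e\<close> times its volume, so the Riemann sum lies within
      \<open>e\<close> times the volume of \<open>Q\<close> of zero.\<close>
    have "0 = integral Q (D h)" using Dint h by simp
    also have "\<dots> = (\<Sum>(x,k)\<in>p. integral k (D h))"
      unfolding Q_def
      by (rule integral_combine_tagged_division_topdown)
        (use p(1) in \<open>auto simp: Q_def intro!: integrable_continuous continuous_on_subset[OF Dc]\<close>)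
    finally have "\<bar>\<Sum>(x, k)\<in>p. measure lborel k * divergence F x\<bar>
        = \<bar>\<Sum>(x,k)\<in>p. integral k (D h) - measure lborel k * divergence F x\<bar>"
      by (simp add: sum_subtractf case_prod_beta)
    also have "\<dots> \<le> (\<Sum>(x,k)\<in>p. e * measure lborel k)"
      by (rule order_trans[OF sum_abs], rule sum_mono) (use h(3) in auto)
    also have "\<dots> = e * measure lborel Q"
      using additive_content_tagged_division[of p] p(1) unfolding Q_def
      by (simp add: case_prod_beta flip: sum_distrib_left)
    finally show ?thesis using near by (simp add: algebra_simps)
  qed note est = this
  have "\<bar>I\<bar> \<le> 0 + e" if e: "0 < e" for e
  proof -
    have "0 < 1 + measure lborel Q" by (simp add: add_pos_nonneg)
    then show ?thesis using est[of "e / (1 + measure lborel Q)"] e by simp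
  qed
  then have "\<bar>I\<bar> \<le> 0" by (rule field_le_epsilon)
  then show ?thesis by (simp add: I_def)
qed

section \<open>Smooth functions and derivatives along vector fields\<close>

lemma has_derivative_frechet_derivative:
  "f differentiable (at x) \<Longrightarrow> (f has_derivative frechet_derivative f (at x)) (at x)"
  using frechet_derivative_works by blast

lemma continuous_on_of_differentiable:
  assumes "\<And>x. f differentiable (at x)"
  shows "continuous_on S f"
  using assms by (meson continuous_at_imp_continuous_on differentiable_imp_continuous_within)

lemma vf_deriv_eq: "(f has_derivative f') (at x) \<Longrightarrow> vf_deriv Y f x = f' (Y x)"
  unfolding vf_deriv_def using frechet_derivative_at by metis

text \<open>The derivative of a merely differentiable function need not be continuous, but it is the
  pointwise limit of the difference quotients in the direction \<open>Y x\<close>, each of which is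
  continuous in \<open>x\<close>.\<close>

lemma borel_measurable_vf_deriv:
  fixes Y :: "'a::euclidean_space \<Rightarrow> 'a"
  assumes g: "\<And>x. g differentiable (at x)" and Y: "continuous_on UNIV Y"
  shows "vf_deriv Y g \<in> borel_measurable borel"
proof (rule borel_measurable_LIMSEQ_real)
  have gc: "continuous_on UNIV g" using g by (rule continuous_on_of_differentiable)
  show "(\<lambda>x. (g (x + inverse (real (Suc n)) *\<^sub>R Y x) - g x) / inverse (real (Suc n))) \<in> borel_measurable borel" for n
    unfolding divide_inverse
    by (intro borel_measurable_continuous_onI continuous_intros continuous_on_compose2[OF gc] Y) auto
  fix x
  let ?g' = "frechet_derivative g (at x)"
  have d: "(g has_derivative ?g') (at (x + 0 *\<^sub>R Y x))"
    using g has_derivative_frechet_derivative by auto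
  have "((\<lambda>t. g (x + t *\<^sub>R Y x)) has_derivative (\<lambda>t. ?g' (t *\<^sub>R Y x))) (at 0)"
    by (rule has_derivative_compose[where f="\<lambda>t. x + t *\<^sub>R Y x" and g=g and x=0, OF _ d])
       (auto intro!: derivative_eq_intros)
  moreover have "?g' (t *\<^sub>R Y x) = ?g' (Y x) * t" for t
    using has_derivative_bounded_linear[OF d] by (simp add: linear_scale bounded_linear.linear mult.commute)
  ultimately have "((\<lambda>t. g (x + t *\<^sub>R Y x)) has_derivative (\<lambda>t. ?g' (Y x) * t)) (at 0)"
    by (simp only:)
  then have "((\<lambda>t. g (x + t *\<^sub>R Y x)) has_field_derivative ?g' (Y x)) (at 0)"
    by (simp only: has_field_derivative_def)
  then have "((\<lambda>h. (g (x + h *\<^sub>R Y x) - g x) / h) \<longlongrightarrow> ?g' (Y x)) (at 0)"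
    by (simp add: DERIV_def)
  moreover have "filterlim (\<lambda>n. inverse (real (Suc n))) (at 0) sequentially"
    unfolding filterlim_at using LIMSEQ_inverse_real_of_nat by (auto simp: )
  ultimately show "(\<lambda>n. (g (x + inverse (real (Suc n)) *\<^sub>R Y x) - g x) / inverse (real (Suc n))) \<longlonglongrightarrow> vf_deriv Y g x"
    unfolding vf_deriv_def by (rule filterlim_compose)
qed

lemma divergence_scaleR:
  fixes Y :: "'a::euclidean_space \<Rightarrow> 'a"
  assumes g: "g differentiable (at x)" and Y: "Y differentiable (at x)"
  shows "divergence (\<lambda>x. g x *\<^sub>R Y x) x = vf_deriv Y g x + g x * divergence Y x"
proof -
  let ?g' = "frechet_derivative g (at x)" and ?Y' = "frechet_derivative Y (at x)"
  have dg: "(g has_derivative ?g') (at x)" and dY: "(Y has_derivative ?Y') (at x)"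
    using assms has_derivative_frechet_derivative by auto
  have "((\<lambda>x. g x *\<^sub>R Y x) has_derivative (\<lambda>v. g x *\<^sub>R ?Y' v + ?g' v *\<^sub>R Y x)) (at x)"
    using dg dY by (auto intro!: derivative_eq_intros)
  then have fd: "frechet_derivative (\<lambda>x. g x *\<^sub>R Y x) (at x) = (\<lambda>v. g x *\<^sub>R ?Y' v + ?g' v *\<^sub>R Y x)"
    using frechet_derivative_at by metis
  have lin: "linear ?g'" using has_derivative_bounded_linear[OF dg] by (rule bounded_linear.linear)
  have "?g' (Y x) = ?g' (\<Sum>b\<in>Basis. (Y x \<bullet> b) *\<^sub>R b)" by (simp only: euclidean_representation)
  also have "\<dots> = (\<Sum>b\<in>Basis. ?g' b * (Y x \<bullet> b))"
    using lin by (simp add: linear_sum linear_scale mult.commute)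
  finally show ?thesis
    unfolding divergence_def fd vf_deriv_def
    by (simp add: inner_add_left sum.distrib sum_distrib_left add.commute)
qed

text \<open>This is the divergence theorem for \<open>g Y\<close>. Integrability is asked of
  \<open>Y g\<close> only, so derivatives of \<open>g\<close> in other directions may be
  unbounded.\<close>

lemma integral_vf_deriv_eq_0:
  fixes Y :: "'a::euclidean_space \<Rightarrow> 'a"
  assumes g: "\<And>x. g differentiable (at x)" and supp: "bounded {x. g x \<noteq> 0}"
    and Y: "\<And>x. Y differentiable (at x)" and div: "\<And>x. divergence Y x = 0"
    and int: "integrable lborel (vf_deriv Y g)"
  shows "(\<integral>x. vf_deriv Y g x \<partial>lborel) = 0"
proof -
  have eq: "divergence (\<lambda>x. g x *\<^sub>R Y x) = vf_deriv Y g"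
    using divergence_scaleR[OF g Y] div by auto
  have hi: "(vf_deriv Y g has_integral (\<integral>x. vf_deriv Y g x \<partial>lborel)) UNIV"
    using int by (rule has_integral_integral_lborel)
  have "integral UNIV (divergence (\<lambda>x. g x *\<^sub>R Y x)) = 0"
  proof (rule integral_divergence_eq_0)
    show "(\<lambda>x. g x *\<^sub>R Y x) differentiable (at x)" for x
      using g Y by (intro differentiable_scaleR)
    show "bounded {x. g x *\<^sub>R Y x \<noteq> 0}" by (rule bounded_subset[OF supp]) auto
    show "divergence (\<lambda>x. g x *\<^sub>R Y x) integrable_on UNIV" unfolding eq using hi by blast
  qed
  then show ?thesis unfolding eq using hi integral_unique by metis
qed

section \<open>Calculus of \<open>Ck\<close> functions and the standard bump\<close>

lemma Ck_SucD: "Ck (Suc m) f \<Longrightarrow> Ck m f"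
proof (induction m arbitrary: f)
  case 0
  then show ?case by (auto intro: continuous_on_of_differentiable)
next
  case (Suc m)
  then show ?case by (metis Ck.simps(2))
qed

lemma Ck_const: "Ck m (\<lambda>x::'a::euclidean_space. c)"
proof (induction m arbitrary: c)
  case (Suc m)
  have "frechet_derivative (\<lambda>x::'a. c) (at x) = (\<lambda>v. 0)" for x by simp
  then show ?case using Suc by simp
qed auto

lemma Ck_add:
  fixes f g :: "'a::euclidean_space \<Rightarrow> 'b::real_normed_vector"
  shows "Ck m f \<Longrightarrow> Ck m g \<Longrightarrow> Ck m (\<lambda>x. f x + g x)"
proof (induction m arbitrary: f g)
  case 0
  then show ?case by (auto intro: continuous_on_add)
next
  case (Suc m)
  have "frechet_derivative (\<lambda>x. f x + g x) (at x) = (\<lambda>v. frechet_derivative f (at x) v + frechet_derivative g (at x) v)" for x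
    using Suc.prems by (intro frechet_derivative_at[symmetric] has_derivative_add has_derivative_frechet_derivative) auto
  then show ?case using Suc by (auto intro: differentiable_add)
qed

lemma Ck_mult:
  fixes f g :: "'a::euclidean_space \<Rightarrow> real"
  shows "Ck m f \<Longrightarrow> Ck m g \<Longrightarrow> Ck m (\<lambda>x. f x * g x)"
proof (induction m arbitrary: f g)
  case 0
  then show ?case by (auto intro: continuous_on_mult)
next
  case (Suc m)
  have "frechet_derivative (\<lambda>x. f x * g x) (at x)
      = (\<lambda>v. f x * frechet_derivative g (at x) v + frechet_derivative f (at x) v * g x)" for x
    using Suc.prems by (intro frechet_derivative_at[symmetric] has_derivative_mult has_derivative_frechet_derivative) auto
  then show ?case using Suc.prems Suc.IH Ck_SucD[OF Suc.prems(1)] Ck_SucD[OF Suc.prems(2)]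
    by (auto intro!: differentiable_mult Ck_add)
qed

lemma smooth_mult:
  fixes f g :: "'a::euclidean_space \<Rightarrow> real"
  shows "smooth f \<Longrightarrow> smooth g \<Longrightarrow> smooth (\<lambda>x. f x * g x)"
  by (simp add: smooth_def Ck_mult)

lemma Ck_affine: "Ck m (\<lambda>y::'a::euclidean_space. c + v \<bullet> y)"
proof (cases m)
  case 0
  then show ?thesis by (auto intro!: continuous_intros)
next
  case (Suc k)
  have d: "((\<lambda>y. c + v \<bullet> y) has_derivative (\<lambda>w. v \<bullet> w)) (at y)" for y :: 'a
    by (auto intro!: derivative_eq_intros)
  have "frechet_derivative (\<lambda>y. c + v \<bullet> y) (at y) = (\<lambda>w. v \<bullet> w)" for y :: 'a
    using d by (intro frechet_derivative_at[symmetric])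
  then show ?thesis using Suc d by (auto simp: Ck_const differentiable_def)
qed

lemma smooth_quadratic:
  "smooth (\<lambda>y::'a::euclidean_space. \<alpha> - \<beta> * (norm (x - y))\<^sup>2)"
  unfolding smooth_def
proof
  fix m
  let ?f = "\<lambda>y::'a. \<alpha> - \<beta> * (norm (x - y))\<^sup>2"
  have d: "(?f has_derivative (\<lambda>w. 2 * \<beta> * ((x - y) \<bullet> w))) (at y)" for y
    unfolding power2_norm_eq_inner
    by (auto intro!: derivative_eq_intros simp: inner_commute algebra_simps)
  then have fd: "frechet_derivative ?f (at y) = (\<lambda>w. 2 * \<beta> * ((x - y) \<bullet> w))" for y
    by (intro frechet_derivative_at[symmetric])
  show "Ck m ?f"
  proof (cases m)
    case 0
    then show ?thesis by (auto intro!: continuous_intros)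
  next
    case (Suc k)
    have "Ck k (\<lambda>y. 2 * \<beta> * ((x - y) \<bullet> w))" for w
      using Ck_affine[of k "2 * \<beta> * (x \<bullet> w)" "- (2 * \<beta>) *\<^sub>R w"] by (simp add: inner_diff_left algebra_simps inner_commute)
    then show ?thesis using Suc d unfolding Suc Ck.simps fd by (auto simp: differentiable_def)
  qed
qed

text \<open>The power \<open>k\<close> makes the family stable under differentiation: the derivative
  of a member is a combination of the members \<open>k + 1\<close> and \<open>k + 2\<close>.
  Smoothness of \<open>exp_bump 0\<close> thus follows by an induction in which \<open>k\<close>
  varies.\<close>

definition exp_bump :: "nat \<Rightarrow> real \<Rightarrow> real" where
  "exp_bump k t = (if t \<le> 0 then 0 else (1 / t) ^ k * exp (- (1 / t)))"

text \<open>With \<open>u = 1 / t\<close> the claim on the right of zero says that the exponential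
  beats every power.\<close>

lemma exp_bump_tendsto_0: "((exp_bump k) \<longlongrightarrow> 0) (at 0)"
proof -
  have "((\<lambda>u::real. u ^ k * exp (- u)) \<longlongrightarrow> 0) at_top"
    using tendsto_power_div_exp_0[of k] by (simp add: exp_minus divide_inverse)
  then have "((\<lambda>t::real. (inverse t) ^ k * exp (- inverse t)) \<longlongrightarrow> 0) (at_right 0)"
    by (rule filterlim_compose[OF _ filterlim_inverse_at_top_right])
  then have "((exp_bump k) \<longlongrightarrow> 0) (at_right 0)"
    by (rule Lim_transform_eventually)
       (auto simp: exp_bump_def eventually_at_right_less divide_inverse intro!: eventually_at_rightI[of 0 1])
  moreover have "((exp_bump k) \<longlongrightarrow> 0) (at_left 0)"
    by (rule Lim_transform_eventually[OF tendsto_const]) (auto simp: exp_bump_def intro!: eventually_at_leftI[of "-1"])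
  ultimately show ?thesis by (simp add: filterlim_split_at)
qed

lemma exp_bump_deriv:
  "(exp_bump k has_real_derivative (exp_bump (k + 2) t - real k * exp_bump (k + 1) t)) (at t)"
proof -
  consider "t < 0" | "t = 0" | "t > 0" by linarith
  then show ?thesis
  proof cases
    case 1
    have "((\<lambda>_. 0) has_real_derivative 0) (at t)" by simp
    then have "(exp_bump k has_real_derivative 0) (at t)"
      by (rule has_field_derivative_transform_within_open[where S="{..<0}"]) (use 1 in \<open>auto simp: exp_bump_def\<close>)
    then show ?thesis using 1 by (simp add: exp_bump_def)
  next
    case 2
    \<comment> \<open>At the origin the difference quotient of the member \<open>k\<close> is the
      member \<open>k + 1\<close> itself, which tends to zero.\<close>
    have "((\<lambda>h. (exp_bump k (0 + h) - exp_bump k 0) / h) \<longlongrightarrow> 0) (at 0)"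
      by (rule Lim_transform_eventually[OF exp_bump_tendsto_0[of "Suc k"]])
         (auto simp: exp_bump_def eventually_at_filter)
    then show ?thesis using 2 by (simp add: DERIV_def exp_bump_def)
  next
    case 3
    have "((\<lambda>t. (1 / t) ^ k * exp (- (1 / t))) has_real_derivative
        (exp_bump (k + 2) t - real k * exp_bump (k + 1) t)) (at t)"
    proof -
      have i: "((\<lambda>t. 1 / t) has_real_derivative - (1 / t) * (1 / t)) (at t)"
        using 3 by (auto intro!: derivative_eq_intros)
      have e: "((\<lambda>t. exp (- (1 / t))) has_real_derivative exp (- (1 / t)) * ((1 / t) * (1 / t))) (at t)"
        using DERIV_chain2[OF DERIV_exp DERIV_minus[OF i]] by simp
      have "real k * (- (1 / t) * (1 / t) * (1 / t) ^ (k - Suc 0)) * exp (- (1 / t))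
          + exp (- (1 / t)) * ((1 / t) * (1 / t)) * (1 / t) ^ k
          = exp_bump (k + 2) t - real k * exp_bump (k + 1) t"
        using 3 by (cases k) (simp_all add: exp_bump_def algebra_simps)
      with DERIV_mult[OF DERIV_power[OF i, of k] e] show ?thesis by simp
    qed
    then show ?thesis
      by (rule has_field_derivative_transform_within_open[where S="{0<..}"]) (use 3 in \<open>auto simp: exp_bump_def\<close>)
  qed
qed

lemma Ck_exp_bump:
  fixes u :: "'a::euclidean_space \<Rightarrow> real"
  assumes "smooth u"
  shows "Ck m (\<lambda>x. exp_bump k (u x))"
proof (induction m arbitrary: k)
  have u: "Ck m u" for m using assms by (simp add: smooth_def)
  have du: "(u has_derivative frechet_derivative u (at x)) (at x)" for x
    using u[of "Suc 0"] has_derivative_frechet_derivative by auto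
  have d: "((\<lambda>x. exp_bump k (u x)) has_derivative
     (\<lambda>v. (exp_bump (k + 2) (u x) + (- real k) * exp_bump (k + 1) (u x)) * frechet_derivative u (at x) v)) (at x)" for x k
    using has_derivative_compose[OF du[of x] exp_bump_deriv[of k "u x", unfolded has_field_derivative_def]] by simp
  {
    case 0
    have "(\<lambda>x. exp_bump k (u x)) differentiable (at x)" for x
      using d unfolding differentiable_def by blast
    then show ?case by (simp add: continuous_on_of_differentiable)
  next
    case (Suc m)
    have "frechet_derivative (\<lambda>x. exp_bump k (u x)) (at x)
       = (\<lambda>v. (exp_bump (k + 2) (u x) + (- real k) * exp_bump (k + 1) (u x)) * frechet_derivative u (at x) v)" for x
      using d by (intro frechet_derivative_at[symmetric])
    moreover have "Ck m (\<lambda>x. frechet_derivative u (at x) b)" if "b \<in> Basis" for b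
      using u[of "Suc m"] that by simp
    moreover have "(\<lambda>x. exp_bump k (u x)) differentiable (at x)" for x
      using d unfolding differentiable_def by blast
    moreover have "Ck m (\<lambda>x. exp_bump (k + 2) (u x) + (- real k) * exp_bump (k + 1) (u x))"
      by (intro Ck_add Ck_mult Ck_const Suc)
    ultimately show ?case by (simp only: Ck.simps) (auto intro: Ck_mult)
  }
qed

lemma exp_bump_nonneg: "0 \<le> exp_bump k t" by (simp add: exp_bump_def)

lemma continuous_on_exp_bump: "continuous_on S (exp_bump k)"
  using exp_bump_deriv DERIV_isCont by (blast intro: continuous_at_imp_continuous_on)

section \<open>Mollification\<close>

lemma integrable_lborel_continuous:
  fixes f :: "'a::euclidean_space \<Rightarrow> 'b::euclidean_space"
  assumes f: "continuous_on UNIV f" and "bounded {x. f x \<noteq> 0}"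
  shows "integrable lborel f"
proof -
  obtain R where R: "{x. f x \<noteq> 0} \<subseteq> cball 0 R"
    using assms(2) unfolding bounded_iff by (auto simp: subset_iff)
  have "integrable lborel (\<lambda>x. indicator (cball 0 R) x *\<^sub>R f x)"
    by (rule borel_integrable_compact) (use f continuous_on_subset in auto)
  moreover have "(\<lambda>x. indicator (cball 0 R) x *\<^sub>R f x) = f"
    using R by (auto simp: indicator_def fun_eq_iff)
  ultimately show ?thesis by simp
qed

lemma integral_lebesgue_eq_lborel:
  fixes f :: "'a::euclidean_space \<Rightarrow> real"
  shows "f \<in> borel_measurable borel \<Longrightarrow> (\<integral>x. f x \<partial>lebesgue) = (\<integral>x. f x \<partial>lborel)"
  by (simp add: integral_completion)

lemma integrable_lebesgue_continuous:
  fixes f :: "'a::euclidean_space \<Rightarrow> real"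
  assumes "continuous_on UNIV f" "bounded {x. f x \<noteq> 0}"
  shows "integrable lebesgue f"
  using integrable_lborel_continuous[OF assms] borel_measurable_continuous_onI[OF assms(1)]
  by (simp add: integrable_completion)

text \<open>The type argument carries the space, which the radius alone does not determine.\<close>

definition mollifier_mass :: "'a::euclidean_space itself \<Rightarrow> real \<Rightarrow> real" where
  "mollifier_mass _ r = (\<integral>z. exp_bump 0 (1 - (norm (z::'a))\<^sup>2 / r\<^sup>2) \<partial>lborel)"

definition mollifier :: "real \<Rightarrow> 'a::euclidean_space \<Rightarrow> real" where
  "mollifier r z = exp_bump 0 (1 - (norm z)\<^sup>2 / r\<^sup>2) / mollifier_mass TYPE('a) r"

text \<open>This is the radial factor of the gradient: the gradient of \<open>mollifier r\<close> at
  \<open>z\<close> is this number times \<open>z\<close>. The index 2 arises from differentiating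
  \<open>exp_bump 0\<close>.\<close>

definition mollifier_slope :: "real \<Rightarrow> 'a::euclidean_space \<Rightarrow> real" where
  "mollifier_slope r z = - 2 / r\<^sup>2 * exp_bump 2 (1 - (norm z)\<^sup>2 / r\<^sup>2) / mollifier_mass TYPE('a) r"

lemma bump_zero: "0 < r \<Longrightarrow> r \<le> norm z \<Longrightarrow> exp_bump k (1 - (norm z)\<^sup>2 / r\<^sup>2) = 0"
  by (simp add: exp_bump_def power_mono)

lemma continuous_on_bump: "continuous_on S (\<lambda>z. exp_bump k (1 - (norm z)\<^sup>2 / r\<^sup>2))"
  unfolding divide_inverse by (intro continuous_on_compose2[OF continuous_on_exp_bump[of UNIV]] continuous_intros) auto

lemma integrable_bump:
  assumes "0 < r"
  shows "integrable lborel (\<lambda>z::'a::euclidean_space. exp_bump k (1 - (norm z)\<^sup>2 / r\<^sup>2))"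
proof (rule integrable_lborel_continuous)
  show "bounded {z::'a. exp_bump k (1 - (norm z)\<^sup>2 / r\<^sup>2) \<noteq> 0}"
    by (rule bounded_subset[of "ball 0 r"], simp, rule subsetI, rule ccontr) (auto simp: bump_zero[OF assms])
qed (rule continuous_on_bump)

text \<open>On the ball of half the radius the argument of the bump is at least 3/4, hence the bump
  is at least \<open>exp (-(4/3))\<close>; halving the radius costs the factor
  \<open>2 ^ DIM('a)\<close>. The bound is proportional to the volume of the ball, so that the
  constants below do not depend on \<open>r\<close>.\<close>

lemma mollifier_mass_ge:
  assumes r: "0 < r"
  shows "exp (-(4/3)) / 2 ^ DIM('a) * measure lborel (ball (0::'a::euclidean_space) r) \<le> mollifier_mass TYPE('a) r"
proof -
  have "exp (-(4/3)) / 2 ^ DIM('a) * measure lborel (ball (0::'a) r) = exp (-(4/3)) * measure lborel (ball (0::'a) (r/2))"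
    using r by (simp add: content_ball power_divide)
  also have "\<dots> = (\<integral>z. exp (-(4/3)) * indicator (ball (0::'a) (r/2)) z \<partial>lborel)" by simp
  also have "\<dots> \<le> mollifier_mass TYPE('a) r"
    unfolding mollifier_mass_def
  proof (rule integral_mono)
    show "integrable lborel (\<lambda>z. exp (-(4/3)) * indicator (ball (0::'a) (r/2)) z :: real)"
      by (intro integrable_mult_right integrable_real_indicator) (auto simp: emeasure_ball r less_imp_le)
    show "integrable lborel (\<lambda>z::'a. exp_bump 0 (1 - (norm z)\<^sup>2 / r\<^sup>2))" by (rule integrable_bump[OF r])
    fix z :: 'a
    show "exp (-(4/3)) * indicator (ball (0::'a) (r/2)) z \<le> exp_bump 0 (1 - (norm z)\<^sup>2 / r\<^sup>2)"
    proof (cases "norm z < r / 2")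
      case True
      have "(norm z)\<^sup>2 \<le> (r/2)\<^sup>2" using True by (intro power_mono) auto
      then have *: "3/4 \<le> 1 - (norm z)\<^sup>2 / r\<^sup>2" using r by (simp add: field_simps power2_eq_square)
      define t where "t = 1 - (norm z)\<^sup>2 / r\<^sup>2"
      have t: "3/4 \<le> t" using * by (simp add: t_def)
      then have "1 / t \<le> 4/3" by (simp add: field_simps)
      then show ?thesis using True t unfolding exp_bump_def t_def[symmetric] by (auto simp: indicator_def)
    qed (auto simp: exp_bump_nonneg)
  qed
  finally show ?thesis .
qed

lemma mollifier_mass_pos: "0 < r \<Longrightarrow> 0 < mollifier_mass TYPE('a::euclidean_space) r"
  using mollifier_mass_ge[of r, where 'a='a]
  by (smt (verit, best) content_ball_gt_0_iff divide_pos_pos exp_gt_zero mult_pos_pos zero_less_numeral zero_less_power)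

lemma mollifier_nonneg: "0 < r \<Longrightarrow> 0 \<le> mollifier r (z::'a::euclidean_space)"
  using mollifier_mass_pos[of r, where 'a='a] by (simp add: mollifier_def exp_bump_nonneg)

lemma mollifier_eq_0: "0 < r \<Longrightarrow> r \<le> norm z \<Longrightarrow> mollifier r z = 0"
  by (simp add: mollifier_def bump_zero)

lemma mollifier_slope_eq_0: "0 < r \<Longrightarrow> r \<le> norm z \<Longrightarrow> mollifier_slope r z = 0"
  by (simp add: mollifier_slope_def bump_zero)

lemma mollifier_commute: "mollifier r (x - y) = mollifier r (y - x)"
  by (simp add: mollifier_def norm_minus_commute)

lemma continuous_on_mollifier: "continuous_on S (mollifier r)"
  unfolding mollifier_def divide_inverse[of _ "mollifier_mass _ _"]
  by (intro continuous_intros continuous_on_bump)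

lemma continuous_on_mollifier_slope: "continuous_on S (mollifier_slope r)"
  unfolding mollifier_slope_def divide_inverse[of _ "mollifier_mass _ _"]
  by (intro continuous_intros continuous_on_bump)

lemma mollifier_has_derivative:
  "(mollifier r has_derivative (\<lambda>v. mollifier_slope r z * (z \<bullet> v))) (at (z::'a::euclidean_space))"
proof -
  let ?u = "\<lambda>z::'a. 1 - (norm z)\<^sup>2 / r\<^sup>2"
  have u: "(?u has_derivative (\<lambda>v. - 2 * (z \<bullet> v) / r\<^sup>2)) (at z)"
    unfolding power2_norm_eq_inner divide_inverse
    by (auto intro!: derivative_eq_intros simp: inner_commute algebra_simps)
  have "((\<lambda>z. exp_bump 0 (?u z)) has_derivative (\<lambda>v. exp_bump 2 (?u z) * (- 2 * (z \<bullet> v) / r\<^sup>2))) (at z)"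
    using has_derivative_compose[OF u exp_bump_deriv[of 0 "?u z", unfolded has_field_derivative_def]]
    by (simp add: numeral_2_eq_2)
  from has_derivative_mult_left[OF this, of "inverse (mollifier_mass TYPE('a) r)"] show ?thesis
    unfolding mollifier_def mollifier_slope_def divide_inverse by (simp add: mult_ac)
qed

text \<open>The slope is of order \<open>1 / r\<^sup>2\<close> over the volume of the ball, and the
  inner product with \<open>z\<close> gains one factor \<open>r\<close>, since the slope vanishes
  for \<open>norm z\<close> at least \<open>r\<close>. The remaining \<open>1 / r\<close> is what a
  Lipschitz bound on \<open>v\<close> will cancel in the commutator; \<open>M\<close> is independent
  of \<open>r\<close>.\<close>

lemma mollifier_slope_bound:
  "\<exists>M>0. \<forall>r>0. \<forall>z v::'a::euclidean_space.
     \<bar>mollifier_slope r z * (z \<bullet> v)\<bar> \<le> M / (r * measure lborel (ball (0::'a) r)) * norm v"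
proof -
  have "compact (exp_bump 2 ` {0..1})"
    by (intro compact_continuous_image continuous_on_exp_bump) auto
  then obtain H where H: "\<And>t. t \<in> {0..1} \<Longrightarrow> \<bar>exp_bump 2 t\<bar> \<le> H"
    using compact_imp_bounded bounded_real by (metis (no_types, lifting) imageI)
  \<comment> \<open>The argument of the bump never exceeds 1 and the bump vanishes for negative
    arguments, so a bound on the compact unit interval suffices.\<close>
  have H1: "\<bar>exp_bump 2 t\<bar> \<le> \<bar>H\<bar> + 1" if "t \<le> 1" for t
    using H[of t] that by (cases "0 \<le> t") (auto simp: exp_bump_def)
  define c :: real where "c = exp (-(4/3)) / 2 ^ DIM('a)"
  have c: "0 < c" by (simp add: c_def)
  define M where "M = 2 * (\<bar>H\<bar> + 1) / c"
  have "\<bar>mollifier_slope r z * (z \<bullet> v)\<bar> \<le> M / (r * measure lborel (ball (0::'a) r)) * norm v"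
    if r: "0 < r" for r and z v :: 'a
  proof (cases "r \<le> norm z")
    case True
    then show ?thesis using r c by (simp add: mollifier_slope_eq_0 M_def)
  next
    case False
    let ?m = "mollifier_mass TYPE('a) r" and ?B = "measure lborel (ball (0::'a) r)"
    have B: "0 < ?B" using r by simp
    have m: "c * ?B \<le> ?m" unfolding c_def using mollifier_mass_ge[OF r] by simp
    have "\<bar>mollifier_slope r z\<bar> = 2 / r\<^sup>2 * \<bar>exp_bump 2 (1 - (norm z)\<^sup>2 / r\<^sup>2)\<bar> / ?m"
      using mollifier_mass_pos[OF r, where 'a='a] by (simp add: mollifier_slope_def abs_mult)
    also have "\<dots> \<le> 2 / r\<^sup>2 * (\<bar>H\<bar> + 1) / (c * ?B)"
      using m c B r H1 by (intro frac_le mult_left_mono mult_nonneg_nonneg) auto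
    finally have s: "\<bar>mollifier_slope r z\<bar> \<le> 2 / r\<^sup>2 * (\<bar>H\<bar> + 1) / (c * ?B)" .
    have zv: "\<bar>z \<bullet> v\<bar> \<le> r * norm v"
      using Cauchy_Schwarz_ineq2[of z v] False by (meson less_imp_le mult_right_mono norm_ge_zero not_le order_trans)
    have "\<bar>mollifier_slope r z * (z \<bullet> v)\<bar> \<le> (2 / r\<^sup>2 * (\<bar>H\<bar> + 1) / (c * ?B)) * (r * norm v)"
      unfolding abs_mult by (rule mult_mono[OF s zv]) (use c B in auto)
    also have "\<dots> = M / (r * ?B) * norm v" using r by (simp add: M_def power2_eq_square)
    finally show ?thesis .
  qed
  moreover have "0 < M" using c by (simp add: M_def)
  ultimately show ?thesis by blast
qed

lemma bounded_mollifier_support: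
  assumes "0 < r"
  shows "bounded {y. mollifier r (x - y) * f y \<noteq> (0::real)}"
  by (rule bounded_subset[of "ball x r"], simp, rule subsetI, rule ccontr)
     (auto simp: dist_norm mollifier_eq_0[OF assms])

lemma bounded_mollifier_slope_support:
  assumes "0 < r"
  shows "bounded {y. mollifier_slope r (x - y) * f y \<noteq> (0::real)}"
  by (rule bounded_subset[of "ball x r"], simp, rule subsetI, rule ccontr)
     (auto simp: dist_norm mollifier_slope_eq_0[OF assms])

lemma continuous_on_mollifier_diff: "continuous_on S (\<lambda>y. mollifier r (x - y))"
  by (intro continuous_on_compose2[OF continuous_on_mollifier[of UNIV]] continuous_intros) auto

lemma continuous_on_mollifier_slope_diff: "continuous_on S (\<lambda>y. mollifier_slope r (x - y))"
  by (intro continuous_on_compose2[OF continuous_on_mollifier_slope[of UNIV]] continuous_intros) auto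

lemma integrable_mollifier_mult:
  fixes f :: "'a::euclidean_space \<Rightarrow> real"
  assumes "0 < r" "continuous_on UNIV f"
  shows "integrable lebesgue (\<lambda>y. mollifier r (x - y) * f y)"
  using assms by (intro integrable_lebesgue_continuous bounded_mollifier_support continuous_on_mult
      continuous_on_mollifier_diff)

lemma integrable_mollifier_slope_mult:
  fixes f :: "'a::euclidean_space \<Rightarrow> real"
  assumes "0 < r" "continuous_on UNIV f"
  shows "integrable lebesgue (\<lambda>y. mollifier_slope r (x - y) * f y)"
  using assms by (intro integrable_lebesgue_continuous bounded_mollifier_slope_support continuous_on_mult
      continuous_on_mollifier_slope_diff)

lemma integral_mollifier:
  fixes x :: "'a::euclidean_space"
  assumes r: "0 < r"
  shows "(\<integral>y. mollifier r (x - y) \<partial>lebesgue) = 1"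
proof -
  have "(\<integral>z. mollifier r (z::'a) \<partial>lborel) = 1"
    unfolding mollifier_def using mollifier_mass_pos[OF r, where 'a='a]
    by (simp add: mollifier_mass_def)
  moreover have "(\<integral>z. mollifier r (z::'a) \<partial>lborel) = (\<integral>y. mollifier r (- x + y) \<partial>lborel)"
    by (subst lborel_distr_plus[of "- x", symmetric], rule integral_distr)
       (auto intro!: borel_measurable_continuous_onI continuous_on_mollifier)
  moreover have "\<dots> = (\<integral>y. mollifier r (x - y) \<partial>lborel)"
    by (simp add: mollifier_commute[of r x] add.commute)
  moreover have "\<dots> = (\<integral>y. mollifier r (x - y) \<partial>lebesgue)"
    by (intro integral_lebesgue_eq_lborel[symmetric] borel_measurable_continuous_onI continuous_on_mollifier_diff)
  ultimately show ?thesis by simp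
qed

lemma test_fun_mollifier:
  fixes x :: "'a::euclidean_space"
  assumes r: "0 < r"
  shows "test_fun UNIV (\<lambda>y. mollifier r (x - y))"
proof -
  let ?m = "mollifier_mass TYPE('a) r"
  have "smooth (\<lambda>y. exp_bump 0 (1 - 1 / r\<^sup>2 * (norm (x - y))\<^sup>2))"
    unfolding smooth_def by (intro allI Ck_exp_bump smooth_quadratic)
  moreover have "smooth (\<lambda>y::'a. 1 / ?m)" by (simp add: smooth_def Ck_const)
  ultimately have "smooth (\<lambda>y. exp_bump 0 (1 - 1 / r\<^sup>2 * (norm (x - y))\<^sup>2) * (1 / ?m))" by (rule smooth_mult)
  moreover have "compact (closure {y. mollifier r (x - y) \<noteq> 0})"
    using bounded_mollifier_support[OF r, of x "\<lambda>_. 1"] by (simp add: compact_closure)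
  ultimately show ?thesis by (simp add: test_fun_def mollifier_def)
qed

lemma vf_deriv_mollifier:
  "vf_deriv Y (\<lambda>y. mollifier r (x - y)) y = - (mollifier_slope r (x - y) * ((x - y) \<bullet> Y y))"
proof -
  have "((\<lambda>y. mollifier r (x - y)) has_derivative (\<lambda>v. mollifier_slope r (x - y) * ((x - y) \<bullet> (- v)))) (at y)"
    by (rule has_derivative_compose[OF _ mollifier_has_derivative]) (auto intro!: derivative_eq_intros)
  from vf_deriv_eq[OF this] show ?thesis by simp
qed

section \<open>Mollified functions and their commutator with a vector field\<close>

definition mollify :: "real \<Rightarrow> ('a::euclidean_space \<Rightarrow> real) \<Rightarrow> 'a \<Rightarrow> real" where
  "mollify r f x = (\<integral>y. mollifier r (x - y) * f y \<partial>lebesgue)"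

lemma mollify_close:
  fixes f :: "'a::euclidean_space \<Rightarrow> real"
  assumes r: "0 < r" and f: "continuous_on UNIV f"
    and W: "\<And>y. norm (y - x) \<le> r \<Longrightarrow> \<bar>f y - f x\<bar> \<le> W"
  shows "\<bar>mollify r f x - f x\<bar> \<le> W"
proof -
  have i1: "integrable lebesgue (\<lambda>y. mollifier r (x - y) * (f y - f x))"
    by (intro integrable_mollifier_mult r continuous_intros f)
  have i2: "integrable lebesgue (\<lambda>y. mollifier r (x - y) * c)" for c
    by (intro integrable_mollifier_mult r continuous_intros)
  have i3: "(\<integral>y. mollifier r (x - y) * c \<partial>lebesgue) = c" for c
    by (simp only: Bochner_Integration.integral_mult_left_zero integral_mollifier[OF r] mult_1)
  have "mollify r f x - f x = (\<integral>y. mollifier r (x - y) * f y \<partial>lebesgue) - (\<integral>y. mollifier r (x - y) * f x \<partial>lebesgue)"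
    by (simp only: mollify_def i3)
  also have "\<dots> = (\<integral>y. mollifier r (x - y) * (f y - f x) \<partial>lebesgue)"
    unfolding right_diff_distrib
    by (intro Bochner_Integration.integral_diff[symmetric] integrable_mollifier_mult r f i2)
  finally have "\<bar>mollify r f x - f x\<bar> \<le> (\<integral>y. \<bar>mollifier r (x - y) * (f y - f x)\<bar> \<partial>lebesgue)"
    using integral_abs_bound by metis
  also have "\<dots> \<le> (\<integral>y. mollifier r (x - y) * W \<partial>lebesgue)"
  proof (rule integral_mono)
    show "integrable lebesgue (\<lambda>y. \<bar>mollifier r (x - y) * (f y - f x)\<bar>)" using i1 by (rule integrable_abs)
    show "\<bar>mollifier r (x - y) * (f y - f x)\<bar> \<le> mollifier r (x - y) * W" for y
    proof (cases "r \<le> norm (x - y)")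
      case False
      then show ?thesis using W[of y] mollifier_nonneg[OF r, of "x - y"]
        by (auto simp: abs_mult norm_minus_commute intro!: mult_left_mono)
    qed (simp add: mollifier_eq_0[OF r])
  qed (rule i2)
  also have "\<dots> = W" by (rule i3)
  finally show ?thesis .
qed

lemma mollify_has_derivative:
  fixes f :: "'a::euclidean_space \<Rightarrow> real"
  assumes r: "0 < r" and f: "continuous_on UNIV f"
  shows "(mollify r f has_derivative (\<lambda>v. \<integral>y. mollifier_slope r (x - y) * (((x - y) \<bullet> v) * f y) \<partial>lebesgue)) (at x)"
proof -
  \<comment> \<open>Differentiation under the integral needs a fixed box. The extra 1 makes this box
    contain the support of the kernel for all centres in the unit ball around
    \<open>x\<close>.\<close>
  obtain a where a: "ball x (1 + r) \<subseteq> cbox (-a) a"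
    using bounded_subset_cbox_symmetric[of "ball x (1 + r)"] by auto
  have conv: "integral (cbox (-a) a) g = (\<integral>y. g y \<partial>lebesgue)"
    if "continuous_on UNIV g" "\<And>y. y \<notin> ball x (1 + r) \<Longrightarrow> g y = 0" for g :: "'a \<Rightarrow> real"
  proof -
    have "bounded {y. g y \<noteq> 0}" by (rule bounded_subset[of "ball x (1 + r)"]) (use that(2) in force)+
    then have "integrable lborel g" using that(1) by (intro integrable_lborel_continuous)
    then have "(g has_integral (\<integral>y. g y \<partial>lborel)) UNIV" by (rule has_integral_integral_lborel)
    moreover have "(\<lambda>y. if y \<in> cbox (-a) a then g y else 0) = g"
    proof
      fix y show "(if y \<in> cbox (-a) a then g y else 0) = g y" using that(2)[of y] a by (cases "y \<in> ball x (1 + r)") auto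
    qed
    ultimately have "(g has_integral (\<integral>y. g y \<partial>lborel)) (cbox (-a) a)"
      by (subst has_integral_restrict_UNIV[symmetric]) simp
    then show ?thesis using that(1) by (simp add: integral_unique integral_lebesgue_eq_lborel borel_measurable_continuous_onI)
  qed
  define fx where "fx x y = (mollifier_slope r (x - y) * f y) *\<^sub>R blinfun_inner_right (x - y)" for x y :: 'a
  have "((\<lambda>x. integral (cbox (-a) a) (\<lambda>y. mollifier r (x - y) * f y)) has_derivative
      integral (cbox (-a) a) (fx x)) (at x within ball x 1)"
  proof (rule leibniz_rule)
    fix x' t :: 'a
    have "((\<lambda>x. mollifier r (x - t)) has_derivative (\<lambda>v. mollifier_slope r (x' - t) * ((x' - t) \<bullet> v))) (at x')"
      by (rule has_derivative_compose[OF _ mollifier_has_derivative]) (auto intro!: derivative_eq_intros)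
    note d1 = has_derivative_mult_left[OF this, of "f t"]
    have "(\<lambda>v. mollifier_slope r (x' - t) * ((x' - t) \<bullet> v) * f t) = blinfun_apply (fx x' t)"
      by (simp add: fun_eq_iff fx_def blinfun.scaleR_left mult_ac)
    from d1[unfolded this]
    show "((\<lambda>x. mollifier r (x - t) * f t) has_derivative blinfun_apply (fx x' t)) (at x' within ball x 1)"
      by (rule has_derivative_at_withinI)
    show "(\<lambda>y. mollifier r (x' - y) * f y) integrable_on cbox (-a) a"
      using f by (intro integrable_continuous continuous_on_mult continuous_on_mollifier_diff) (auto intro: continuous_on_subset)
  next
    have "continuous_on (ball x 1 \<times> cbox (-a) a) (\<lambda>z. fx (fst z) (snd z))"
      unfolding fx_def
      by (intro continuous_intros continuous_on_compose2[OF continuous_on_mollifier_slope[of UNIV]]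
        continuous_on_compose2[OF f] bounded_linear.continuous_on[OF bounded_linear_blinfun_inner_right]) auto
    then show "continuous_on (ball x 1 \<times> cbox (-a) a) (\<lambda>(x, t). fx x t)" by (simp add: case_prod_beta)
  qed auto
  then have d: "((\<lambda>x. integral (cbox (-a) a) (\<lambda>y. mollifier r (x - y) * f y)) has_derivative
      integral (cbox (-a) a) (fx x)) (at x)"
    by (subst (asm) at_within_open) auto
  have eq: "integral (cbox (-a) a) (\<lambda>y. mollifier r (x' - y) * f y) = mollify r f x'" if "x' \<in> ball x 1" for x'
    unfolding mollify_def
  proof (rule conv)
    fix y assume "y \<notin> ball x (1 + r)"
    then have "r \<le> norm (x' - y)" using that dist_triangle[of x y x'] by (auto simp: dist_norm)
    then show "mollifier r (x' - y) * f y = 0" by (simp add: mollifier_eq_0[OF r])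
  qed (intro continuous_on_mult continuous_on_mollifier_diff f)
  have d2: "(mollify r f has_derivative integral (cbox (-a) a) (fx x)) (at x)"
    by (rule has_derivative_transform_within_open[OF d, of "ball x 1"]) (use eq in auto)
  have fxint: "fx x integrable_on cbox (-a) a"
    unfolding fx_def
    by (intro integrable_continuous continuous_intros continuous_on_mollifier_slope_diff
        continuous_on_subset[OF f] bounded_linear.continuous_on[OF bounded_linear_blinfun_inner_right]) auto
  have "blinfun_apply (integral (cbox (-a) a) (fx x)) v
      = (\<integral>y. mollifier_slope r (x - y) * (((x - y) \<bullet> v) * f y) \<partial>lebesgue)" for v
  proof -
    have "blinfun_apply (integral (cbox (-a) a) (fx x)) v = integral (cbox (-a) a) (\<lambda>y. blinfun_apply (fx x y) v)"
      by (rule blinfun_apply_integral[OF fxint])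
    also have "\<dots> = integral (cbox (-a) a) (\<lambda>y. mollifier_slope r (x - y) * (((x - y) \<bullet> v) * f y))"
      by (simp add: fx_def blinfun.scaleR_left mult_ac)
    also have "\<dots> = (\<integral>y. mollifier_slope r (x - y) * (((x - y) \<bullet> v) * f y) \<partial>lebesgue)"
    proof (rule conv)
      fix y assume "y \<notin> ball x (1 + r)"
      then have "r \<le> norm (x - y)" by (auto simp: dist_norm)
      then show "mollifier_slope r (x - y) * (((x - y) \<bullet> v) * f y) = 0" by (simp add: mollifier_slope_eq_0[OF r])
    qed (intro continuous_intros continuous_on_mollifier_slope_diff f)
    finally show ?thesis .
  qed
  then have "blinfun_apply (integral (cbox (-a) a) (fx x))
      = (\<lambda>v. \<integral>y. mollifier_slope r (x - y) * (((x - y) \<bullet> v) * f y) \<partial>lebesgue)" by (rule ext)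
  from d2[unfolded this] show ?thesis .
qed

text \<open>Friedrichs' commutator estimate. Since \<open>Y\<close> has zero divergence, the kernel
  \<open>(x - y) \<bullet> (Y x - Y y)\<close> times the slope has integral zero, so \<open>f y\<close> may be replaced by
  \<open>f y - f x\<close>.\<close>

lemma commutator_bound:
  fixes f :: "'a::euclidean_space \<Rightarrow> real" and Y :: "'a \<Rightarrow> 'a"
  assumes M: "\<And>z v::'a. \<bar>mollifier_slope r z * (z \<bullet> v)\<bar> \<le> M / (r * measure lborel (ball (0::'a) r)) * norm v"
    and M0: "0 \<le> M" and L0: "0 \<le> L"
    and r: "0 < r" and f: "continuous_on UNIV f"
    and Y: "\<And>x. Y differentiable (at x)" and div: "\<And>x. divergence Y x = 0"
    and weak: "has_weak_deriv Y f F"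
    and L: "\<And>y. norm (y - x) \<le> r \<Longrightarrow> norm (Y y - Y x) \<le> L * norm (y - x)"
    and W: "\<And>y. norm (y - x) \<le> r \<Longrightarrow> \<bar>f y - f x\<bar> \<le> W"
  shows "\<bar>vf_deriv Y (mollify r f) x - mollify r F x\<bar> \<le> M * L * W"
proof -
  have Yc: "continuous_on S Y" for S using Y by (rule continuous_on_of_differentiable)
  define k where "k v y = mollifier_slope r (x - y) * ((x - y) \<bullet> v)" for v y
  have cont: "continuous_on UNIV (\<lambda>y. ((x - y) \<bullet> (Y x - Y y)) * g y)"
       "continuous_on UNIV (\<lambda>y. ((x - y) \<bullet> Y y) * g y)"
       "continuous_on UNIV (\<lambda>y. ((x - y) \<bullet> Y x) * g y)" if "continuous_on UNIV g" for g :: "'a \<Rightarrow> real"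
    by (intro continuous_intros Yc that)+
  have ints: "integrable lebesgue (\<lambda>y. k (Y x - Y y) y * g y)"
       "integrable lebesgue (\<lambda>y. k (Y y) y * g y)" "integrable lebesgue (\<lambda>y. k (Y x) y * g y)"
    if "continuous_on UNIV g" for g :: "'a \<Rightarrow> real"
    using integrable_mollifier_slope_mult[OF r cont(1)[OF that], of x] integrable_mollifier_slope_mult[OF r cont(2)[OF that], of x]
      integrable_mollifier_slope_mult[OF r cont(3)[OF that], of x]
    by (simp_all add: k_def mult.assoc)
  \<comment> \<open>The kernel \<open>y \<mapsto> mollifier r (x - y)\<close> is itself a test
    function, so the definition of the weak derivative moves \<open>Y\<close> onto it. The field is
    then evaluated at \<open>y\<close>, whereas differentiating the mollification evaluates it at
    \<open>x\<close>.\<close>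
  have 1: "mollify r F x = (\<integral>y. k (Y y) y * f y \<partial>lebesgue)"
  proof -
    have "(\<integral>y. F y * mollifier r (x - y) \<partial>lebesgue)
        = - (\<integral>y. f y * vf_deriv Y (\<lambda>y. mollifier r (x - y)) y \<partial>lebesgue)"
      using weak test_fun_mollifier[OF r, of x] unfolding has_weak_deriv_def by blast
    then show ?thesis by (simp add: mollify_def vf_deriv_mollifier k_def mult.commute)
  qed
  have 2: "vf_deriv Y (mollify r f) x = (\<integral>y. k (Y x) y * f y \<partial>lebesgue)"
    using vf_deriv_eq[OF mollify_has_derivative[OF r f]] by (simp add: k_def mult.assoc)
  \<comment> \<open>The field \<open>y \<mapsto> Y x - Y y\<close> has zero divergence too, and the
    integrand is minus its action on the kernel.\<close>
  have 3: "(\<integral>y. k (Y x - Y y) y \<partial>lebesgue) = 0"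
  proof -
    let ?U = "\<lambda>y. Y x - Y y"
    have eq: "vf_deriv ?U (\<lambda>y. mollifier r (x - y)) = (\<lambda>y. - k (Y x - Y y) y)"
      by (simp add: fun_eq_iff vf_deriv_mollifier k_def)
    have fdU: "frechet_derivative ?U (at y) = (\<lambda>v. - frechet_derivative Y (at y) v)" for y
      using has_derivative_diff[OF has_derivative_const has_derivative_frechet_derivative[OF Y]]
      by (intro frechet_derivative_at[symmetric]) auto
    have meas: "(\<lambda>y. k (Y x - Y y) y) \<in> borel_measurable borel"
      unfolding k_def by (intro borel_measurable_continuous_onI continuous_intros continuous_on_mollifier_slope_diff Yc)
    have il: "integrable lborel (\<lambda>y. k (Y x - Y y) y)"
      using ints(1)[of "\<lambda>_. 1"] meas by (simp add: integrable_completion)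
    have "(\<integral>y. vf_deriv ?U (\<lambda>y. mollifier r (x - y)) y \<partial>lborel) = 0"
    proof (rule integral_vf_deriv_eq_0)
      show "(\<lambda>y. mollifier r (x - y)) differentiable (at y)" for y
        using test_fun_mollifier[OF r, of x] unfolding test_fun_def smooth_def by (metis Ck.simps(2))
      show "bounded {y. mollifier r (x - y) \<noteq> 0}" using bounded_mollifier_support[OF r, of x "\<lambda>_. 1"] by simp
      show "?U differentiable (at y)" for y using Y by (intro differentiable_diff) auto
      show "divergence ?U y = 0" for y
        using div[of y] unfolding divergence_def fdU by (simp add: sum_negf)
      show "integrable lborel (vf_deriv ?U (\<lambda>y. mollifier r (x - y)))" unfolding eq using il by simp
    qed
    then show ?thesis using meas unfolding eq by (simp add: integral_lebesgue_eq_lborel)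
  qed
  have "vf_deriv Y (mollify r f) x - mollify r F x = (\<integral>y. k (Y x) y * f y - k (Y y) y * f y \<partial>lebesgue)"
    unfolding 1 2 using ints[OF f] by simp
  also have "\<dots> = (\<integral>y. k (Y x - Y y) y * (f y - f x) + f x * k (Y x - Y y) y \<partial>lebesgue)"
    by (rule Bochner_Integration.integral_cong) (auto simp: k_def inner_diff_right algebra_simps)
  also have "\<dots> = (\<integral>y. k (Y x - Y y) y * (f y - f x) \<partial>lebesgue) + (\<integral>y. f x * k (Y x - Y y) y \<partial>lebesgue)"
    using ints(1)[of "\<lambda>_. 1"] f
    by (intro Bochner_Integration.integral_add ints continuous_intros) auto
  also have "\<dots> = (\<integral>y. k (Y x - Y y) y * (f y - f x) \<partial>lebesgue)" using 3 by simp
  finally have "\<bar>vf_deriv Y (mollify r f) x - mollify r F x\<bar> \<le> (\<integral>y. \<bar>k (Y x - Y y) y * (f y - f x)\<bar> \<partial>lebesgue)"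
    using integral_abs_bound by metis
  also have "\<dots> \<le> (\<integral>y. (M * L * W / measure lborel (ball (0::'a) r)) * indicator (ball x r) y \<partial>lebesgue)"
  proof (rule integral_mono)
    show "integrable lebesgue (\<lambda>y. \<bar>k (Y x - Y y) y * (f y - f x)\<bar>)"
      using f by (intro integrable_abs ints continuous_intros)
    show "integrable lebesgue (\<lambda>y. (M * L * W / measure lborel (ball (0::'a) r)) * indicator (ball x r) y)"
      by (intro integrable_mult_right integrable_real_indicator) (auto simp: emeasure_ball r less_imp_le)
    fix y
    show "\<bar>k (Y x - Y y) y * (f y - f x)\<bar> \<le> (M * L * W / measure lborel (ball (0::'a) r)) * indicator (ball x r) y"
    proof (cases "y \<in> ball x r")
      case False
      then have "r \<le> norm (x - y)" by (simp add: dist_norm)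
      then show ?thesis using False by (simp add: k_def mollifier_slope_eq_0[OF r])
    next
      case True
      then have n: "norm (y - x) \<le> r" by (simp add: dist_norm norm_minus_commute)
      have W0: "0 \<le> W" using W[of x] r by simp
      have B: "0 < measure lborel (ball (0::'a) r)" using r by simp
      have "L * norm (y - x) \<le> L * r" using n L0 by (intro mult_left_mono) auto
      then have L1: "norm (Y x - Y y) \<le> L * r"
        using L[OF n] by (simp add: norm_minus_commute)
      have "\<bar>k (Y x - Y y) y\<bar> \<le> M / (r * measure lborel (ball (0::'a) r)) * norm (Y x - Y y)"
        unfolding k_def by (rule M)
      also have "\<dots> \<le> M / (r * measure lborel (ball (0::'a) r)) * (L * r)"
        using L1 M0 r B by (intro mult_left_mono) auto
      also have "\<dots> = M * L / measure lborel (ball (0::'a) r)" using r by simp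
      \<comment> \<open>The factor \<open>r\<close> from the Lipschitz bound has cancelled the
        \<open>1 / r\<close> of the slope. What remains is constant on the ball and integrates to
        \<open>M * L\<close>, whatever the scale.\<close>
      finally have kb: "\<bar>k (Y x - Y y) y\<bar> \<le> M * L / measure lborel (ball (0::'a) r)" .
      have "\<bar>k (Y x - Y y) y * (f y - f x)\<bar> \<le> (M * L / measure lborel (ball (0::'a) r)) * W"
        unfolding abs_mult by (rule mult_mono[OF kb W[OF n]]) (use kb abs_ge_zero order_trans in \<open>blast+\<close>)
      then show ?thesis using True by simp
    qed
  qed
  also have "\<dots> = M * L * W"
  proof -
    have "measure lborel (ball x r) = measure lborel (ball (0::'a) r)"
      using r by (simp add: content_ball)
    then show ?thesis using r content_ball_gt_0_iff[of "0::'a" r] by simp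
  qed
  finally show ?thesis .
qed

section \<open>Pairings of locally integrable functions with compactly supported ones\<close>

lemma bounded_obtain_cball:
  assumes "bounded {x::'a::euclidean_space. f x \<noteq> (0::'b::zero)}"
  obtains R where "0 < R" "\<And>x. R < norm x \<Longrightarrow> f x = 0"
proof -
  obtain B where "\<And>x. f x \<noteq> 0 \<Longrightarrow> norm x \<le> B" using assms unfolding bounded_iff by auto
  then show ?thesis by (intro that[of "max B 1"]) fastforce+
qed

lemma bounded_supportI:
  assumes "\<And>x::'a::real_normed_vector. R < norm x \<Longrightarrow> f x = (0::'b::zero)"
  shows "bounded {x. f x \<noteq> 0}"
  using assms unfolding bounded_iff by (intro exI[of _ R]) (auto simp: not_less[symmetric])

lemma continuous_bounded_on_cball:
  fixes f :: "'a::euclidean_space \<Rightarrow> 'b::real_normed_vector"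
  assumes "continuous_on UNIV f"
  obtains B where "0 < B" "\<And>x. norm x \<le> R \<Longrightarrow> norm (f x) \<le> B"
proof -
  have "compact (f ` cball 0 R)"
    using assms by (intro compact_continuous_image) (auto intro: continuous_on_subset)
  then obtain B where "\<forall>y\<in>f ` cball 0 R. norm y \<le> B" using compact_imp_bounded bounded_iff by blast
  then show ?thesis by (intro that[of "max B 1"]) (auto simp: le_max_iff_disj)
qed

lemma continuous_bounded_support_bounded:
  fixes f :: "'a::euclidean_space \<Rightarrow> real"
  assumes "continuous_on UNIV f" "bounded {x. f x \<noteq> 0}"
  obtains B where "0 < B" "\<And>x. \<bar>f x\<bar> \<le> B"
proof -
  obtain R where R: "\<And>x. R < norm x \<Longrightarrow> f x = 0" using bounded_obtain_cball[OF assms(2)] by metis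
  obtain B where B: "0 < B" "\<And>x. norm x \<le> R \<Longrightarrow> norm (f x) \<le> B"
    using continuous_bounded_on_cball[OF assms(1)] by metis
  show ?thesis
  proof (rule that[OF B(1)])
    fix x show "\<bar>f x\<bar> \<le> B" using R[of x] B by (cases "norm x \<le> R") auto
  qed
qed

lemma measurable_lebesgue_continuous:
  "continuous_on UNIV f \<Longrightarrow> f \<in> borel_measurable lebesgue"
  by (simp add: borel_measurable_continuous_onI measurable_completion)

lemma integrable_loc_mult:
  fixes F \<psi> :: "'a::euclidean_space \<Rightarrow> real"
  assumes F: "\<And>K. compact K \<Longrightarrow> F absolutely_integrable_on K"
    and \<psi>: "\<psi> \<in> borel_measurable lebesgue" and B: "\<And>x. \<bar>\<psi> x\<bar> \<le> B" and s: "bounded {x. \<psi> x \<noteq> 0}"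
  shows "integrable lebesgue (\<lambda>x. F x * \<psi> x)"
proof -
  obtain R where R: "\<And>x. R < norm x \<Longrightarrow> \<psi> x = 0" using bounded_obtain_cball[OF s] by metis
  have i: "integrable lebesgue (\<lambda>x. indicator (cball 0 R) x * F x)"
    using F[of "cball 0 R"] by (simp add: set_integrable_def)
  have eq: "(\<lambda>x. F x * \<psi> x) = (\<lambda>x. (indicator (cball 0 R) x * F x) * \<psi> x)"
    using R by (force simp: indicator_def)
  show ?thesis
  proof (rule Bochner_Integration.integrable_bound)
    show "integrable lebesgue (\<lambda>x. B * (indicator (cball 0 R) x * F x))" using i by simp
    show "(\<lambda>x. F x * \<psi> x) \<in> borel_measurable lebesgue"
      unfolding eq using i \<psi> by (intro borel_measurable_times[of "\<lambda>x. indicator (cball 0 R) x * F x"]) auto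
    have "norm (F x * \<psi> x) \<le> norm (B * (indicator (cball 0 R) x * F x))" for x
    proof (cases "norm x \<le> R")
      case True
      have "\<bar>F x\<bar> * \<bar>\<psi> x\<bar> \<le> \<bar>F x\<bar> * B" using B[of x] by (rule mult_left_mono) simp
      moreover have "0 \<le> B" using B[of x] by simp
      ultimately show ?thesis using True by (simp add: abs_mult mult.commute)
    qed (use R in auto)
    then show "AE x in lebesgue. norm (F x * \<psi> x) \<le> norm (B * (indicator (cball 0 R) x * F x))" by simp
  qed
qed

lemma integrable_loc_mult_continuous:
  fixes F \<psi> :: "'a::euclidean_space \<Rightarrow> real"
  assumes F: "\<And>K. compact K \<Longrightarrow> F absolutely_integrable_on K"
    and \<psi>: "continuous_on UNIV \<psi>" and s: "bounded {x. \<psi> x \<noteq> 0}"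
  shows "integrable lebesgue (\<lambda>x. F x * \<psi> x)"
proof -
  obtain B where "\<And>x. \<bar>\<psi> x\<bar> \<le> B" using continuous_bounded_support_bounded[OF \<psi> s] by metis
  from integrable_loc_mult[OF F measurable_lebesgue_continuous[OF \<psi>] this s] show ?thesis .
qed

lemma mollify_eq_0:
  assumes r: "0 < r" and "\<And>y. norm (y - x) < r \<Longrightarrow> f y = 0"
  shows "mollify r f x = 0"
proof -
  have eq: "mollifier r (x - y) * f y = 0" for y
    using assms(2)[of y] mollifier_eq_0[OF r, of "x - y"] by (cases "norm (y - x) < r") (auto simp: norm_minus_commute)
  show ?thesis unfolding mollify_def eq by simp
qed

lemma continuous_on_mollify:
  fixes f :: "'a::euclidean_space \<Rightarrow> real"
  assumes "0 < r" "continuous_on UNIV f"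
  shows "continuous_on S (mollify r f)"
  using mollify_has_derivative[OF assms] by (intro continuous_on_of_differentiable) (auto simp: differentiable_def)

text \<open>Mollification is self-adjoint because the kernel is even. \<open>F\<close> is only
  Lebesgue measurable, while Fubini is applied on the product of two copies of
  \<open>lborel\<close>; hence \<open>F\<close> is replaced on a large ball by a Borel function
  \<open>G\<close> that agrees with it almost everywhere.\<close>

lemma mollify_fubini:
  fixes F \<psi> :: "'a::euclidean_space \<Rightarrow> real"
  assumes r: "0 < r" and F: "\<And>K. compact K \<Longrightarrow> F absolutely_integrable_on K"
    and \<psi>: "continuous_on UNIV \<psi>" and s: "bounded {x. \<psi> x \<noteq> 0}"
  shows "integrable lebesgue (\<lambda>x. mollify r F x * \<psi> x)"
    and "(\<integral>x. mollify r F x * \<psi> x \<partial>lebesgue) = (\<integral>y. F y * mollify r \<psi> y \<partial>lebesgue)"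
proof -
  obtain R where R: "\<And>x. R < norm x \<Longrightarrow> \<psi> x = 0" using bounded_obtain_cball[OF s] by metis
  \<comment> \<open>For \<open>x\<close> in the support of \<open>\<psi>\<close> the kernel sees
    only points of this ball, which also contains the support of the mollified
    \<open>\<psi>\<close>.\<close>
  let ?K = "cball (0::'a) (R + r)"
  have i: "integrable lebesgue (\<lambda>x. indicator ?K x * F x)"
    using F[of ?K] by (simp add: set_integrable_def)
  then obtain G where G: "G \<in> borel_measurable lborel" and "AE x in lborel. indicator ?K x * F x = G x"
    using completion_ex_borel_measurable_real[of "\<lambda>x. indicator ?K x * F x" lborel] by auto
  then have GAE: "AE x in lebesgue. indicator ?K x * F x = G x" by (intro AE_completion)
  have Gm: "G \<in> borel_measurable borel" using G by simp
  have Gi: "integrable lborel G"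
  proof -
    have "integrable lebesgue G"
      by (rule integrable_cong_AE_imp[OF i measurable_completion[OF G] GAE])
    then show ?thesis using Gm by (simp add: integrable_completion)
  qed
  have \<psi>m: "\<psi> \<in> borel_measurable borel" using \<psi> by (rule borel_measurable_continuous_onI)
  have \<psi>i: "integrable lborel \<psi>" using \<psi> s by (rule integrable_lborel_continuous)
  have mm: "mollifier r \<in> borel_measurable (borel :: 'a measure)"
    by (intro borel_measurable_continuous_onI continuous_on_mollifier)
  define H where "H x y = mollifier r (x - y) * G y * \<psi> x" for x y
  obtain B where B: "\<And>z::'a. \<bar>mollifier r z\<bar> \<le> B"
  proof -
    have "bounded {z::'a. mollifier r z \<noteq> 0}" using bounded_mollifier_support[OF r, of "0::'a" "\<lambda>_. 1"]
      by (simp add: mollifier_def)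
    then show ?thesis using continuous_bounded_support_bounded[OF continuous_on_mollifier] that by metis
  qed
  have GP: "integrable (lborel \<Otimes>\<^sub>M lborel) (\<lambda>(x,y). \<psi> x * G y)"
  proof (rule lborel_pair.Fubini_integrable)
    show "(\<lambda>(x,y). \<psi> x * G y) \<in> borel_measurable (lborel \<Otimes>\<^sub>M lborel)"
      using \<psi>m Gm by measurable
    show "AE x in lborel. integrable lborel (\<lambda>y. case (x, y) of (x, y) \<Rightarrow> \<psi> x * G y)" using Gi by simp
    show "integrable lborel (\<lambda>x. \<integral>y. norm (case (x, y) of (x, y) \<Rightarrow> \<psi> x * G y) \<partial>lborel)"
      using \<psi>i by (simp add: abs_mult)
  qed
  have HP: "integrable (lborel \<Otimes>\<^sub>M lborel) (\<lambda>(x,y). H x y)"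
  proof (rule Bochner_Integration.integrable_bound)
    show "integrable (lborel \<Otimes>\<^sub>M lborel) (\<lambda>z. B * (case z of (x,y) \<Rightarrow> \<psi> x * G y))" using GP by (rule integrable_mult_right)
    show "(\<lambda>(x,y). H x y) \<in> borel_measurable (lborel \<Otimes>\<^sub>M lborel)"
      unfolding H_def using \<psi>m Gm mm by measurable
    have "norm (H x y) \<le> norm (B * (\<psi> x * G y))" for x y
    proof -
      have "\<bar>mollifier r (x - y)\<bar> * (\<bar>G y\<bar> * \<bar>\<psi> x\<bar>) \<le> \<bar>B\<bar> * (\<bar>G y\<bar> * \<bar>\<psi> x\<bar>)"
        using B[of "x - y"] by (intro mult_right_mono) auto
      then show ?thesis by (simp add: H_def abs_mult mult_ac)
    qed
    then show "AE z in lborel \<Otimes>\<^sub>M lborel. norm (case z of (x,y) \<Rightarrow> H x y) \<le> norm (B * (case z of (x,y) \<Rightarrow> \<psi> x * G y))"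
      by (auto simp: case_prod_beta)
  qed
  have inner1: "(\<integral>y. H x y \<partial>lborel) = mollify r F x * \<psi> x" for x
  proof (cases "R < norm x")
    case True
    then show ?thesis by (simp add: H_def R)
  next
    case False
    have "(\<integral>y. H x y \<partial>lborel) = (\<integral>y. mollifier r (x - y) * G y \<partial>lborel) * \<psi> x" by (simp add: H_def)
    also have "(\<integral>y. mollifier r (x - y) * G y \<partial>lborel) = (\<integral>y. mollifier r (x - y) * G y \<partial>lebesgue)"
      by (intro integral_lebesgue_eq_lborel[symmetric] borel_measurable_times Gm
          borel_measurable_continuous_onI[OF continuous_on_mollifier_diff])
    also have "\<dots> = (\<integral>y. mollifier r (x - y) * (indicator ?K y * F y) \<partial>lebesgue)"
    proof (rule integral_cong_AE)
      have m: "(\<lambda>y. mollifier r (x - y)) \<in> borel_measurable lebesgue"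
        by (intro measurable_lebesgue_continuous continuous_on_mollifier_diff)
      show "(\<lambda>y. mollifier r (x - y) * G y) \<in> borel_measurable lebesgue"
        by (intro borel_measurable_times m measurable_completion[OF G])
      show "(\<lambda>y. mollifier r (x - y) * (indicator ?K y * F y)) \<in> borel_measurable lebesgue"
        using m i by (intro borel_measurable_times[of "\<lambda>y. mollifier r (x - y)"]) auto
      show "AE y in lebesgue. mollifier r (x - y) * G y = mollifier r (x - y) * (indicator ?K y * F y)"
        using GAE by eventually_elim simp
    qed
    also have "\<dots> = mollify r F x"
      unfolding mollify_def
    proof (rule Bochner_Integration.integral_cong[OF refl])
      fix y
      show "mollifier r (x - y) * (indicator ?K y * F y) = mollifier r (x - y) * F y"
      proof (cases "r \<le> norm (x - y)")
        case False
        then have "norm y \<le> R + r" using \<open>\<not> R < norm x\<close> norm_triangle_ineq4[of x "x - y"] by simp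
        then show ?thesis by simp
      qed (simp add: mollifier_eq_0[OF r])
    qed
    finally show ?thesis .
  qed
  have inner2: "(\<integral>x. H x y \<partial>lborel) = G y * mollify r \<psi> y" for y
  proof -
    have "(\<integral>x. H x y \<partial>lborel) = (\<integral>x. G y * (mollifier r (y - x) * \<psi> x) \<partial>lborel)"
      by (rule Bochner_Integration.integral_cong[OF refl]) (simp add: H_def mollifier_commute[of r y])
    also have "\<dots> = G y * (\<integral>x. mollifier r (y - x) * \<psi> x \<partial>lborel)" by simp
    also have "(\<integral>x. mollifier r (y - x) * \<psi> x \<partial>lborel) = mollify r \<psi> y"
      unfolding mollify_def
      by (intro integral_lebesgue_eq_lborel[symmetric] borel_measurable_times \<psi>m
          borel_measurable_continuous_onI[OF continuous_on_mollifier_diff])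
    finally show ?thesis .
  qed
  have int1: "integrable lborel (\<lambda>x. mollify r F x * \<psi> x)"
    using lborel_pair.integrable_fst'[OF HP] by (simp add: inner1)
  then show "integrable lebesgue (\<lambda>x. mollify r F x * \<psi> x)"
    by (subst integrable_completion) auto
  have "(\<integral>x. mollify r F x * \<psi> x \<partial>lebesgue) = (\<integral>x. mollify r F x * \<psi> x \<partial>lborel)"
    using int1 by (intro integral_lebesgue_eq_lborel) auto
  also have "\<dots> = (\<integral>x. (\<integral>y. H x y \<partial>lborel) \<partial>lborel)" by (simp add: inner1)
  also have "\<dots> = (\<integral>y. (\<integral>x. H x y \<partial>lborel) \<partial>lborel)" by (rule lborel_pair.Fubini_integral[OF HP, symmetric])
  also have "\<dots> = (\<integral>y. G y * mollify r \<psi> y \<partial>lborel)" by (simp add: inner2)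
  also have "\<dots> = (\<integral>y. G y * mollify r \<psi> y \<partial>lebesgue)"
    using Gm borel_measurable_continuous_onI[OF continuous_on_mollify[OF r \<psi>]]
    by (intro integral_lebesgue_eq_lborel[symmetric] borel_measurable_times)
  also have "\<dots> = (\<integral>y. (indicator ?K y * F y) * mollify r \<psi> y \<partial>lebesgue)"
  proof (rule integral_cong_AE)
    have m: "mollify r \<psi> \<in> borel_measurable lebesgue"
      by (intro measurable_lebesgue_continuous continuous_on_mollify[OF r \<psi>])
    show "(\<lambda>y. G y * mollify r \<psi> y) \<in> borel_measurable lebesgue"
      by (intro borel_measurable_times m measurable_completion[OF G])
    show "(\<lambda>y. (indicator ?K y * F y) * mollify r \<psi> y) \<in> borel_measurable lebesgue"
      using m i by (intro borel_measurable_times[of "\<lambda>y. indicator ?K y * F y"]) auto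
    show "AE y in lebesgue. G y * mollify r \<psi> y = (indicator ?K y * F y) * mollify r \<psi> y"
      using GAE by eventually_elim simp
  qed
  also have "\<dots> = (\<integral>y. F y * mollify r \<psi> y \<partial>lebesgue)"
  proof (rule Bochner_Integration.integral_cong[OF refl])
    fix y
    show "(indicator ?K y * F y) * mollify r \<psi> y = F y * mollify r \<psi> y"
    proof (cases "norm y \<le> R + r")
      case False
      have "mollify r \<psi> y = 0"
      proof (rule mollify_eq_0[OF r])
        fix z assume "norm (z - y) < r"
        then have "R < norm z" using False norm_triangle_ineq4[of z "z - y"] by simp
        then show "\<psi> z = 0" by (rule R)
      qed
      then show ?thesis by simp
    qed simp
  qed
  finally show "(\<integral>x. mollify r F x * \<psi> x \<partial>lebesgue) = (\<integral>y. F y * mollify r \<psi> y \<partial>lebesgue)" .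
qed

abbreviation eps_seq :: "nat \<Rightarrow> real" where
  "eps_seq n \<equiv> inverse (real (Suc n))"

lemma eps_seq_le_1: "eps_seq n \<le> 1" by (simp add: field_simps)

lemma eps_seq_eventually_close:
  fixes f :: "'a::euclidean_space \<Rightarrow> real"
  assumes f: "continuous_on UNIV f" and e: "0 < e"
  shows "\<forall>\<^sub>F n in sequentially. \<forall>y. norm (y - x) \<le> eps_seq n \<longrightarrow> \<bar>f y - f x\<bar> \<le> e"
proof -
  have "isCont f x" using f by (simp add: continuous_on_eq_continuous_at)
  then obtain r where r: "0 < r" "\<And>y. dist y x < r \<Longrightarrow> dist (f y) (f x) < e"
    using e unfolding continuous_at_eps_delta by blast
  have "\<forall>\<^sub>F n in sequentially. eps_seq n < r"
    using order_tendstoD(2)[OF LIMSEQ_inverse_real_of_nat r(1)] .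
  then show ?thesis
  proof eventually_elim
    case (elim n)
    show ?case
    proof (intro allI impI)
      fix y assume "norm (y - x) \<le> eps_seq n"
      then have "dist y x < r" using elim by (simp add: dist_norm)
      from r(2)[OF this] show "\<bar>f y - f x\<bar> \<le> e" by (simp add: dist_real_def)
    qed
  qed
qed

lemma mollify_tendsto:
  fixes f :: "'a::euclidean_space \<Rightarrow> real"
  assumes f: "continuous_on UNIV f"
  shows "(\<lambda>n. mollify (eps_seq n) f x) \<longlonglongrightarrow> f x"
proof (rule LIMSEQ_I)
  fix e :: real assume e: "0 < e"
  have "\<forall>\<^sub>F n in sequentially. norm (mollify (eps_seq n) f x - f x) < e"
    using eps_seq_eventually_close[OF f half_gt_zero[OF e], of x]
  proof eventually_elim
    case (elim n)
    then have "\<bar>mollify (eps_seq n) f x - f x\<bar> \<le> e / 2" by (intro mollify_close f) auto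
    then show ?case using e by simp
  qed
  then show "\<exists>no. \<forall>n\<ge>no. norm (mollify (eps_seq n) f x - f x) < e" by (simp add: eventually_sequentially)
qed

text \<open>The mollifier is moved onto \<open>\<psi>\<close>, where convergence is pointwise and
  bounded. This avoids any convergence statement about the mollifications of
  \<open>F\<close>.\<close>

lemma mollify_pairing_tendsto:
  fixes F \<psi> :: "'a::euclidean_space \<Rightarrow> real"
  assumes F: "\<And>K. compact K \<Longrightarrow> F absolutely_integrable_on K"
    and \<psi>: "continuous_on UNIV \<psi>" and s: "bounded {x. \<psi> x \<noteq> 0}"
  shows "(\<lambda>n. \<integral>x. mollify (eps_seq n) F x * \<psi> x \<partial>lebesgue) \<longlonglongrightarrow> (\<integral>x. F x * \<psi> x \<partial>lebesgue)"
proof -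
  obtain R where R: "\<And>x. R < norm x \<Longrightarrow> \<psi> x = 0" using bounded_obtain_cball[OF s] by metis
  obtain B where B: "0 < B" "\<And>x. \<bar>\<psi> x\<bar> \<le> B" using continuous_bounded_support_bounded[OF \<psi> s] by metis
  have bnd: "\<bar>mollify (eps_seq n) \<psi> y\<bar> \<le> 3 * B" for n y
  proof -
    have "\<bar>\<psi> z - \<psi> y\<bar> \<le> 2 * B" for z using B(2)[of z] B(2)[of y] by linarith
    then have "\<bar>mollify (eps_seq n) \<psi> y - \<psi> y\<bar> \<le> 2 * B" by (intro mollify_close \<psi>) auto
    then show ?thesis using B(2)[of y] by linarith
  qed
  have z: "mollify (eps_seq n) \<psi> y = 0" if "R + 1 < norm y" for n y
  proof (rule mollify_eq_0)
    show "0 < eps_seq n" by simp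
    fix z assume "norm (z - y) < eps_seq n"
    then have "norm (z - y) < 1" using eps_seq_le_1[of n] by linarith
    then have "R < norm z" using that norm_triangle_ineq4[of z "z - y"] by simp
    then show "\<psi> z = 0" by (rule R)
  qed
  have m: "mollify (eps_seq n) \<psi> \<in> borel_measurable lebesgue" for n
    by (intro measurable_lebesgue_continuous continuous_on_mollify \<psi>) simp
  have supp: "bounded {y. mollify (eps_seq n) \<psi> y \<noteq> 0}" for n
    using z by (rule bounded_supportI)
  have "(\<lambda>n. \<integral>y. F y * mollify (eps_seq n) \<psi> y \<partial>lebesgue) \<longlonglongrightarrow> (\<integral>x. F x * \<psi> x \<partial>lebesgue)"
  proof (rule integral_dominated_convergence)
    show "(\<lambda>x. F x * \<psi> x) \<in> borel_measurable lebesgue"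
      using integrable_loc_mult_continuous[OF F \<psi> s] by auto
    show "(\<lambda>y. F y * mollify (eps_seq n) \<psi> y) \<in> borel_measurable lebesgue" for n
      using integrable_loc_mult[OF F m bnd supp] by auto
    show "integrable lebesgue (\<lambda>y. 3 * B * \<bar>indicator (cball 0 (R+1)) y * F y\<bar>)"
      using F[of "cball 0 (R+1)"] by (intro integrable_mult_right integrable_abs) (simp add: set_integrable_def)
    show "AE y in lebesgue. (\<lambda>n. F y * mollify (eps_seq n) \<psi> y) \<longlonglongrightarrow> F y * \<psi> y"
      by (intro AE_I2 tendsto_intros mollify_tendsto \<psi>)
    show "AE y in lebesgue. norm (F y * mollify (eps_seq n) \<psi> y) \<le> 3 * B * \<bar>indicator (cball 0 (R+1)) y * F y\<bar>" for n
    proof (rule AE_I2)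
      fix y
      show "norm (F y * mollify (eps_seq n) \<psi> y) \<le> 3 * B * \<bar>indicator (cball 0 (R+1)) y * F y\<bar>"
      proof (cases "R + 1 < norm y")
        case True
        then show ?thesis using B z by simp
      next
        case False
        have "\<bar>F y\<bar> * \<bar>mollify (eps_seq n) \<psi> y\<bar> \<le> \<bar>F y\<bar> * (3 * B)" using bnd by (intro mult_left_mono) auto
        then show ?thesis using False by (simp add: abs_mult mult_ac)
      qed
    qed
  qed
  then show ?thesis by (subst mollify_fubini(2)[OF _ F \<psi> s]) auto
qed

section \<open>Weak derivatives\<close>

text \<open>By inner regularity the set where \<open>H\<close> is positive, cut to a ball, is up to
  measure \<open>e\<close> a compact set \<open>T\<close>. There \<open>H\<close> is positive with
  integral zero, so \<open>T\<close> is null and the whole set has measure at most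
  \<open>e\<close>.\<close>

lemma AE_nonpos_of_compact_integrals:
  fixes H :: "'a::euclidean_space \<Rightarrow> real"
  assumes H: "\<And>K. compact K \<Longrightarrow> H absolutely_integrable_on K"
    and 0: "\<And>K. compact K \<Longrightarrow> (\<integral>x. H x * indicator K x \<partial>lebesgue) = 0"
  shows "AE x in lebesgue. H x \<le> 0"
proof -
  have null: "emeasure lebesgue {x \<in> cball 0 (real m). 0 < H x} = 0" for m
  proof -
    define A where "A = {x \<in> cball 0 (real m). 0 < H x}"
    have m: "(\<lambda>x. indicator (cball 0 (real m)) x * H x) \<in> borel_measurable lebesgue"
      using H[of "cball 0 (real m)"] by (auto simp: set_integrable_def)
    have "A = {x \<in> space lebesgue. 0 < indicator (cball 0 (real m)) x * H x}"
      by (auto simp: A_def indicator_def)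
    then have A: "A \<in> sets lebesgue" using m borel_measurable_less[OF borel_measurable_const m] by simp
    have "emeasure lebesgue A \<le> 0 + ennreal e" if e: "0 < e" for e :: real
    proof -
      obtain T where T: "closed T" "T \<subseteq> A" "A - T \<in> lmeasurable" "emeasure lebesgue (A - T) < ennreal e"
        using sets_lebesgue_inner_closed[OF A e] by metis
      have "T \<subseteq> cball 0 (real m)" using T(2) by (auto simp: A_def)
      then have Tc: "compact T"
        using T(1) bounded_subset[OF bounded_cball] by (auto simp: compact_eq_bounded_closed)
      have i: "integrable lebesgue (\<lambda>x. H x * indicator T x)"
        using H[OF Tc] by (simp add: set_integrable_def mult.commute)
      have nn: "0 \<le> H x * indicator T x" for x using T(2) by (auto simp: indicator_def A_def)
      have "AE x in lebesgue. H x * indicator T x = 0"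
        using integral_nonneg_eq_0_iff_AE[OF i] nn 0[OF Tc] by simp
      then have "AE x in lebesgue. x \<notin> T"
        by eventually_elim (use T(2) in \<open>auto simp: indicator_def A_def split: if_splits\<close>)
      then have "emeasure lebesgue T = 0"
        using fmeasurableD[OF lmeasurable_compact[OF Tc]] by (subst (asm) AE_iff_measurable[of T]) auto
      moreover have "emeasure lebesgue A \<le> emeasure lebesgue T + emeasure lebesgue (A - T)"
        using emeasure_subadditive[of T lebesgue "A - T"] T fmeasurableD[OF lmeasurable_compact[OF Tc]] A
        by (simp add: Un_absorb1 sets.Diff)
      ultimately show ?thesis using T(4) by simp
    qed
    then have "emeasure lebesgue A \<le> 0" by (rule ennreal_le_epsilon)
    then show ?thesis by (simp add: A_def)
  qed
  have "AE x in lebesgue. \<forall>m. x \<notin> {x \<in> cball 0 (real m). 0 < H x}"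
  proof (subst AE_all_countable, intro allI)
    fix m
    have mm: "(\<lambda>x. indicator (cball 0 (real m)) x * H x) \<in> borel_measurable lebesgue"
      using H[of "cball 0 (real m)"] by (auto simp: set_integrable_def)
    have eq: "{x \<in> cball 0 (real m). 0 < H x} = {x \<in> space lebesgue. 0 < indicator (cball 0 (real m)) x * H x}"
      by (auto simp: indicator_def)
    have "{x \<in> cball 0 (real m). 0 < H x} \<in> sets lebesgue"
      unfolding eq using borel_measurable_less[OF borel_measurable_const mm] by simp
    then have "{x \<in> cball 0 (real m). 0 < H x} \<in> null_sets lebesgue" using null by blast
    then show "AE x in lebesgue. x \<notin> {x \<in> cball 0 (real m). 0 < H x}" by (rule AE_not_in)
  qed
  then show ?thesis
  proof eventually_elim
    case (elim x)
    obtain m where "norm x \<le> real m" using real_arch_simple by blast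
    then show ?case using elim by force
  qed
qed

lemma AE_eq_0_of_continuous_pairings:
  fixes H :: "'a::euclidean_space \<Rightarrow> real"
  assumes H: "\<And>K. compact K \<Longrightarrow> H absolutely_integrable_on K"
    and 0: "\<And>\<psi>. continuous_on UNIV \<psi> \<Longrightarrow> bounded {x. \<psi> x \<noteq> 0} \<Longrightarrow> (\<integral>x. H x * \<psi> x \<partial>lebesgue) = 0"
  shows "AE x in lebesgue. H x = 0"
proof -
  have comp: "(\<integral>x. H x * indicator K x \<partial>lebesgue) = 0" if K: "compact K" for K
  \<comment> \<open>The indicator of \<open>K\<close> is approximated by tent functions of the
    distance to \<open>K\<close>. By convention \<open>infdist\<close> to the empty set is 0, which
    would make the tents constantly 1, so that case is set apart.\<close>
  proof (cases "K = {}")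
    case False
    define \<psi> where "\<psi> n x = max 0 (1 - real (Suc n) * infdist x K)" for n x
    obtain R where R: "K \<subseteq> cball 0 R" using compact_imp_bounded[OF K] unfolding bounded_iff by (auto simp: subset_iff)
    have c: "continuous_on UNIV (\<psi> n)" for n unfolding \<psi>_def by (intro continuous_intros)
    have z: "\<psi> n x = 0" if "R + 1 < norm x" for n x
    proof -
      have "\<exists>y\<in>K. infdist x K = dist x y" using infdist_attains_inf[OF compact_imp_closed[OF K] False] by metis
      then obtain y where y: "y \<in> K" "infdist x K = dist x y" by blast
      have "1 \<le> infdist x K"
        using y R that norm_triangle_ineq2[of x y] by (auto simp: dist_norm subset_iff)
      then have "1 \<le> real (Suc n) * infdist x K" using mult_mono[of 1 "real (Suc n)" 1 "infdist x K"] by simp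
      then show ?thesis by (simp add: \<psi>_def)
    qed
    have supp: "bounded {x. \<psi> n x \<noteq> 0}" for n
      using z by (rule bounded_supportI)
    have b: "\<bar>\<psi> n x\<bar> \<le> 1" for n x by (auto simp: \<psi>_def infdist_nonneg)
    have lim: "(\<lambda>n. \<psi> n x) \<longlonglongrightarrow> indicator K x" for x
    proof (cases "x \<in> K")
      case True
      then show ?thesis by (simp add: \<psi>_def)
    next
      case F: False
      then have pos: "0 < infdist x K"
        using infdist_pos_not_in_closed[OF compact_imp_closed[OF K] False F] by simp
      obtain N where N: "1 < real N * infdist x K" using reals_Archimedean3[OF pos] by metis
      have "\<forall>\<^sub>F n in sequentially. \<psi> n x = 0"
        unfolding eventually_sequentially
      proof (intro exI allI impI)
        fix n assume "N \<le> n"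
        then have "real N * infdist x K \<le> real (Suc n) * infdist x K"
          by (intro mult_right_mono) (auto simp: infdist_nonneg)
        then show "\<psi> n x = 0" using N by (simp add: \<psi>_def)
      qed
      then show ?thesis using F by (simp add: tendsto_eventually)
    qed
    have "(\<lambda>n. \<integral>x. H x * \<psi> n x \<partial>lebesgue) \<longlonglongrightarrow> (\<integral>x. H x * indicator K x \<partial>lebesgue)"
    proof (rule integral_dominated_convergence)
      show "(\<lambda>x. H x * indicator K x) \<in> borel_measurable lebesgue"
        using H[OF K] by (auto simp: set_integrable_def mult.commute)
      show "(\<lambda>x. H x * \<psi> n x) \<in> borel_measurable lebesgue" for n
        using integrable_loc_mult_continuous[OF H c supp] by auto
      show "integrable lebesgue (\<lambda>x. \<bar>indicator (cball 0 (R+1)) x * H x\<bar>)"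
        using H[of "cball 0 (R+1)"] by (intro integrable_abs) (simp add: set_integrable_def)
      show "AE x in lebesgue. (\<lambda>n. H x * \<psi> n x) \<longlonglongrightarrow> H x * indicator K x"
        by (intro AE_I2 tendsto_intros lim)
      show "AE x in lebesgue. norm (H x * \<psi> n x) \<le> \<bar>indicator (cball 0 (R+1)) x * H x\<bar>" for n
      proof (rule AE_I2)
        fix x show "norm (H x * \<psi> n x) \<le> \<bar>indicator (cball 0 (R+1)) x * H x\<bar>"
          using mult_left_mono[OF b[of n x], of "\<bar>H x\<bar>"] z[of x n]
          by (cases "R + 1 < norm x") (auto simp: abs_mult)
      qed
    qed
    then show ?thesis using 0[OF c supp] by (simp add: LIMSEQ_const_iff)
  qed simp
  have "AE x in lebesgue. H x \<le> 0" by (rule AE_nonpos_of_compact_integrals[OF H comp])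
  moreover have "AE x in lebesgue. - H x \<le> 0"
  proof (rule AE_nonpos_of_compact_integrals)
    show "(\<lambda>x. - H x) absolutely_integrable_on K" if "compact K" for K
      using H[OF that] by (simp add: set_integrable_def)
    show "(\<integral>x. - H x * indicator K x \<partial>lebesgue) = 0" if "compact K" for K
      using comp[OF that] by simp
  qed
  ultimately show ?thesis by eventually_elim simp
qed

section \<open>Uniqueness of weak derivatives and integration by parts\<close>

lemma test_fun_imp:
  assumes "test_fun U \<phi>"
  shows "continuous_on S \<phi>" "bounded {x. \<phi> x \<noteq> 0}" "\<phi> differentiable (at x)"
proof -
  have "Ck (Suc 0) \<phi>" using assms unfolding test_fun_def smooth_def by blast
  then have d: "\<phi> differentiable (at x)" for x by simp
  then show "\<phi> differentiable (at x)" "continuous_on S \<phi>" by (auto intro: continuous_on_of_differentiable)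
  show "bounded {x. \<phi> x \<noteq> 0}"
    using assms unfolding test_fun_def by (meson bounded_subset closure_subset compact_imp_bounded)
qed

text \<open>The mollifier kernels are test functions, so all mollifications of the difference
  \<open>H\<close> vanish, and with them, in the limit, its pairings with continuous functions of
  bounded support. This is what lets the representative chosen in \<open>weak_grad\<close> be
  identified with an explicit formula.\<close>

lemma weak_deriv_unique:
  fixes Y :: "'a::euclidean_space \<Rightarrow> 'a"
  assumes F: "has_weak_deriv Y f F" and G: "has_weak_deriv Y f G"
  shows "AE x in lebesgue. F x = G x"
proof -
  define H where "H x = F x - G x" for x
  have Fl: "F absolutely_integrable_on K" and Gl: "G absolutely_integrable_on K" if "compact K" for K
    using F G that unfolding has_weak_deriv_def by auto
  have Hl: "H absolutely_integrable_on K" if "compact K" for K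
    unfolding H_def using Fl[OF that] Gl[OF that] by (rule set_integral_diff)
  have m0: "mollify \<epsilon> H x = 0" if \<epsilon>: "0 < \<epsilon>" for \<epsilon> x
  proof -
    let ?\<phi> = "\<lambda>y. mollifier \<epsilon> (x - y)"
    have t: "test_fun UNIV ?\<phi>" by (rule test_fun_mollifier[OF \<epsilon>])
    have i: "integrable lebesgue (\<lambda>y. F y * ?\<phi> y)" "integrable lebesgue (\<lambda>y. G y * ?\<phi> y)"
      using integrable_loc_mult_continuous[OF Fl test_fun_imp(1,2)[OF t]]
        integrable_loc_mult_continuous[OF Gl test_fun_imp(1,2)[OF t]] by auto
    have "(\<integral>y. F y * ?\<phi> y \<partial>lebesgue) = (\<integral>y. G y * ?\<phi> y \<partial>lebesgue)"
      using F G t unfolding has_weak_deriv_def by metis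
    moreover have "mollify \<epsilon> H x = (\<integral>y. F y * ?\<phi> y - G y * ?\<phi> y \<partial>lebesgue)"
      unfolding mollify_def by (rule Bochner_Integration.integral_cong[OF refl]) (simp add: H_def algebra_simps)
    ultimately show ?thesis using i by simp
  qed
  have "(\<integral>x. H x * \<psi> x \<partial>lebesgue) = 0" if "continuous_on UNIV \<psi>" "bounded {x. \<psi> x \<noteq> 0}" for \<psi>
    using mollify_pairing_tendsto[OF Hl that] m0 by (simp add: LIMSEQ_const_iff)
  from AE_eq_0_of_continuous_pairings[OF Hl this] have "AE x in lebesgue. H x = 0" .
  then show ?thesis by eventually_elim (simp add: H_def)
qed

lemma smooth_imp_differentiable: "smooth f \<Longrightarrow> f differentiable (at x)"
  unfolding smooth_def by (metis Ck.simps(2))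

text \<open>Mean value inequality on a ball, which is convex and compact. \<open>Ck\<close> controls
  the derivative on basis vectors only, so its operator norm is bounded by the sum of the bounds
  over the basis.\<close>

lemma smooth_locally_lipschitz:
  fixes Y :: "'a::euclidean_space \<Rightarrow> 'b::real_normed_vector"
  assumes "smooth Y"
  obtains L where "0 \<le> L" "\<And>x y. norm x \<le> R \<Longrightarrow> norm y \<le> R \<Longrightarrow> norm (Y y - Y x) \<le> L * norm (y - x)"
proof -
  have "Ck (Suc 0) Y" using assms by (simp add: smooth_def)
  then have d: "\<And>x. Y differentiable (at x)"
    and c: "\<And>b. b \<in> Basis \<Longrightarrow> continuous_on UNIV (\<lambda>x. frechet_derivative Y (at x) b)" by auto
  have "\<exists>B>0. \<forall>x. norm x \<le> R \<longrightarrow> norm (frechet_derivative Y (at x) b) \<le> B" if "b \<in> Basis" for b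
    using continuous_bounded_on_cball[OF c[OF that], of R] by metis
  then obtain B where B: "\<And>b. b \<in> Basis \<Longrightarrow> 0 < B b"
    "\<And>b x. b \<in> Basis \<Longrightarrow> norm x \<le> R \<Longrightarrow> norm (frechet_derivative Y (at x) b) \<le> B b" by metis
  define L where "L = (\<Sum>b\<in>Basis. B b)"
  have L0: "0 \<le> L" unfolding L_def using B(1) by (intro sum_nonneg) (auto intro: less_imp_le)
  have "norm (Y y - Y x) \<le> L * norm (y - x)" if "norm x \<le> R" "norm y \<le> R" for x y
  proof (rule differentiable_bound[of "cball 0 R"])
    fix z :: 'a assume z: "z \<in> cball 0 R"
    show "(Y has_derivative frechet_derivative Y (at z)) (at z within cball 0 R)"
      using has_derivative_frechet_derivative[OF d] has_derivative_at_withinI by blast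
    have lin: "linear (frechet_derivative Y (at z))"
      using has_derivative_frechet_derivative[OF d] has_derivative_linear by blast
    show "onorm (frechet_derivative Y (at z)) \<le> L"
    proof (rule onorm_bound[OF L0])
      fix v :: 'a
      have "frechet_derivative Y (at z) v = frechet_derivative Y (at z) (\<Sum>b\<in>Basis. (v \<bullet> b) *\<^sub>R b)"
        by (simp only: euclidean_representation)
      also have "\<dots> = (\<Sum>b\<in>Basis. (v \<bullet> b) *\<^sub>R frechet_derivative Y (at z) b)"
        using lin by (simp add: linear_sum linear_scale)
      also have "norm \<dots> \<le> (\<Sum>b\<in>Basis. norm v * B b)"
      proof (rule sum_norm_le)
        fix b :: 'a assume b: "b \<in> Basis"
        show "norm ((v \<bullet> b) *\<^sub>R frechet_derivative Y (at z) b) \<le> norm v * B b"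
          using Basis_le_norm[OF b, of v] B(2)[OF b, of z] z by (auto intro!: mult_mono)
      qed
      also have "\<dots> = L * norm v" unfolding L_def sum_distrib_right by (simp add: mult.commute)
      finally show "norm (frechet_derivative Y (at z) v) \<le> L * norm v" .
    qed
  qed (use that in auto)
  with L0 show ?thesis by (rule that)
qed

lemma absolutely_integrable_on_compact_continuous:
  fixes f :: "'a::euclidean_space \<Rightarrow> real"
  assumes f: "continuous_on UNIV f" and "compact K"
  shows "f absolutely_integrable_on K"
proof -
  have "integrable lborel (\<lambda>x. indicator K x *\<^sub>R f x)"
    using assms by (intro borel_integrable_compact) (auto intro: continuous_on_subset)
  then show ?thesis unfolding set_integrable_def by (subst integrable_completion) auto
qed

lemma vf_deriv_eq_0:
  fixes g :: "'a::euclidean_space \<Rightarrow> real"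
  assumes "\<And>x. R < norm x \<Longrightarrow> g x = 0" "R < norm x"
  shows "vf_deriv Y g x = 0"
proof -
  have "((\<lambda>_. 0) has_derivative (\<lambda>_. 0)) (at x)" by simp
  then have "(g has_derivative (\<lambda>_. 0)) (at x)"
    by (rule has_derivative_transform_within_open[where s = "- cball 0 R"]) (use assms in auto)
  then show ?thesis by (simp add: vf_deriv_eq)
qed

lemma bounded_vf_deriv_support:
  fixes g :: "'a::euclidean_space \<Rightarrow> real"
  assumes "bounded {x. g x \<noteq> 0}"
  shows "bounded {x. vf_deriv Y g x \<noteq> 0}"
proof -
  obtain R where "\<And>x. R < norm x \<Longrightarrow> g x = 0" using bounded_obtain_cball[OF assms] by metis
  from vf_deriv_eq_0[OF this] show ?thesis by (rule bounded_supportI)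
qed

text \<open>The defining identity of the weak derivative is extended from smooth test functions to
  \<open>\<psi>\<close> that are merely differentiable with \<open>Y \<psi>\<close> bounded. Such a
  \<open>\<psi>\<close> is not approximated at all: instead \<open>f\<close> is mollified, the
  divergence theorem is applied to the differentiable product with \<open>\<psi>\<close>, and the
  commutator is shown to disappear.\<close>

lemma weak_integration_by_parts:
  fixes Y :: "'a::euclidean_space \<Rightarrow> 'a"
  assumes Y: "smooth Y" and div: "\<And>x. divergence Y x = 0"
    and f: "continuous_on UNIV f" and weak: "has_weak_deriv Y f F"
    and \<psi>: "\<And>x. \<psi> differentiable (at x)" and s: "bounded {x. \<psi> x \<noteq> 0}"
    and C: "\<And>x. \<bar>vf_deriv Y \<psi> x\<bar> \<le> C"
  shows "(\<integral>x. F x * \<psi> x \<partial>lebesgue) = - (\<integral>x. f x * vf_deriv Y \<psi> x \<partial>lebesgue)"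
proof -
  have F: "F absolutely_integrable_on K" if "compact K" for K
    using weak that unfolding has_weak_deriv_def by auto
  have Yd: "Y differentiable (at x)" for x using Y by (rule smooth_imp_differentiable)
  have Yc: "continuous_on UNIV Y" using Yd by (rule continuous_on_of_differentiable)
  have \<psi>c: "continuous_on UNIV \<psi>" using \<psi> by (rule continuous_on_of_differentiable)
  obtain R where R: "0 < R" "\<And>x. R < norm x \<Longrightarrow> \<psi> x = 0" using bounded_obtain_cball[OF s] by metis
  have Y0: "vf_deriv Y \<psi> x = 0" if "R < norm x" for x using vf_deriv_eq_0[OF R(2) that] .
  have sY: "bounded {x. vf_deriv Y \<psi> x \<noteq> 0}" using s by (rule bounded_vf_deriv_support)
  have Ym: "vf_deriv Y \<psi> \<in> borel_measurable borel" using \<psi> Yc by (rule borel_measurable_vf_deriv)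
  have Yml: "vf_deriv Y \<psi> \<in> borel_measurable lebesgue" using Ym by (simp add: measurable_completion)
  \<comment> \<open>All mollification radii are at most 1, so over the support of
    \<open>\<psi>\<close> only values in the ball of radius \<open>R + 1\<close> matter.\<close>
  obtain B where B: "0 < B" "\<And>x. norm x \<le> R + 1 \<Longrightarrow> \<bar>f x\<bar> \<le> B"
    using continuous_bounded_on_cball[OF f, of "R + 1"] by auto
  obtain L where L: "0 \<le> L" "\<And>x y. norm x \<le> R + 1 \<Longrightarrow> norm y \<le> R + 1 \<Longrightarrow> norm (Y y - Y x) \<le> L * norm (y - x)"
    using smooth_locally_lipschitz[OF Y, of "R + 1"] by metis
  obtain M where M: "0 < M" "\<And>\<epsilon> z v. 0 < \<epsilon> \<Longrightarrow>
     \<bar>mollifier_slope \<epsilon> z * ((z::'a) \<bullet> v)\<bar> \<le> M / (\<epsilon> * measure lborel (ball (0::'a) \<epsilon>)) * norm v"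
    using mollifier_slope_bound by metis
  define fn where "fn n = mollify (eps_seq n) f" for n
  have fnd: "fn n differentiable (at x)" for n x
    using mollify_has_derivative[OF _ f, of "eps_seq n" x] unfolding fn_def differentiable_def by auto
  have fnc: "continuous_on UNIV (fn n)" for n using fnd by (rule continuous_on_of_differentiable)
  have near: "norm y \<le> R + 1" if "norm x \<le> R" "norm (y - x) \<le> eps_seq n" for x y :: 'a and n
    using that eps_seq_le_1[of n] norm_triangle_ineq2[of y x] by linarith
  have comm: "\<bar>vf_deriv Y (fn n) x - mollify (eps_seq n) F x\<bar> \<le> M * L * \<omega>"
    if x: "norm x \<le> R" and \<omega>: "\<And>y. norm (y - x) \<le> eps_seq n \<Longrightarrow> \<bar>f y - f x\<bar> \<le> \<omega>" for n x \<omega>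
    unfolding fn_def
  proof (rule commutator_bound[OF M(2) _ L(1) _ f Yd div weak])
    show "norm (Y y - Y x) \<le> L * norm (y - x)" if "norm (y - x) \<le> eps_seq n" for y
      using L(2)[of x y] near[OF x that] x by simp
  qed (use M \<omega> in auto)
  have osc: "\<bar>f y - f x\<bar> \<le> 2 * B" if "norm x \<le> R" "norm (y - x) \<le> eps_seq n" for x y n
    using B(2)[of x] B(2)[OF near[OF that]] that by linarith
  \<comment> \<open>This is \<open>\<psi>\<close> times the commutator. The crude oscillation
    \<open>2 * B\<close> of \<open>f\<close> gives a dominating function, and the small oscillation
    near a point gives the pointwise limit.\<close>
  define c where "c n x = \<psi> x * vf_deriv Y (fn n) x - mollify (eps_seq n) F x * \<psi> x" for n x
  have ceq: "\<bar>c n x\<bar> = \<bar>\<psi> x\<bar> * \<bar>vf_deriv Y (fn n) x - mollify (eps_seq n) F x\<bar>" for n x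
    by (simp add: c_def abs_mult[symmetric] algebra_simps)
  have mi: "integrable lebesgue (\<lambda>x. mollify (eps_seq n) F x * \<psi> x)" for n
    by (intro mollify_fubini(1) F \<psi>c s) auto
  have cm: "c n \<in> borel_measurable lebesgue" for n
  proof -
    have "vf_deriv Y (fn n) \<in> borel_measurable lebesgue"
      using borel_measurable_vf_deriv[OF fnd Yc] by (simp add: measurable_completion)
    then show ?thesis unfolding c_def
      by (intro borel_measurable_diff borel_measurable_times measurable_lebesgue_continuous[OF \<psi>c]
         borel_measurable_integrable[OF mi])
  qed
  have cb: "\<bar>c n x\<bar> \<le> M * L * (2 * B) * \<bar>\<psi> x\<bar>" for n x
  proof (cases "R < norm x")
    case False
    then have "\<bar>vf_deriv Y (fn n) x - mollify (eps_seq n) F x\<bar> \<le> M * L * (2 * B)"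
      by (intro comm osc) auto
    then show ?thesis unfolding ceq by (metis abs_ge_zero mult.commute mult_right_mono)
  qed (simp add: c_def R)
  have \<psi>i: "integrable lebesgue \<psi>" by (rule integrable_lebesgue_continuous[OF \<psi>c s])
  have ci: "integrable lebesgue (c n)" for n
    by (rule Bochner_Integration.integrable_bound[of _ "\<lambda>x. M * L * (2 * B) * \<bar>\<psi> x\<bar>"])
       (use \<psi>i cm cb M L B in \<open>auto simp: abs_mult\<close>)
  have clim: "(\<lambda>n. c n x) \<longlonglongrightarrow> 0" for x
  proof (cases "R < norm x")
    case True
    then show ?thesis by (simp add: c_def R)
  next
    case False
    show ?thesis
    proof (rule LIMSEQ_I)
      fix e :: real assume e: "0 < e"
      \<comment> \<open>The summand 1 guards against a vanishing denominator and makes the final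
        inequality strict.\<close>
      define e' where "e' = e / (M * L * \<bar>\<psi> x\<bar> + 1)"
      have pos: "0 < M * L * \<bar>\<psi> x\<bar> + 1" using M L by (simp add: add_nonneg_pos)
      then have e': "0 < e'" using e by (simp add: e'_def)
      have "\<forall>\<^sub>F n in sequentially. norm (c n x - 0) < e"
        using eps_seq_eventually_close[OF f e', of x]
      proof eventually_elim
        case (elim n)
        then have "\<bar>c n x\<bar> \<le> \<bar>\<psi> x\<bar> * (M * L * e')"
          unfolding ceq using False by (intro mult_left_mono comm) auto
        also have "\<dots> < (M * L * \<bar>\<psi> x\<bar> + 1) * e'" using e' by (simp add: algebra_simps)
        also have "\<dots> = e" using pos by (simp add: e'_def)
        finally show ?case by simp
      qed
      then show "\<exists>no. \<forall>n\<ge>no. norm (c n x - 0) < e" by (simp add: eventually_sequentially)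
    qed
  qed
  have lim1: "(\<lambda>n. \<integral>x. c n x \<partial>lebesgue) \<longlonglongrightarrow> (\<integral>x. (0::real) \<partial>(lebesgue :: 'a measure))"
    by (rule integral_dominated_convergence[where w="\<lambda>x. M * L * (2 * B) * \<bar>\<psi> x\<bar>"])
       (use \<psi>i cm cb clim in auto)
  have lim2: "(\<lambda>n. \<integral>x. mollify (eps_seq n) F x * \<psi> x \<partial>lebesgue) \<longlonglongrightarrow> (\<integral>x. F x * \<psi> x \<partial>lebesgue)"
    by (rule mollify_pairing_tendsto[OF F \<psi>c s])
  have fnb: "\<bar>fn n x\<bar> \<le> 3 * B" if "norm x \<le> R" for n x
  proof -
    have "\<bar>fn n x - f x\<bar> \<le> 2 * B" unfolding fn_def using osc[OF that] by (intro mollify_close f) auto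
    then show ?thesis using B(2)[of x] that by linarith
  qed
  have C0: "0 \<le> C" using C[of 0] by simp
  have fnl: "fn n absolutely_integrable_on K" "f absolutely_integrable_on K" if "compact K" for n K
    using absolutely_integrable_on_compact_continuous fnc f that by auto
  have fi: "integrable lebesgue (\<lambda>x. fn n x * vf_deriv Y \<psi> x)" for n
    by (rule integrable_loc_mult[OF fnl(1) Yml C sY])
  have lim3: "(\<lambda>n. \<integral>x. fn n x * vf_deriv Y \<psi> x \<partial>lebesgue) \<longlonglongrightarrow> (\<integral>x. f x * vf_deriv Y \<psi> x \<partial>lebesgue)"
  proof (rule integral_dominated_convergence)
    show "(\<lambda>x. f x * vf_deriv Y \<psi> x) \<in> borel_measurable lebesgue"
      using integrable_loc_mult[OF fnl(2) Yml C sY] by auto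
    show "(\<lambda>x. fn n x * vf_deriv Y \<psi> x) \<in> borel_measurable lebesgue" for n using fi by auto
    show "integrable lebesgue (\<lambda>x. 3 * B * C * indicator (cball 0 R) x)"
      by (intro integrable_mult_right integrable_real_indicator) (auto simp: emeasure_cball R less_imp_le)
    show "AE x in lebesgue. (\<lambda>n. fn n x * vf_deriv Y \<psi> x) \<longlonglongrightarrow> f x * vf_deriv Y \<psi> x"
      unfolding fn_def by (intro AE_I2 tendsto_intros mollify_tendsto f)
    show "AE x in lebesgue. norm (fn n x * vf_deriv Y \<psi> x) \<le> 3 * B * C * indicator (cball 0 R) x" for n
    proof (rule AE_I2)
      fix x show "norm (fn n x * vf_deriv Y \<psi> x) \<le> 3 * B * C * indicator (cball 0 R) x"
      proof (cases "R < norm x")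
        case False
        then have "\<bar>fn n x\<bar> * \<bar>vf_deriv Y \<psi> x\<bar> \<le> (3 * B) * C"
          using fnb[of x n] C[of x] B by (intro mult_mono) auto
        then show ?thesis using False by (simp add: abs_mult)
      qed (simp add: Y0)
    qed
  qed
  \<comment> \<open>The three integrands add up to \<open>Y\<close> applied to the product of
    \<open>fn n\<close> and \<open>\<psi>\<close>, whose integral vanishes. The identity holds for
    each \<open>n\<close>, and the limit is taken term by term.\<close>
  have zero: "(\<integral>x. fn n x * vf_deriv Y \<psi> x \<partial>lebesgue) + (\<integral>x. mollify (eps_seq n) F x * \<psi> x \<partial>lebesgue)
      + (\<integral>x. c n x \<partial>lebesgue) = 0" for n
  proof -
    have eq: "vf_deriv Y (\<lambda>x. fn n x * \<psi> x) x = fn n x * vf_deriv Y \<psi> x + vf_deriv Y (fn n) x * \<psi> x" for x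
      using vf_deriv_eq[OF has_derivative_mult[OF has_derivative_frechet_derivative[OF fnd] has_derivative_frechet_derivative[OF \<psi>]]]
      by (simp add: vf_deriv_def)
    have gd: "(\<lambda>x. fn n x * \<psi> x) differentiable (at x)" for x using fnd \<psi> by (rule differentiable_mult)
    have meas: "vf_deriv Y (\<lambda>x. fn n x * \<psi> x) \<in> borel_measurable borel"
      by (rule borel_measurable_vf_deriv[OF gd Yc])
    have eq2: "vf_deriv Y (\<lambda>x. fn n x * \<psi> x) = (\<lambda>x. fn n x * vf_deriv Y \<psi> x + mollify (eps_seq n) F x * \<psi> x + c n x)"
      by (rule ext, subst eq) (simp add: c_def algebra_simps)
    have il: "integrable lebesgue (vf_deriv Y (\<lambda>x. fn n x * \<psi> x))"
      unfolding eq2 by (intro Bochner_Integration.integrable_add fi mi ci)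
    then have ib: "integrable lborel (vf_deriv Y (\<lambda>x. fn n x * \<psi> x))"
      using meas by (simp add: integrable_completion)
    have "(\<integral>x. vf_deriv Y (\<lambda>x. fn n x * \<psi> x) x \<partial>lborel) = 0"
      by (rule integral_vf_deriv_eq_0[OF gd _ Yd div ib]) (rule bounded_subset[OF s], auto)
    then have "(\<integral>x. vf_deriv Y (\<lambda>x. fn n x * \<psi> x) x \<partial>lebesgue) = 0"
      using meas by (simp add: integral_lebesgue_eq_lborel)
    then show ?thesis unfolding eq2
      using fi[of n] mi[of n] ci[of n] by simp
  qed
  have "(\<lambda>n. (\<integral>x. fn n x * vf_deriv Y \<psi> x \<partial>lebesgue) + (\<integral>x. mollify (eps_seq n) F x * \<psi> x \<partial>lebesgue)
      + (\<integral>x. c n x \<partial>lebesgue)) \<longlonglongrightarrow> (\<integral>x. f x * vf_deriv Y \<psi> x \<partial>lebesgue) + (\<integral>x. F x * \<psi> x \<partial>lebesgue) + 0"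
    using lim1 by (intro tendsto_add lim2 lim3) simp
  then show ?thesis unfolding zero by (simp add: LIMSEQ_const_iff)
qed

section \<open>Products and cutoffs\<close>

lemma continuous_on_vf_deriv:
  fixes Y :: "'a::euclidean_space \<Rightarrow> 'a"
  assumes \<phi>: "Ck (Suc 0) \<phi>" and Y: "continuous_on UNIV Y"
  shows "continuous_on UNIV (vf_deriv Y \<phi>)"
proof -
  have d: "\<phi> differentiable (at x)" for x using \<phi> by simp
  have "vf_deriv Y \<phi> x = (\<Sum>b\<in>Basis. (Y x \<bullet> b) * frechet_derivative \<phi> (at x) b)" for x
  proof -
    have lin: "linear (frechet_derivative \<phi> (at x))"
      using has_derivative_frechet_derivative[OF d] has_derivative_linear by blast
    have "vf_deriv Y \<phi> x = frechet_derivative \<phi> (at x) (\<Sum>b\<in>Basis. (Y x \<bullet> b) *\<^sub>R b)"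
      by (simp only: euclidean_representation vf_deriv_def)
    then show ?thesis using lin by (simp add: linear_sum linear_scale)
  qed
  then have eq: "vf_deriv Y \<phi> = (\<lambda>x. \<Sum>b\<in>Basis. (Y x \<bullet> b) * frechet_derivative \<phi> (at x) b)" by blast
  show ?thesis unfolding eq using \<phi> by (intro continuous_intros Y) auto
qed

lemma vf_deriv_mult:
  assumes "f differentiable (at x)" "g differentiable (at x)"
  shows "vf_deriv Y (\<lambda>x. f x * g x) x = f x * vf_deriv Y g x + vf_deriv Y f x * g x"
  using vf_deriv_eq[OF has_derivative_mult[OF has_derivative_frechet_derivative[OF assms(1)] has_derivative_frechet_derivative[OF assms(2)]]]
  by (simp add: vf_deriv_def)

text \<open>For a test function \<open>\<phi>\<close> the product \<open>g \<phi>\<close> is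
  differentiable but in general not smooth, so it is admissible only in the extended integration by
  parts. Applied to \<open>f\<close>, that gives the product rule after splitting
  \<open>Y (g \<phi>)\<close>.\<close>

lemma has_weak_deriv_mult:
  fixes Y :: "'a::euclidean_space \<Rightarrow> 'a"
  assumes Y: "smooth Y" and div: "\<And>x. divergence Y x = 0"
    and f: "continuous_on UNIV f" and weak: "has_weak_deriv Y f F"
    and g: "\<And>x. g differentiable (at x)"
    and B: "\<And>R. \<exists>B. \<forall>x. norm x \<le> R \<longrightarrow> \<bar>vf_deriv Y g x\<bar> \<le> B"
  shows "has_weak_deriv Y (\<lambda>x. f x * g x) (\<lambda>x. F x * g x + f x * vf_deriv Y g x)"
  unfolding has_weak_deriv_def
proof (intro conjI allI impI)
  have F: "F absolutely_integrable_on K" if "compact K" for K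
    using weak that unfolding has_weak_deriv_def by auto
  have fl: "f absolutely_integrable_on K" if "compact K" for K
    using absolutely_integrable_on_compact_continuous[OF f that] .
  have Yc: "continuous_on UNIV Y"
    using smooth_imp_differentiable[OF Y] by (rule continuous_on_of_differentiable)
  have gc: "continuous_on UNIV g" using g by (rule continuous_on_of_differentiable)
  have Ygm: "vf_deriv Y g \<in> borel_measurable lebesgue"
    using borel_measurable_vf_deriv[OF g Yc] by (simp add: measurable_completion)
  have gm: "g \<in> borel_measurable lebesgue" by (rule measurable_lebesgue_continuous[OF gc])
  {
    fix K :: "'a set" assume K: "compact K"
    obtain R where R: "\<And>x. x \<in> K \<Longrightarrow> norm x \<le> R" using compact_imp_bounded[OF K] unfolding bounded_iff by auto
    have Km: "K \<in> sets lebesgue" using fmeasurableD[OF lmeasurable_compact[OF K]] .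
    obtain B1 where B1: "\<And>x. norm x \<le> R \<Longrightarrow> \<bar>vf_deriv Y g x\<bar> \<le> B1" using B by metis
    obtain B2 where B2: "\<And>x. norm x \<le> R \<Longrightarrow> \<bar>g x\<bar> \<le> B2"
      using continuous_bounded_on_cball[OF gc, of R] by auto
    have loc: "integrable lebesgue (\<lambda>x. h x * (indicator K x * k x))"
      if h: "\<And>K. compact K \<Longrightarrow> h absolutely_integrable_on K" and k: "k \<in> borel_measurable lebesgue"
        and C: "\<And>x. norm x \<le> R \<Longrightarrow> \<bar>k x\<bar> \<le> C" for h k :: "'a \<Rightarrow> real" and C
    proof (rule integrable_loc_mult[OF h])
      show "(\<lambda>x. indicator K x * k x) \<in> borel_measurable lebesgue"
        using Km k by (intro borel_measurable_times borel_measurable_indicator)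
      show "\<bar>indicator K x * k x\<bar> \<le> \<bar>C\<bar>" for x
        using C[of x] R[of x] by (auto simp: indicator_def)
      show "bounded {x. indicator K x * k x \<noteq> 0}"
        by (rule bounded_subset[OF compact_imp_bounded[OF K]]) (auto simp: indicator_def)
    qed
    have "integrable lebesgue (\<lambda>x. F x * (indicator K x * g x) + f x * (indicator K x * vf_deriv Y g x))"
      by (intro Bochner_Integration.integrable_add loc[OF F gm B2] loc[OF fl Ygm B1])
    then show "(\<lambda>x. F x * g x + f x * vf_deriv Y g x) absolutely_integrable_on K"
      unfolding set_integrable_def by (simp add: algebra_simps)
  }
  fix \<phi> :: "'a \<Rightarrow> real" assume t: "test_fun UNIV \<phi>"
  note t' = test_fun_imp[OF t]
  have Y\<phi>c: "continuous_on UNIV (vf_deriv Y \<phi>)"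
    using t unfolding test_fun_def smooth_def by (blast intro: continuous_on_vf_deriv Yc)
  have sY\<phi>: "bounded {x. vf_deriv Y \<phi> x \<noteq> 0}" using t'(2) by (rule bounded_vf_deriv_support)
  obtain R where R: "\<And>x. R < norm x \<Longrightarrow> \<phi> x = 0" using bounded_obtain_cball[OF t'(2)] by metis
  obtain B1 where B1: "\<And>x. norm x \<le> R \<Longrightarrow> \<bar>vf_deriv Y g x\<bar> \<le> B1" using B by metis
  have gY\<phi>c: "continuous_on UNIV (\<lambda>x. g x * vf_deriv Y \<phi> x)" by (intro continuous_on_mult gc Y\<phi>c)
  have gY\<phi>s: "bounded {x. g x * vf_deriv Y \<phi> x \<noteq> 0}" by (rule bounded_subset[OF sY\<phi>]) auto
  obtain B2 where B2: "\<And>x. \<bar>g x * vf_deriv Y \<phi> x\<bar> \<le> B2"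
    using continuous_bounded_support_bounded[OF gY\<phi>c gY\<phi>s] by metis
  obtain B3 where B3: "0 < B3" "\<And>x. \<bar>\<phi> x\<bar> \<le> B3" using continuous_bounded_support_bounded[OF t'(1,2)] by metis
  have B4: "\<bar>vf_deriv Y g x * \<phi> x\<bar> \<le> \<bar>B1\<bar> * B3" for x
  proof (cases "R < norm x")
    case False
    then have "\<bar>vf_deriv Y g x\<bar> \<le> \<bar>B1\<bar>" using B1[of x] by simp
    then show ?thesis unfolding abs_mult using B3 by (intro mult_mono) auto
  qed (use R B3 in simp)
  have s4: "bounded {x. vf_deriv Y g x * \<phi> x \<noteq> 0}" by (rule bounded_subset[OF t'(2)]) auto
  have m4: "(\<lambda>x. vf_deriv Y g x * \<phi> x) \<in> borel_measurable lebesgue"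
    by (intro borel_measurable_times Ygm measurable_lebesgue_continuous t'(1))
  have eq: "vf_deriv Y (\<lambda>x. g x * \<phi> x) x = g x * vf_deriv Y \<phi> x + vf_deriv Y g x * \<phi> x" for x
    by (rule vf_deriv_mult[OF g t'(3)])
  have ibp: "(\<integral>x. F x * (g x * \<phi> x) \<partial>lebesgue) = - (\<integral>x. f x * vf_deriv Y (\<lambda>x. g x * \<phi> x) x \<partial>lebesgue)"
  proof (rule weak_integration_by_parts[OF Y div f weak])
    show "(\<lambda>x. g x * \<phi> x) differentiable (at x)" for x using g t'(3) by (rule differentiable_mult)
    show "bounded {x. g x * \<phi> x \<noteq> 0}" by (rule bounded_subset[OF t'(2)]) auto
    show "\<bar>vf_deriv Y (\<lambda>x. g x * \<phi> x) x\<bar> \<le> B2 + \<bar>B1\<bar> * B3" for x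
      unfolding eq using B2[of x] B4[of x] by linarith
  qed
  have i1: "integrable lebesgue (\<lambda>x. F x * (g x * \<phi> x))"
    by (rule integrable_loc_mult_continuous[OF F])
       (auto intro!: continuous_on_mult gc t'(1) bounded_subset[OF t'(2)])
  have i2: "integrable lebesgue (\<lambda>x. f x * (g x * vf_deriv Y \<phi> x))"
    by (rule integrable_loc_mult_continuous[OF fl gY\<phi>c gY\<phi>s])
  have i3: "integrable lebesgue (\<lambda>x. f x * (vf_deriv Y g x * \<phi> x))"
    by (rule integrable_loc_mult[OF fl m4 B4 s4])
  have "(\<integral>x. (F x * g x + f x * vf_deriv Y g x) * \<phi> x \<partial>lebesgue)
      = (\<integral>x. F x * (g x * \<phi> x) + f x * (vf_deriv Y g x * \<phi> x) \<partial>lebesgue)"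
    by (rule Bochner_Integration.integral_cong) (auto simp: algebra_simps)
  also have "\<dots> = (\<integral>x. F x * (g x * \<phi> x) \<partial>lebesgue) + (\<integral>x. f x * (vf_deriv Y g x * \<phi> x) \<partial>lebesgue)"
    using i1 i3 by simp
  also have "(\<integral>x. F x * (g x * \<phi> x) \<partial>lebesgue)
      = - (\<integral>x. f x * (g x * vf_deriv Y \<phi> x) + f x * (vf_deriv Y g x * \<phi> x) \<partial>lebesgue)"
    unfolding ibp eq by (simp only: distrib_left)
  also have "\<dots> = - (\<integral>x. f x * (g x * vf_deriv Y \<phi> x) \<partial>lebesgue) - (\<integral>x. f x * (vf_deriv Y g x * \<phi> x) \<partial>lebesgue)"
    using i2 i3 by simp
  finally show "(\<integral>x. (F x * g x + f x * vf_deriv Y g x) * \<phi> x \<partial>lebesgue) = - (\<integral>x. f x * g x * vf_deriv Y \<phi> x \<partial>lebesgue)"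
    by (simp add: mult.assoc)
qed

lemma weak_grad_has_weak_deriv:
  assumes "f \<in> class_L X"
  shows "has_weak_deriv (X i) f (\<lambda>x. weak_grad X f x $ i)"
proof -
  have "\<exists>g. has_weak_deriv (X i) f g" using assms by (auto simp: class_L_def)
  from someI_ex[OF this] show ?thesis by (simp add: weak_grad_def)
qed

text \<open>\<open>weak_grad\<close> selects an unspecified representative, so the second claim
  comes from uniqueness and holds almost everywhere. Local boundedness of
  \<open>vf_deriv (X i) g\<close> keeps the new derivatives in \<open>Linf_loc\<close>.\<close>

lemma class_L_mult:
  fixes X :: "'k::finite \<Rightarrow> 'a::euclidean_space \<Rightarrow> 'a"
  assumes X: "\<And>i. smooth (X i)" and div: "\<And>i x. divergence (X i) x = 0"
    and f: "f \<in> class_L X" and g: "\<And>x. g differentiable (at x)"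
    and B: "\<And>i R. \<exists>B. \<forall>x. norm x \<le> R \<longrightarrow> \<bar>vf_deriv (X i) g x\<bar> \<le> B"
  shows "(\<lambda>x. f x * g x) \<in> class_L X"
    and "AE x in lebesgue. weak_grad X (\<lambda>x. f x * g x) x = g x *\<^sub>R weak_grad X f x + f x *\<^sub>R classical_grad X g x"
proof -
  have fc: "continuous_on UNIV f" using f by (simp add: class_L_def)
  have gc: "continuous_on UNIV g" using g by (rule continuous_on_of_differentiable)
  have m: "vf_deriv (X i) g \<in> borel_measurable lebesgue" for i
    using borel_measurable_vf_deriv[OF g continuous_on_of_differentiable[OF smooth_imp_differentiable[OF X]]]
    by (simp add: measurable_completion)
  note prod = has_weak_deriv_mult[OF X div fc _ g B]
  have "\<exists>G. Linf_loc G \<and> has_weak_deriv (X i) (\<lambda>x. f x * g x) G" for i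
  proof -
    obtain F where F: "Linf_loc F" "has_weak_deriv (X i) f F" using f by (auto simp: class_L_def)
    have "Linf_loc (\<lambda>x. F x * g x + f x * vf_deriv (X i) g x)"
      unfolding Linf_loc_def
    proof (intro conjI allI impI)
      have "F \<in> borel_measurable lebesgue" using F(1) by (simp add: Linf_loc_def)
      then show "(\<lambda>x. F x * g x + f x * vf_deriv (X i) g x) \<in> borel_measurable lebesgue"
        by (intro borel_measurable_add borel_measurable_times m measurable_lebesgue_continuous[OF fc]
            measurable_lebesgue_continuous[OF gc])
      fix K :: "'a set" assume K: "compact K"
      obtain R where R: "\<And>x. x \<in> K \<Longrightarrow> norm x \<le> R" using compact_imp_bounded[OF K] unfolding bounded_iff by auto
      obtain B1 where B1: "\<And>x. norm x \<le> R \<Longrightarrow> \<bar>vf_deriv (X i) g x\<bar> \<le> B1" using B by metis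
      obtain B2 where B2: "0 < B2" "\<And>x. norm x \<le> R \<Longrightarrow> \<bar>g x\<bar> \<le> B2"
        using continuous_bounded_on_cball[OF gc, of R] by auto
      obtain B3 where B3: "0 < B3" "\<And>x. norm x \<le> R \<Longrightarrow> \<bar>f x\<bar> \<le> B3"
        using continuous_bounded_on_cball[OF fc, of R] by auto
      obtain M where M: "AE x in lebesgue. x \<in> K \<longrightarrow> \<bar>F x\<bar> \<le> M" using F(1) K unfolding Linf_loc_def by metis
      have "AE x in lebesgue. x \<in> K \<longrightarrow> \<bar>F x * g x + f x * vf_deriv (X i) g x\<bar> \<le> \<bar>M\<bar> * B2 + B3 * \<bar>B1\<bar>"
        using M
      proof eventually_elim
        case (elim x)
        show ?case
        proof
          assume x: "x \<in> K"
          have 1: "\<bar>F x\<bar> * \<bar>g x\<bar> \<le> \<bar>M\<bar> * B2"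
            using elim x B2 R[OF x] by (intro mult_mono) auto
          have "\<bar>vf_deriv (X i) g x\<bar> \<le> \<bar>B1\<bar>" using B1[OF R[OF x]] by simp
          then have 2: "\<bar>f x\<bar> * \<bar>vf_deriv (X i) g x\<bar> \<le> B3 * \<bar>B1\<bar>"
            using B3 R[OF x] by (intro mult_mono) auto
          show "\<bar>F x * g x + f x * vf_deriv (X i) g x\<bar> \<le> \<bar>M\<bar> * B2 + B3 * \<bar>B1\<bar>"
            using 1 2 abs_triangle_ineq[of "F x * g x" "f x * vf_deriv (X i) g x"] by (simp add: abs_mult)
        qed
      qed
      then show "\<exists>M. AE x in lebesgue. x \<in> K \<longrightarrow> \<bar>F x * g x + f x * vf_deriv (X i) g x\<bar> \<le> M" by blast
    qed
    then show ?thesis using prod[OF F(2)] by blast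
  qed
  then show L: "(\<lambda>x. f x * g x) \<in> class_L X"
    using fc gc by (auto simp: class_L_def intro!: continuous_on_mult)
  have "AE x in lebesgue. weak_grad X (\<lambda>x. f x * g x) x $ i = weak_grad X f x $ i * g x + f x * vf_deriv (X i) g x" for i
    by (rule weak_deriv_unique[OF weak_grad_has_weak_deriv[OF L] prod[OF weak_grad_has_weak_deriv[OF f]]])
  then have "AE x in lebesgue. \<forall>i. weak_grad X (\<lambda>x. f x * g x) x $ i = weak_grad X f x $ i * g x + f x * vf_deriv (X i) g x"
    by (rule eventually_all_finite)
  then show "AE x in lebesgue. weak_grad X (\<lambda>x. f x * g x) x = g x *\<^sub>R weak_grad X f x + f x *\<^sub>R classical_grad X g x"
    by eventually_elim (simp add: vec_eq_iff classical_grad_def mult.commute)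
qed

section \<open>Cutoff functions built from the distance\<close>

lemma mollify_ge:
  fixes f :: "'a::euclidean_space \<Rightarrow> real"
  assumes r: "0 < r" and f: "continuous_on UNIV f" and c: "\<And>y. norm (y - x) < r \<Longrightarrow> c \<le> f y"
  shows "c \<le> mollify r f x"
proof -
  have "c = (\<integral>y. mollifier r (x - y) * c \<partial>lebesgue)"
    by (simp only: Bochner_Integration.integral_mult_left_zero integral_mollifier[OF r] mult_1)
  also have "\<dots> \<le> mollify r f x"
    unfolding mollify_def
  proof (rule integral_mono)
    show "mollifier r (x - y) * c \<le> mollifier r (x - y) * f y" for y
      using c[of y] mollifier_nonneg[OF r, of "x - y"] mollifier_eq_0[OF r, of "x - y"]
      by (cases "norm (y - x) < r") (auto simp: norm_minus_commute intro!: mult_left_mono)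
  qed (intro integrable_mollifier_mult r f continuous_intros)+
  finally show ?thesis .
qed

lemma mollify_AE_bound:
  fixes F :: "'a::euclidean_space \<Rightarrow> real"
  assumes r: "0 < r" and F: "\<And>K. compact K \<Longrightarrow> F absolutely_integrable_on K"
    and b: "AE y in lebesgue. \<bar>F y\<bar> \<le> B"
  shows "\<bar>mollify r F x\<bar> \<le> B"
proof -
  have i: "integrable lebesgue (\<lambda>y. F y * mollifier r (x - y))"
    using bounded_mollifier_support[OF r, of x "\<lambda>_. 1"]
    by (intro integrable_loc_mult_continuous F continuous_on_mollifier_diff) auto
  have "\<bar>mollify r F x\<bar> \<le> (\<integral>y. \<bar>F y * mollifier r (x - y)\<bar> \<partial>lebesgue)"
    unfolding mollify_def mult.commute[of "mollifier _ _"] by (rule integral_abs_bound)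
  also have "\<dots> \<le> (\<integral>y. mollifier r (x - y) * B \<partial>lebesgue)"
  proof (rule integral_mono_AE)
    show "integrable lebesgue (\<lambda>y. \<bar>F y * mollifier r (x - y)\<bar>)" using i by (rule integrable_abs)
    show "integrable lebesgue (\<lambda>y. mollifier r (x - y) * B)" by (intro integrable_mollifier_mult r continuous_intros)
    show "AE y in lebesgue. \<bar>F y * mollifier r (x - y)\<bar> \<le> mollifier r (x - y) * B"
      using b
    proof eventually_elim
      case (elim y)
      show ?case using mult_left_mono[OF elim mollifier_nonneg[OF r, of "x - y"]] mollifier_nonneg[OF r, of "x - y"]
        by (simp add: abs_mult mult.commute)
    qed
  qed
  also have "\<dots> = B"
    by (simp only: Bochner_Integration.integral_mult_left_zero integral_mollifier[OF r] mult_1)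
  finally show ?thesis .
qed

text \<open>The positive part has a corner at 0 which squaring removes. Two such squares will form
  the cutoff profile, differentiable with explicit derivative.\<close>

lemma has_derivative_pos_part_square:
  "((\<lambda>t::real. (max 0 t)\<^sup>2) has_real_derivative 2 * max 0 t) (at t)"
proof -
  consider "t < 0" | "t = 0" | "t > 0" by linarith
  then show ?thesis
  proof cases
    case 1
    have "((\<lambda>_. 0) has_real_derivative 0) (at t)" by simp
    then have "((\<lambda>t::real. (max 0 t)\<^sup>2) has_real_derivative 0) (at t)"
      by (rule has_field_derivative_transform_within_open[where S="{..<0}"]) (use 1 in auto)
    then show ?thesis using 1 by simp
  next
    case 2
    have "((\<lambda>h. max 0 h) \<longlongrightarrow> (max 0 0 :: real)) (at 0)" by (intro tendsto_intros)
    then have "((\<lambda>h. ((max 0 (0 + h))\<^sup>2 - (max 0 0)\<^sup>2) / h) \<longlongrightarrow> (0::real)) (at 0)"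
      by (rule_tac Lim_transform_eventually) (auto simp: eventually_at_filter power2_eq_square max_def)
    then show ?thesis using 2 by (simp add: DERIV_def)
  next
    case 3
    have "((\<lambda>t. t\<^sup>2) has_real_derivative 2 * t) (at t)" by (auto intro!: derivative_eq_intros)
    then have "((\<lambda>t::real. (max 0 t)\<^sup>2) has_real_derivative 2 * t) (at t)"
      by (rule has_field_derivative_transform_within_open[where S="{0<..}"]) (use 3 in auto)
    then show ?thesis using 3 by simp
  qed
qed

text \<open>The cutoff is a profile of \<open>d\<close> mollified at a scale depending on \<open>R\<close>; the constant \<open>8\<close> is
  the bound \<open>4\<close> for the derivative of the profile times the bound \<open>2\<close> for the mollified \<open>d\<close>.\<close>

lemma cutoff_exists:
  fixes X :: "'k::finite \<Rightarrow> 'a::euclidean_space \<Rightarrow> 'a"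
  assumes X: "\<And>i. smooth (X i)" and div: "\<And>i x. divergence (X i) x = 0"
    and d: "d \<in> class_L X" and balls: "\<And>R. compact {x. d x \<le> R}"
    and grad: "AE x in lebesgue. norm (weak_grad X d x) \<le> 1"
  shows "\<exists>\<eta>. (\<forall>x. \<eta> differentiable (at x)) \<and> bounded {x. \<eta> x \<noteq> 0} \<and> (\<forall>x. 0 \<le> \<eta> x \<and> \<eta> x \<le> 1)
     \<and> (\<forall>x. d x \<le> R \<longrightarrow> \<eta> x = 1) \<and> (\<forall>i x. \<bar>vf_deriv (X i) \<eta> x\<bar> \<le> 8)"
proof -
  have dc: "continuous_on UNIV d" using d by (simp add: class_L_def)
  \<comment> \<open>The level \<open>R + 2\<close> is where the cutoff has to be zero: 1 for the
    error of the mollified distance and 1 for the width of the transition.\<close>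
  obtain r where r: "\<And>x. d x \<le> R + 2 \<Longrightarrow> norm x \<le> r"
    using compact_imp_bounded[OF balls[of "R+2"]] unfolding bounded_iff by auto
  obtain M where M: "0 < M" "\<And>u z v. 0 < u \<Longrightarrow>
     \<bar>mollifier_slope u z * ((z::'a) \<bullet> v)\<bar> \<le> M / (u * measure lborel (ball (0::'a) u)) * norm v"
    using mollifier_slope_bound by metis
  have "\<exists>L\<ge>0. \<forall>x y. norm x \<le> r + 2 \<longrightarrow> norm y \<le> r + 2 \<longrightarrow> norm (X i y - X i x) \<le> L * norm (y - x)" for i
    using smooth_locally_lipschitz[OF X, of "r + 2" i] by metis
  then obtain L where L: "\<And>i. 0 \<le> L i" "\<And>i x y. norm x \<le> r + 2 \<Longrightarrow> norm y \<le> r + 2 \<Longrightarrow> norm (X i y - X i x) \<le> L i * norm (y - x)"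
    by metis
  define S where "S = (\<Sum>i\<in>UNIV. L i)"
  have LS: "L i \<le> S" for i unfolding S_def using L(1) by (intro member_le_sum) auto
  have S0: "0 \<le> S" unfolding S_def using L(1) by (intro sum_nonneg) auto
  \<comment> \<open>\<open>w\<close> is the oscillation of \<open>d\<close> allowed within the
    mollification radius. It is chosen so that the commutator bound \<open>M * L i * w\<close> is at
    most 1 for all fields at once; \<open>S\<close> dominates every \<open>L i\<close>.\<close>
  define w where "w = 1 / (M * S + 1)"
  have pos: "0 < M * S + 1" using M(1) S0 by (simp add: add_nonneg_pos)
  have w: "0 < w" "w \<le> 1" "M * S * w \<le> 1"
    using pos M(1) S0 by (auto simp: w_def field_simps)
  have "uniformly_continuous_on (cball 0 (r + 2)) d"
    by (intro compact_uniformly_continuous continuous_on_subset[OF dc]) auto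
  then obtain \<delta> where \<delta>: "0 < \<delta>" "\<And>x y. norm x \<le> r + 2 \<Longrightarrow> norm y \<le> r + 2 \<Longrightarrow> norm (y - x) < \<delta> \<Longrightarrow> \<bar>d y - d x\<bar> < w"
    unfolding uniformly_continuous_on_def using w(1) by (force simp: dist_norm)
  define u where "u = min 1 (\<delta> / 2)"
  have u: "0 < u" "u \<le> 1" "u < \<delta>" using \<delta>(1) by (auto simp: u_def)
  define m where "m = mollify u d"
  have md: "m differentiable (at x)" for x
    using mollify_has_derivative[OF u(1) dc] unfolding m_def differentiable_def by blast
  have inb: "norm y \<le> r + 2" if "norm x \<le> r + 1" "norm (y - x) \<le> u" for x y :: 'a
    using that u(2) norm_triangle_ineq2[of y x] by linarith
  have close: "\<bar>d y - d x\<bar> \<le> w" if "norm x \<le> r + 1" "norm (y - x) \<le> u" for x y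
    using \<delta>(2)[of x y] inb[OF that] that u(3) by force
  have m_close: "\<bar>m x - d x\<bar> \<le> 1" if "norm x \<le> r + 1" for x
    using mollify_close[OF u(1) dc, of x w] close[OF that] w(2) unfolding m_def by fastforce
  \<comment> \<open>As \<open>u\<close> is at most 1, beyond radius \<open>r + 1\<close> only values
    of \<open>d\<close> above \<open>R + 2\<close> are averaged.\<close>
  have m_far: "norm x \<le> r + 1" if "m x < R + 2" for x
  proof (rule ccontr)
    assume far: "\<not> norm x \<le> r + 1"
    have "R + 2 \<le> m x"
      unfolding m_def
    proof (rule mollify_ge[OF u(1) dc])
      fix y assume "norm (y - x) < u"
      then have "r < norm y" using far u(2) norm_triangle_ineq2[of x y] norm_minus_commute[of x y] by linarith
      then show "R + 2 \<le> d y" using r[of y] by linarith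
    qed
    then show False using that by simp
  qed
  \<comment> \<open>One unit comes from mollifying a weak derivative bounded by 1, the other from
    the commutator.\<close>
  have Xm: "\<bar>vf_deriv (X i) m x\<bar> \<le> 2" if x: "norm x \<le> r + 1" for i x
  proof -
    let ?F = "\<lambda>x. weak_grad X d x $ i"
    have weak: "has_weak_deriv (X i) d ?F" by (rule weak_grad_has_weak_deriv[OF d])
    have "AE y in lebesgue. \<bar>?F y\<bar> \<le> 1"
      using grad by eventually_elim (meson component_le_norm_cart order_trans)
    then have 1: "\<bar>mollify u ?F x\<bar> \<le> 1"
      using weak by (intro mollify_AE_bound u(1)) (auto simp: has_weak_deriv_def)
    have "\<bar>vf_deriv (X i) m x - mollify u ?F x\<bar> \<le> M * L i * w"
      unfolding m_def
    proof (rule commutator_bound[OF M(2) _ L(1) _ dc smooth_imp_differentiable[OF X] div weak])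
      show "norm (X i y - X i x) \<le> L i * norm (y - x)" if "norm (y - x) \<le> u" for y
        using L(2)[of x y i] inb[OF x that] x by simp
    qed (use M u close[OF x] in auto)
    also have "\<dots> \<le> M * S * w" using LS M(1) w(1) by (intro mult_right_mono mult_left_mono) auto
    finally show ?thesis using 1 w(3) by linarith
  qed
  define s where "s t = (max 0 t)\<^sup>2" for t :: real
  \<comment> \<open>With \<open>t = m x - (R + 1)\<close> the profile is 1 for
    \<open>t \<le> 0\<close> and 0 for \<open>t \<ge> 1\<close>. Where \<open>d x \<le> R\<close>,
    the mollification \<open>m\<close> exceeds \<open>d\<close> by at most 1, hence the shift by
    \<open>R + 1\<close>.\<close>
  define \<eta> where "\<eta> x = s (1 - s (m x - (R + 1)))" for x
  have \<eta>d: "(\<eta> has_derivative (\<lambda>v. 2 * max 0 (1 - s (m x - (R+1))) * (- (2 * max 0 (m x - (R+1)) * frechet_derivative m (at x) v)))) (at x)" for x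
  proof -
    have sd: "(s has_derivative (\<lambda>h. 2 * max 0 t * h)) (at t)" for t
      using has_derivative_pos_part_square[of t] by (simp add: s_def[abs_def] has_field_derivative_def)
    have 1: "((\<lambda>x. m x - (R+1)) has_derivative frechet_derivative m (at x)) (at x)"
      using has_derivative_diff[OF has_derivative_frechet_derivative[OF md] has_derivative_const] by simp
    note 2 = has_derivative_compose[OF 1 sd]
    have 3: "((\<lambda>x. 1 - s (m x - (R+1))) has_derivative (\<lambda>v. - (2 * max 0 (m x - (R+1)) * frechet_derivative m (at x) v))) (at x)"
      using has_derivative_diff[OF has_derivative_const 2] by simp
    show ?thesis unfolding \<eta>_def[abs_def] by (rule has_derivative_compose[OF 3 sd])
  qed
  have deriv: "vf_deriv (X i) \<eta> x = 2 * max 0 (1 - s (m x - (R+1))) * (- (2 * max 0 (m x - (R+1)) * vf_deriv (X i) m x))" for i x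
    using vf_deriv_eq[OF \<eta>d] by (simp add: vf_deriv_def)
  have s01: "0 \<le> s t" for t by (simp add: s_def)
  have s1: "1 \<le> s t" if "1 \<le> t" for t using that by (simp add: s_def)
  have "\<eta> differentiable (at x)" for x using \<eta>d unfolding differentiable_def by blast
  moreover have "bounded {x. \<eta> x \<noteq> 0}"
  proof (rule bounded_subset[OF bounded_cball])
    show "{x. \<eta> x \<noteq> 0} \<subseteq> cball 0 (r + 1)"
    proof
      fix x assume "x \<in> {x. \<eta> x \<noteq> 0}"
      then have "m x < R + 2" using s1[of "m x - (R+1)"] by (rule_tac ccontr) (auto simp: \<eta>_def s_def)
      then show "x \<in> cball 0 (r + 1)" using m_far by simp
    qed
  qed
  moreover have "0 \<le> \<eta> x \<and> \<eta> x \<le> 1" for x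
    using s01 by (auto simp: \<eta>_def s_def intro!: power_le_one)
  moreover have "\<eta> x = 1" if "d x \<le> R" for x
  proof -
    have "norm x \<le> r + 1" using r[of x] that by simp
    then have "m x - (R + 1) \<le> 0" using m_close that by fastforce
    then show ?thesis by (simp add: \<eta>_def s_def)
  qed
  moreover have "\<bar>vf_deriv (X i) \<eta> x\<bar> \<le> 8" for i x
  proof (cases "m x < R + 2")
    case False
    then have "max 0 (1 - s (m x - (R+1))) = 0" using s1[of "m x - (R+1)"] by simp
    then show ?thesis unfolding deriv by simp
  next
    case True
    have a: "\<bar>max 0 (1 - s (m x - (R+1)))\<bar> \<le> 1" using s01[of "m x - (R+1)"] by simp
    have b: "\<bar>max 0 (m x - (R+1))\<bar> \<le> 1" using True by simp
    have c: "\<bar>vf_deriv (X i) m x\<bar> \<le> 2" by (rule Xm[OF m_far[OF True]])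
    have "\<bar>vf_deriv (X i) \<eta> x\<bar> = 4 * (\<bar>max 0 (1 - s (m x - (R+1)))\<bar> * (\<bar>max 0 (m x - (R+1))\<bar> * \<bar>vf_deriv (X i) m x\<bar>))"
      unfolding deriv by (simp add: abs_mult)
    also have "\<dots> \<le> 4 * (1 * (1 * 2))"
      by (intro mult_left_mono mult_mono a b c) auto
    finally show ?thesis by simp
  qed
  ultimately show ?thesis by blast
qed

section \<open>The perturbed bound\<close>

lemma powr_add_le:
  fixes a b q :: real
  assumes "0 \<le> a" "0 \<le> b" "1 \<le> q"
  shows "(a + b) powr q \<le> 2 powr (q - 1) * (a powr q + b powr q)"
proof (cases "a = 0 \<or> b = 0")
  case True
  have "1 \<le> 2 powr (q - 1)" using assms by (simp add: ge_one_powr_ge_zero)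
  then have "1 * c powr q \<le> 2 powr (q - 1) * c powr q" for c by (rule mult_right_mono) simp
  then show ?thesis using True assms by auto
next
  case False
  then have ab: "0 < a" "0 < b" using assms by auto
  have "((1 - 1/2) *\<^sub>R a + (1/2) *\<^sub>R b) powr q \<le> (1 - 1/2) * a powr q + (1/2) * b powr q"
    by (rule convex_onD[OF powr_convex[OF assms(3)]]) (use ab in auto)
  then have "((a + b) / 2) powr q \<le> (a powr q + b powr q) / 2" by (simp add: field_simps)
  then have "2 powr q * ((a + b) / 2) powr q \<le> 2 powr q * ((a powr q + b powr q) / 2)"
    by (rule mult_left_mono) simp
  moreover have "2 powr q * ((a + b) / 2) powr q = (a + b) powr q"
  proof -
    have "2 * ((a + b) / 2) = a + b" by simp
    then show ?thesis using ab by (simp only: powr_mult[symmetric])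
  qed
  ultimately have "(a + b) powr q \<le> 2 powr q / 2 * (a powr q + b powr q)" by (simp add: field_simps)
  moreover have "2 powr (q - 1) = 2 powr q / (2::real)" by (simp add: powr_diff)
  ultimately show ?thesis by (simp only:)
qed

lemma norm_add_powr_le:
  fixes u v :: "'a::real_normed_vector"
  assumes "1 \<le> q"
  shows "norm (u + v) powr q \<le> 2 powr (q - 1) * (norm u powr q + norm v powr q)"
proof -
  have "norm (u + v) powr q \<le> (norm u + norm v) powr q"
    using assms by (intro powr_mono2 norm_triangle_ineq) auto
  also have "\<dots> \<le> 2 powr (q - 1) * (norm u powr q + norm v powr q)"
    using assms by (intro powr_add_le) auto
  finally show ?thesis .
qed

lemma norm_scaleR_powr: "norm (a *\<^sub>R v) powr q = \<bar>a\<bar> powr q * norm v powr q"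
  by (simp add: powr_mult)

text \<open>The convexity inequality is used twice, and the order matters. The \<open>DW\<close>
  term is split off first and so carries a single factor \<open>2 powr (q - 1)\<close>, as in the
  smallness condition; separating the cutoff from \<open>Df\<close> costs the second factor, which
  falls only on terms that are not absorbed.\<close>

lemma gradient_bound:
  fixes Df D\<eta> DW :: "'a::real_normed_vector"
  assumes q: "1 \<le> q" and e: "0 < e" and \<eta>: "0 \<le> \<eta>" "\<eta> \<le> 1" and c: "norm D\<eta> \<le> c"
    and S: "norm DW powr q \<le> S"
  shows "norm ((\<eta> * e) *\<^sub>R Df + f *\<^sub>R (e *\<^sub>R D\<eta> + (\<eta> * (- e / q)) *\<^sub>R DW)) powr q
    \<le> (2 powr (q - 1))\<^sup>2 * (norm Df powr q * e powr q) + (2 powr (q - 1))\<^sup>2 * c powr q * (\<bar>f\<bar> powr q * e powr q)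
       + 2 powr (q - 1) * q powr (- q) * (\<bar>f * (\<eta> * e)\<bar> powr q * S)"
proof -
  let ?k = "2 powr (q - 1)"
  let ?u = "e *\<^sub>R (\<eta> *\<^sub>R Df + f *\<^sub>R D\<eta>)" and ?v = "(- (f * (\<eta> * e)) / q) *\<^sub>R DW"
  have eq: "(\<eta> * e) *\<^sub>R Df + f *\<^sub>R (e *\<^sub>R D\<eta> + (\<eta> * (- e / q)) *\<^sub>R DW) = ?u + ?v"
    by (simp add: algebra_simps)
  have "norm ?v powr q = \<bar>f * (\<eta> * e)\<bar> powr q * q powr (- q) * norm DW powr q"
    unfolding norm_scaleR_powr using q by (simp add: abs_mult powr_divide powr_minus field_simps)
  also have "\<dots> \<le> \<bar>f * (\<eta> * e)\<bar> powr q * q powr (- q) * S" using S by (intro mult_left_mono) auto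
  finally have v: "norm ?v powr q \<le> q powr (- q) * (\<bar>f * (\<eta> * e)\<bar> powr q * S)" by (simp add: mult_ac)
  have "norm (\<eta> *\<^sub>R Df + f *\<^sub>R D\<eta>) powr q \<le> ?k * (\<bar>\<eta>\<bar> powr q * norm Df powr q + \<bar>f\<bar> powr q * norm D\<eta> powr q)"
    using norm_add_powr_le[OF q, of "\<eta> *\<^sub>R Df" "f *\<^sub>R D\<eta>"] by (simp only: norm_scaleR_powr)
  also have "\<dots> \<le> ?k * (1 * norm Df powr q + \<bar>f\<bar> powr q * c powr q)"
  proof (intro mult_left_mono add_mono mult_right_mono)
    show "\<bar>\<eta>\<bar> powr q \<le> 1" using \<eta> q by (simp add: powr_le1)
    show "norm D\<eta> powr q \<le> c powr q" using c q by (intro powr_mono2) auto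
  qed auto
  finally have "norm ?u powr q \<le> e powr q * (?k * (norm Df powr q + \<bar>f\<bar> powr q * c powr q))"
    unfolding norm_scaleR_powr using e by (simp add: mult_left_mono)
  then have "?k * (norm ?u powr q + norm ?v powr q)
     \<le> ?k * (e powr q * (?k * (norm Df powr q + \<bar>f\<bar> powr q * c powr q)) + q powr (- q) * (\<bar>f * (\<eta> * e)\<bar> powr q * S))"
    using v by (intro mult_left_mono add_mono) auto
  with norm_add_powr_le[OF q, of ?u ?v] show ?thesis
    unfolding eq by (simp add: power2_eq_square algebra_simps)
qed

text \<open>Finiteness of \<open>A\<close> permits the subtraction of \<open>\<theta> A\<close>. An
  infinite \<open>T\<close> needs no argument, since its coefficient is positive.\<close>

lemma ennreal_absorb:
  fixes A T :: ennreal
  assumes A: "A < \<infinity>" and le: "A \<le> T + ennreal \<theta> * A" and \<theta>: "0 \<le> \<theta>" "\<theta> < 1"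
  shows "A \<le> ennreal (1 / (1 - \<theta>)) * T"
proof (cases "T = \<infinity>")
  case True
  then show ?thesis using \<theta> by (simp add: ennreal_mult_top)
next
  case False
  then obtain t where t: "T = ennreal t" "0 \<le> t" by (cases T) auto
  obtain a where a: "A = ennreal a" "0 \<le> a" using A by (cases A) auto
  have "a \<le> t + \<theta> * a"
    using le t a \<theta> by (simp add: ennreal_mult[symmetric] ennreal_plus[symmetric] del: ennreal_plus)
  then have "a \<le> 1 / (1 - \<theta>) * t" using \<theta> by (simp add: field_simps)
  then have "ennreal a \<le> ennreal (1 / (1 - \<theta>) * t)" by (rule ennreal_leI)
  also have "\<dots> = ennreal (1 / (1 - \<theta>)) * ennreal t" using \<theta> t by (intro ennreal_mult) auto
  finally show ?thesis by (simp add: a t)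
qed

lemma borel_measurable_locally_integrable:
  fixes F :: "'a::euclidean_space \<Rightarrow> real"
  assumes F: "\<And>K. compact K \<Longrightarrow> F absolutely_integrable_on K"
  shows "F \<in> borel_measurable lebesgue"
proof (rule borel_measurable_LIMSEQ_real)
  show "(\<lambda>x. indicator (cball 0 (real n)) x * F x) \<in> borel_measurable lebesgue" for n
    using F[of "cball 0 (real n)"] by (auto simp: set_integrable_def)
  fix x :: 'a
  obtain N where N: "norm x \<le> real N" using real_arch_simple by blast
  have "\<forall>\<^sub>F n in sequentially. indicator (cball 0 (real n)) x * F x = F x"
    unfolding eventually_sequentially by (intro exI[of _ N]) (use N in auto)
  then show "(\<lambda>n. indicator (cball 0 (real n)) x * F x) \<longlonglongrightarrow> F x" by (rule tendsto_eventually)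
qed

lemma borel_measurable_weak_grad:
  fixes X :: "'k::finite \<Rightarrow> 'a::euclidean_space \<Rightarrow> 'a"
  assumes "f \<in> class_L X"
  shows "(\<lambda>x. norm (weak_grad X f x)) \<in> borel_measurable lebesgue"
proof -
  have "(\<lambda>x. weak_grad X f x $ i) \<in> borel_measurable lebesgue" for i
    using weak_grad_has_weak_deriv[OF assms, of i]
    by (intro borel_measurable_locally_integrable) (auto simp: has_weak_deriv_def)
  then have "(\<lambda>x. sqrt (\<Sum>i\<in>UNIV. (norm (weak_grad X f x $ i))\<^sup>2)) \<in> borel_measurable lebesgue" by measurable
  then show ?thesis unfolding norm_vec_def L2_set_def .
qed

text \<open>Some local bound is all that is wanted for the derivatives of \<open>W\<close>, so no
  root of order \<open>q\<close> has to be taken.\<close>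

lemma norm_le_of_powr_le:
  fixes t S q :: real
  assumes "1 \<le> q" "t powr q \<le> S"
  shows "t \<le> max 1 S"
proof (cases "1 \<le> t")
  case True
  then have "t powr 1 \<le> t powr q" using assms by (intro powr_mono) auto
  then show ?thesis using True assms by simp
qed simp

lemma vf_deriv_component_le: "\<bar>vf_deriv (X i) W x\<bar> \<le> norm (classical_grad X W x)"
  using component_le_norm_cart[of "classical_grad X W x" i] by (simp add: classical_grad_def)

text \<open>The test functions are \<open>f\<close> cut off to a sublevel set of \<open>d\<close> and multiplied by \<open>exp (- W / q)\<close>.
  The cutoff makes the term carrying \<open>\<delta>\<close> finite, so that it can be absorbed, and does not affect
  the factor of that term.\<close>

lemma perturbed_bound:
  fixes X :: "'k::finite \<Rightarrow> 'a::euclidean_space \<Rightarrow> 'a" and d W :: "'a \<Rightarrow> real" and \<mu> :: "'a measure"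
  assumes X: "\<And>i. smooth (X i)" and div: "\<And>i x. divergence (X i) x = 0"
    and d: "d \<in> class_L X" and d0: "\<And>x. 0 \<le> d x" and balls: "\<And>R. compact {x. d x \<le> R}"
    and grad_d: "AE x in lebesgue. norm (weak_grad X d x) \<le> 1"
    and p: "0 \<le> p" and q: "1 \<le> q"
    and sets: "sets \<mu> = sets lebesgue" and prob: "prob_space \<mu>"
    and AE: "\<And>P. (AE x in lebesgue. P x) \<Longrightarrow> AE x in \<mu>. P x"
    and C: "0 < C" and D: "0 < D"
    and U_bound: "\<And>f. f \<in> class_L X \<Longrightarrow>
        (\<integral>\<^sup>+x. ennreal (\<bar>f x\<bar> powr q * d x powr p) \<partial>\<mu>)
          \<le> ennreal C * (\<integral>\<^sup>+x. ennreal (norm (weak_grad X f x) powr q) \<partial>\<mu>)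
            + ennreal D * (\<integral>\<^sup>+x. ennreal (\<bar>f x\<bar> powr q) \<partial>\<mu>)"
    and W: "\<And>x. W differentiable (at x)"
    and \<delta>: "0 < \<delta>" and \<gamma>: "0 < \<gamma>"
    and grad_W: "\<And>x. norm (classical_grad X W x) powr q \<le> \<delta> * d x powr p + \<gamma>"
    and small: "\<delta> * 2 powr (q - 1) * q powr (- q) * C < 1"
  shows "\<exists>C' D' :: real. 0 < C' \<and> 0 < D' \<and> (\<forall>f\<in>class_L X.
        (\<integral>\<^sup>+x. ennreal (\<bar>f x\<bar> powr q * d x powr p * exp (- W x)) \<partial>\<mu>)
          \<le> ennreal C' * (\<integral>\<^sup>+x. ennreal (norm (weak_grad X f x) powr q * exp (- W x)) \<partial>\<mu>)
            + ennreal D' * (\<integral>\<^sup>+x. ennreal (\<bar>f x\<bar> powr q * exp (- W x)) \<partial>\<mu>))"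
proof -
  define \<kappa> where "\<kappa> = 2 powr (q - 1) * q powr (- q)"
  define k where "k = (2 powr (q - 1))\<^sup>2"
  \<comment> \<open>Each component of the gradient of the cutoff is at most 8, and the Euclidean
    norm is at most the sum of the components.\<close>
  define c where "c = 8 * real CARD('k)"
  \<comment> \<open>The coefficient with which the left-hand side reappears on the right; the
    smallness hypothesis says that it is below 1. Dividing by \<open>1 - \<theta>\<close> produces
    \<open>C1\<close> and \<open>D1\<close>.\<close>
  define \<theta> where "\<theta> = C * (\<kappa> * \<delta>)"
  define C1 where "C1 = C * k / (1 - \<theta>)"
  define D1 where "D1 = (C * (k * c powr q) + C * (\<kappa> * \<gamma>) + D) / (1 - \<theta>)"
  have \<kappa>: "0 < \<kappa>" and k: "0 < k" and c: "0 < c" using q by (auto simp: \<kappa>_def k_def c_def)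
  have \<theta>: "0 \<le> \<theta>" "\<theta> < 1" using C \<kappa> \<delta> small by (auto simp: \<theta>_def \<kappa>_def mult_ac)
  have pos: "0 < C * (k * c powr q) + C * (\<kappa> * \<gamma>) + D"
    using C D \<kappa> \<gamma> k c by (intro add_pos_pos mult_pos_pos) auto
  have C1: "0 < C1" and D1: "0 < D1" using C k \<theta> pos by (auto simp: C1_def D1_def)
  have dc: "continuous_on UNIV d" using d by (simp add: class_L_def)
  have Wc: "continuous_on UNIV W" using W by (rule continuous_on_of_differentiable)
  have meas: "g \<in> borel_measurable \<mu> \<longleftrightarrow> g \<in> borel_measurable lebesgue" for g :: "'a \<Rightarrow> 'b::topological_space"
    using measurable_cong_sets[OF sets refl] by blast
  have cm: "g \<in> borel_measurable \<mu>" if "continuous_on UNIV g" for g :: "'a \<Rightarrow> real"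
    unfolding meas using that by (rule measurable_lebesgue_continuous)
  note dm = cm[OF dc] and Wm = cm[OF Wc]
  have dbound: "\<exists>B>0. \<forall>x. norm x \<le> R \<longrightarrow> d x \<le> B" for R
    using continuous_bounded_on_cball[OF dc, of R] by (metis abs_le_D1 real_norm_def)
  have main: "(\<integral>\<^sup>+x. ennreal (\<bar>f x\<bar> powr q * d x powr p * exp (- W x)) \<partial>\<mu>)
          \<le> ennreal C1 * (\<integral>\<^sup>+x. ennreal (norm (weak_grad X f x) powr q * exp (- W x)) \<partial>\<mu>)
            + ennreal D1 * (\<integral>\<^sup>+x. ennreal (\<bar>f x\<bar> powr q * exp (- W x)) \<partial>\<mu>)"
    if f: "f \<in> class_L X" for f
  proof -
    have fc: "continuous_on UNIV f" using f by (simp add: class_L_def)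
    note fm = cm[OF fc]
    have gfm: "(\<lambda>x. norm (weak_grad X f x)) \<in> borel_measurable \<mu>"
      unfolding meas by (rule borel_measurable_weak_grad[OF f])
    define a1 where "a1 x = ennreal (norm (weak_grad X f x) powr q * exp (- W x))" for x
    define a2 where "a2 x = ennreal (\<bar>f x\<bar> powr q * exp (- W x))" for x
    have a1m: "a1 \<in> borel_measurable \<mu>" unfolding a1_def using gfm Wm by measurable
    have a2m: "a2 \<in> borel_measurable \<mu>" unfolding a2_def using fm Wm by measurable
    define T where "T = ennreal C1 * (\<integral>\<^sup>+x. a1 x \<partial>\<mu>) + ennreal D1 * (\<integral>\<^sup>+x. a2 x \<partial>\<mu>)"
    \<comment> \<open>Neither \<open>C1\<close> nor \<open>D1\<close>, and hence not
      \<open>T\<close>, depends on \<open>R\<close>, because the derivative bound 8 of the cutoff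
      does not.\<close>
    have trunc: "(\<integral>\<^sup>+x. ennreal (\<bar>f x\<bar> powr q * d x powr p * exp (- W x)) * indicator {x. d x \<le> R} x \<partial>\<mu>) \<le> T" for R
    proof -
      obtain \<eta> where \<eta>: "\<And>x. \<eta> differentiable (at x)" "bounded {x. \<eta> x \<noteq> 0}" "\<And>x. 0 \<le> \<eta> x" "\<And>x. \<eta> x \<le> 1"
        "\<And>x. d x \<le> R \<Longrightarrow> \<eta> x = 1" "\<And>i x. \<bar>vf_deriv (X i) \<eta> x\<bar> \<le> 8"
        using cutoff_exists[OF X div d balls grad_d, of R] by blast
      define e where "e x = exp (- W x / q)" for x
      have e0: "0 < e x" for x by (simp add: e_def)
      have eq: "e x powr q = exp (- W x)" for x using q by (simp add: e_def powr_def)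
      have ed: "(e has_derivative (\<lambda>v. (- e x / q) * frechet_derivative W (at x) v)) (at x)" for x
      proof -
        note h = has_derivative_frechet_derivative[OF W[of x]]
        show ?thesis unfolding e_def[abs_def] divide_inverse
          by (rule has_derivative_eq_rhs[OF has_derivative_exp[OF has_derivative_mult_left[OF has_derivative_minus[OF h]]]])
             (auto simp: fun_eq_iff)
      qed
      have ediff: "e differentiable (at x)" for x using ed unfolding differentiable_def by blast
      define g where "g x = \<eta> x * e x" for x
      have gd: "g differentiable (at x)" for x unfolding g_def[abs_def] using \<eta>(1) ediff by (rule differentiable_mult)
      have vfe: "vf_deriv Y e x = (- e x / q) * vf_deriv Y W x" for Y x
        using vf_deriv_eq[OF ed] by (simp add: vf_deriv_def)
      have vfg: "vf_deriv Y g x = \<eta> x * ((- e x / q) * vf_deriv Y W x) + vf_deriv Y \<eta> x * e x" for Y x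
        unfolding g_def[abs_def] vf_deriv_mult[OF \<eta>(1) ediff] vfe ..
      have cg: "classical_grad X g x = e x *\<^sub>R classical_grad X \<eta> x + (\<eta> x * (- e x / q)) *\<^sub>R classical_grad X W x" for x
        by (simp add: vec_eq_iff classical_grad_def vfg mult.commute)
      have gc: "continuous_on UNIV g" using gd by (rule continuous_on_of_differentiable)
      have ec: "continuous_on UNIV e" using ediff by (rule continuous_on_of_differentiable)
      \<comment> \<open>This is the hypothesis on \<open>g\<close> in the product rule. The bound on
        \<open>norm (classical_grad X W x)\<close> is local because \<open>d\<close> is bounded on
        balls, and it concerns the fields \<open>X i\<close> only.\<close>
      have gb: "\<exists>B. \<forall>x. norm x \<le> r \<longrightarrow> \<bar>vf_deriv (X i) g x\<bar> \<le> B" for i r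
      proof -
        obtain B1 where B1: "0 < B1" "\<And>x. norm x \<le> r \<Longrightarrow> d x \<le> B1" using dbound by metis
        obtain B2 where B2: "0 < B2" "\<And>x. norm x \<le> r \<Longrightarrow> \<bar>e x\<bar> \<le> B2"
          using continuous_bounded_on_cball[OF ec, of r] by auto
        define S where "S = max 1 (\<delta> * B1 powr p + \<gamma>)"
        have "\<bar>vf_deriv (X i) g x\<bar> \<le> B2 * S + 8 * B2" if x: "norm x \<le> r" for x
        proof -
          have "norm (classical_grad X W x) powr q \<le> \<delta> * B1 powr p + \<gamma>"
            using grad_W[of x] B1(2)[OF x] d0[of x] p \<delta> powr_mono2[of p "d x" B1]
            by (smt (verit, best) mult_left_mono)
          from norm_le_of_powr_le[OF q this] have w: "\<bar>vf_deriv (X i) W x\<bar> \<le> S"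
            using vf_deriv_component_le[of X i W x] by (simp add: S_def)
          have e1: "\<bar>- e x / q\<bar> \<le> B2"
          proof -
            have "e x / q \<le> e x / 1" using q e0[of x] by (intro divide_left_mono) auto
            then show ?thesis using B2(2)[OF x] e0[of x] q by simp
          qed
          have "\<bar>\<eta> x\<bar> * (\<bar>- e x / q\<bar> * \<bar>vf_deriv (X i) W x\<bar>) \<le> 1 * (B2 * S)"
            using e1 w \<eta>(3,4)[of x] B2(1) by (intro mult_mono) auto
          moreover have "\<bar>vf_deriv (X i) \<eta> x\<bar> * \<bar>e x\<bar> \<le> 8 * B2"
            using \<eta>(6)[of i x] B2(2)[OF x] by (intro mult_mono) auto
          ultimately show ?thesis unfolding vfg
            using abs_triangle_ineq[of "\<eta> x * ((- e x / q) * vf_deriv (X i) W x)" "vf_deriv (X i) \<eta> x * e x"]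
            by (simp only: abs_mult mult_1)
        qed
        then show ?thesis by blast
      qed
      define h where "h x = f x * g x" for x
      have hL: "h \<in> class_L X" unfolding h_def[abs_def] by (rule class_L_mult(1)[OF X div f gd gb])
      have hc: "continuous_on UNIV h" using hL by (simp add: class_L_def)
      note hm = cm[OF hc]
      have hgrad: "AE x in \<mu>. weak_grad X h x = g x *\<^sub>R weak_grad X f x + f x *\<^sub>R classical_grad X g x"
        unfolding h_def[abs_def] by (rule AE[OF class_L_mult(2)[OF X div f gd gb]])
      \<comment> \<open>\<open>a1\<close> and \<open>a2\<close> carry the weight
        \<open>exp (- W x)\<close> explicitly. In \<open>a3\<close> and \<open>a4\<close> it is
        hidden in \<open>h\<close>, whose q-th power already contains it.\<close>
      define a3 where "a3 x = ennreal (\<bar>h x\<bar> powr q * d x powr p)" for x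
      define a4 where "a4 x = ennreal (\<bar>h x\<bar> powr q)" for x
      have a3m: "a3 \<in> borel_measurable \<mu>" unfolding a3_def using hm dm by measurable
      have a4m: "a4 \<in> borel_measurable \<mu>" unfolding a4_def using hm by measurable
      have cgn: "norm (classical_grad X \<eta> x) \<le> c" for x
      proof -
        have "norm (classical_grad X \<eta> x) \<le> (\<Sum>i\<in>UNIV. \<bar>classical_grad X \<eta> x $ i\<bar>)" by (rule norm_le_l1_cart)
        also have "\<dots> \<le> (\<Sum>i\<in>(UNIV::'k set). 8)" by (rule sum_mono) (simp add: classical_grad_def \<eta>(6))
        finally show ?thesis by (simp add: c_def)
      qed
      let ?H = "\<integral>\<^sup>+x. ennreal (norm (weak_grad X h x) powr q) \<partial>\<mu>"
      have "AE x in \<mu>. ennreal (norm (weak_grad X h x) powr q)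
          \<le> ennreal k * a1 x + ennreal (k * c powr q) * a2 x + ennreal (\<kappa> * \<delta>) * a3 x + ennreal (\<kappa> * \<gamma>) * a4 x"
        using hgrad
      proof eventually_elim
        case (elim x)
        have "norm (weak_grad X h x) powr q \<le> k * (norm (weak_grad X f x) powr q * exp (- W x))
            + k * c powr q * (\<bar>f x\<bar> powr q * exp (- W x)) + \<kappa> * (\<bar>h x\<bar> powr q * (\<delta> * d x powr p + \<gamma>))"
          unfolding elim cg unfolding g_def h_def k_def \<kappa>_def eq[symmetric]
          by (rule gradient_bound[OF q e0 \<eta>(3,4) cgn grad_W])
        also have "\<dots> = k * (norm (weak_grad X f x) powr q * exp (- W x))
            + k * c powr q * (\<bar>f x\<bar> powr q * exp (- W x)) + \<kappa> * \<delta> * (\<bar>h x\<bar> powr q * d x powr p) + \<kappa> * \<gamma> * (\<bar>h x\<bar> powr q)"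
          by (simp add: algebra_simps)
        finally have "ennreal (norm (weak_grad X h x) powr q) \<le> ennreal \<dots>" by (rule ennreal_leI)
        also have "\<dots> = ennreal k * a1 x + ennreal (k * c powr q) * a2 x + ennreal (\<kappa> * \<delta>) * a3 x + ennreal (\<kappa> * \<gamma>) * a4 x"
          using k \<kappa> \<delta> \<gamma> by (simp add: a1_def a2_def a3_def a4_def ennreal_mult)
        finally show ?case .
      qed
      then have "?H
          \<le> (\<integral>\<^sup>+x. ennreal k * a1 x + ennreal (k * c powr q) * a2 x + ennreal (\<kappa> * \<delta>) * a3 x + ennreal (\<kappa> * \<gamma>) * a4 x \<partial>\<mu>)"
        by (rule nn_integral_mono_AE)
      also have "\<dots> = ennreal k * integral\<^sup>N \<mu> a1 + ennreal (k * c powr q) * integral\<^sup>N \<mu> a2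
           + ennreal (\<kappa> * \<delta>) * integral\<^sup>N \<mu> a3 + ennreal (\<kappa> * \<gamma>) * integral\<^sup>N \<mu> a4"
        using a1m a2m a3m a4m by (simp add: nn_integral_add nn_integral_cmult)
      finally have gradh: "?H \<le> \<dots>" .
      \<comment> \<open>Since the cutoff is at most 1, the terms in \<open>a4\<close> can be merged
        into those in \<open>a2\<close>. For \<open>a3\<close> the cutoff must stay, as it is what
        makes that integral finite.\<close>
      have a42: "integral\<^sup>N \<mu> a4 \<le> integral\<^sup>N \<mu> a2"
      proof (rule nn_integral_mono)
        fix x
        have "\<bar>h x\<bar> powr q \<le> (\<bar>f x\<bar> * e x) powr q"
          unfolding h_def g_def using q \<eta>(3,4)[of x] e0[of x]
          by (intro powr_mono2) (auto simp: abs_mult intro!: mult_left_mono mult_left_le_one_le)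
        also have "\<dots> = \<bar>f x\<bar> powr q * exp (- W x)" using e0[of x] by (simp add: powr_mult eq)
        finally show "a4 x \<le> a2 x" unfolding a4_def a2_def by (rule ennreal_leI)
      qed
      have "integral\<^sup>N \<mu> a3 \<le> ennreal C * ?H + ennreal D * integral\<^sup>N \<mu> a4"
        unfolding a3_def[abs_def] a4_def[abs_def] by (rule U_bound[OF hL])
      also have "\<dots> \<le> ennreal C * (ennreal k * integral\<^sup>N \<mu> a1 + ennreal (k * c powr q) * integral\<^sup>N \<mu> a2
           + ennreal (\<kappa> * \<delta>) * integral\<^sup>N \<mu> a3 + ennreal (\<kappa> * \<gamma>) * integral\<^sup>N \<mu> a2) + ennreal D * integral\<^sup>N \<mu> a2"
        using gradh a42 by (intro add_mono mult_left_mono order_trans[OF gradh] order_refl) auto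
      also have "\<dots> = (ennreal (C * k) * integral\<^sup>N \<mu> a1 + ennreal (C * (k * c powr q) + C * (\<kappa> * \<gamma>) + D) * integral\<^sup>N \<mu> a2)
           + ennreal \<theta> * integral\<^sup>N \<mu> a3"
        using C D k \<kappa> \<gamma> \<delta> by (simp add: \<theta>_def ennreal_mult ennreal_plus algebra_simps)
      finally have le: "integral\<^sup>N \<mu> a3 \<le> \<dots>" .
      \<comment> \<open>\<open>h\<close> is bounded with bounded support, \<open>d\<close> is
        bounded on that support, and the measure has total mass 1.\<close>
      have fin: "integral\<^sup>N \<mu> a3 < \<infinity>"
      proof -
        have hs: "bounded {x. h x \<noteq> 0}" by (rule bounded_subset[OF \<eta>(2)]) (auto simp: h_def g_def)
        obtain r where r: "\<And>x. r < norm x \<Longrightarrow> h x = 0" using bounded_obtain_cball[OF hs] by metis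
        obtain B1 where B1: "0 < B1" "\<And>x. \<bar>h x\<bar> \<le> B1" using continuous_bounded_support_bounded[OF hc hs] by metis
        obtain B2 where B2: "0 < B2" "\<And>x. norm x \<le> r \<Longrightarrow> d x \<le> B2" using dbound by metis
        have "a3 x \<le> ennreal (B1 powr q * B2 powr p)" for x
        proof (cases "r < norm x")
          case False
          then show ?thesis unfolding a3_def using B1 B2 d0[of x] q p
            by (intro ennreal_leI mult_mono powr_mono2) auto
        qed (simp add: a3_def r)
        then have "integral\<^sup>N \<mu> a3 \<le> (\<integral>\<^sup>+x. ennreal (B1 powr q * B2 powr p) \<partial>\<mu>)" by (intro nn_integral_mono)
        also have "\<dots> < \<infinity>" using prob_space.emeasure_space_1[OF prob] by simp
        finally show ?thesis .
      qed
      have "(\<integral>\<^sup>+x. ennreal (\<bar>f x\<bar> powr q * d x powr p * exp (- W x)) * indicator {x. d x \<le> R} x \<partial>\<mu>) \<le> integral\<^sup>N \<mu> a3"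
      proof (rule nn_integral_mono)
        fix x
        show "ennreal (\<bar>f x\<bar> powr q * d x powr p * exp (- W x)) * indicator {x. d x \<le> R} x \<le> a3 x"
        proof (cases "d x \<le> R")
          case True
          then have "\<bar>h x\<bar> powr q = \<bar>f x\<bar> powr q * exp (- W x)"
            using e0[of x] by (simp add: h_def g_def \<eta>(5) abs_mult powr_mult eq)
          then show ?thesis by (simp add: a3_def indicator_def mult_ac)
        qed simp
      qed
      also have "\<dots> \<le> ennreal (1 / (1 - \<theta>)) * (ennreal (C * k) * integral\<^sup>N \<mu> a1
           + ennreal (C * (k * c powr q) + C * (\<kappa> * \<gamma>) + D) * integral\<^sup>N \<mu> a2)"
        by (rule ennreal_absorb[OF fin le \<theta>])
      also have "\<dots> = T"
      proof -
        have "ennreal C1 = ennreal (1 / (1 - \<theta>)) * ennreal (C * k)"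
          unfolding C1_def using C k \<theta> by (subst ennreal_mult[symmetric]) auto
        moreover have "ennreal D1 = ennreal (1 / (1 - \<theta>)) * ennreal (C * (k * c powr q) + C * (\<kappa> * \<gamma>) + D)"
          unfolding D1_def using pos \<theta> by (subst ennreal_mult[symmetric]) auto
        ultimately show ?thesis by (simp add: T_def distrib_left mult.assoc)
      qed
      finally show ?thesis .
    qed
    define G where "G x = ennreal (\<bar>f x\<bar> powr q * d x powr p * exp (- W x))" for x
    have Gm: "G \<in> borel_measurable \<mu>" unfolding G_def using fm dm Wm by measurable
    have "(\<lambda>n. \<integral>\<^sup>+x. G x * indicator {x. d x \<le> real n} x \<partial>\<mu>) \<longlonglongrightarrow> integral\<^sup>N \<mu> G"
    proof (rule nn_integral_LIMSEQ)
      show "incseq (\<lambda>n x. G x * indicator {x. d x \<le> real n} x)"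
        by (auto simp: incseq_def le_fun_def indicator_def)
      have "{x. d x \<le> real n} \<in> sets \<mu>" for n
        unfolding sets by (rule fmeasurableD[OF lmeasurable_compact[OF balls]])
      then show "(\<lambda>x. G x * indicator {x. d x \<le> real n} x) \<in> borel_measurable \<mu>" for n
        using Gm by (intro borel_measurable_times_ennreal borel_measurable_indicator)
      fix x
      obtain N where N: "d x \<le> real N" using real_arch_simple by blast
      have "\<forall>\<^sub>F n in sequentially. G x * indicator {x. d x \<le> real n} x = G x"
        unfolding eventually_sequentially by (intro exI[of _ N]) (use N in auto)
      then show "(\<lambda>n. G x * indicator {x. d x \<le> real n} x) \<longlonglongrightarrow> G x" by (rule tendsto_eventually)
    qed
    then have "integral\<^sup>N \<mu> G \<le> T"
      by (rule LIMSEQ_le_const2) (use trunc in \<open>auto simp: G_def\<close>)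
    then show ?thesis by (simp add: G_def[abs_def] T_def a1_def[abs_def] a2_def[abs_def])
  qed
  show ?thesis using C1 D1 main by blast
qed

section \<open>The bounded potential and the conclusion\<close>

lemma osc_finite_imp_bounded:
  assumes "osc V < \<infinity>"
  obtains m M where "\<And>x. m \<le> V x" "\<And>x. V x \<le> M"
proof -
  \<comment> \<open>In \<open>ereal\<close> a sum with a summand \<infinity> is \<infinity>, even
    when the other is -\<infinity>. An infinite supremum or an infimum -\<infinity> would therefore
    make the oscillation infinite.\<close>
  have s: "(SUP x. ereal (V x)) \<noteq> \<infinity>" and i: "(INF x. ereal (V x)) \<noteq> -\<infinity>"
    using assms unfolding osc_def by (auto simp: minus_ereal_def)
  have le: "ereal (V x) \<le> (SUP x. ereal (V x))" "(INF x. ereal (V x)) \<le> ereal (V x)" for x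
    by (auto intro: SUP_upper INF_lower)
  \<comment> \<open>Any point will do; \<open>undefined\<close> serves as a witness that the domain
    is not empty.\<close>
  have s': "(SUP x. ereal (V x)) \<noteq> -\<infinity>" using le(1)[of undefined] by auto
  have i': "(INF x. ereal (V x)) \<noteq> \<infinity>" using le(2)[of undefined] by auto
  obtain M where M: "(SUP x. ereal (V x)) = ereal M" using s s' by (cases "SUP x. ereal (V x)") auto
  obtain m where m: "(INF x. ereal (V x)) = ereal m" using i i' by (cases "INF x. ereal (V x)") auto
  show ?thesis using that[of m M] le M m by simp
qed

theorem theorem2p5:
  fixes X :: "'k::finite \<Rightarrow> real ^ 'n \<Rightarrow> real ^ 'n"
    and \<rho> :: "real ^ 'n \<Rightarrow> real ^ 'n \<Rightarrow> real"
    and d W V :: "real ^ 'n \<Rightarrow> real"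
    and p q \<beta> Z Z' \<sigma> K \<epsilon> C D \<delta> \<gamma> :: real
    and \<mu>\<^sub>p \<mu> :: "(real ^ 'n) measure"
  assumes X_smooth: "\<And>i. smooth (X i)"
    and X_div_free: "\<And>i x. divergence (X i) x = 0"
    and metric: "Metric_space UNIV \<rho>"
    and d_def: "\<And>x. d x = \<rho> 0 x"
    and d_L: "d \<in> class_L X"
    and balls_compact: "\<And>R. compact {x. d x \<le> R}"
    and p: "2 \<le> p" and conj: "1 / p + 1 / q = 1"
    and \<beta>: "0 < \<beta>"
    and Z: "0 < Z"
    and \<mu>\<^sub>p_def: "\<mu>\<^sub>p = density lebesgue (\<lambda>x. ennreal (exp (- \<beta> * d x powr p) / Z))"
    and \<mu>\<^sub>p_prob: "prob_space \<mu>\<^sub>p"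
    and \<sigma>: "1 \<le> \<sigma>"
    and grad_d: "AE x in lebesgue. 1 / \<sigma> \<le> norm (weak_grad X d x) \<and> norm (weak_grad X d x) \<le> 1"
    and K: "0 \<le> K" and \<epsilon>: "0 \<le> \<epsilon>" "\<epsilon> < 1 / \<sigma>\<^sup>2"
    and lap_d: "weak_laplacian_le X {x. 1 < d x} d (\<lambda>x. K + \<beta> * p * \<epsilon> * d x powr (p - 1))"
    and C: "0 < C" and D: "0 < D"
    and U_bound: "\<And>f. f \<in> class_L X \<Longrightarrow>
        (\<integral>\<^sup>+x. ennreal (\<bar>f x\<bar> powr q * d x powr p) \<partial>\<mu>\<^sub>p)
          \<le> ennreal C * (\<integral>\<^sup>+x. ennreal (norm (weak_grad X f x) powr q) \<partial>\<mu>\<^sub>p)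
            + ennreal D * (\<integral>\<^sup>+x. ennreal (\<bar>f x\<bar> powr q) \<partial>\<mu>\<^sub>p)"
    and W_diff: "\<And>x. W differentiable (at x)"
    and \<delta>: "0 < \<delta>" and \<gamma>: "0 < \<gamma>"
    and grad_W: "\<And>x. norm (classical_grad X W x) powr q \<le> \<delta> * d x powr p + \<gamma>"
    and \<delta>_small: "\<delta> * 2 powr (q - 1) * q powr (- q) * C < 1"
    and V_meas: "V \<in> borel_measurable lebesgue"
    and V_osc: "osc V < \<infinity>"
    and Z': "0 < Z'"
    and \<mu>_def: "\<mu> = density \<mu>\<^sub>p (\<lambda>x. ennreal (exp (- W x - V x) / Z'))"
    and \<mu>_prob: "prob_space \<mu>"
  shows "\<exists>C' D' :: real. 0 < C' \<and> 0 < D' \<and>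
      (\<forall>f\<in>class_L X.
        (\<integral>\<^sup>+x. ennreal (\<bar>f x\<bar> powr q * d x powr p) \<partial>\<mu>)
          \<le> ennreal C' * (\<integral>\<^sup>+x. ennreal (norm (weak_grad X f x) powr q) \<partial>\<mu>)
            + ennreal D' * (\<integral>\<^sup>+x. ennreal (\<bar>f x\<bar> powr q) \<partial>\<mu>))"
proof -
  have p0: "0 \<le> p" using p by simp
  have q: "1 \<le> q"
  proof -
    have "0 < 1 / p" "1 / p \<le> 1 / 2" using p by (auto simp: field_simps)
    \<comment> \<open>As \<open>1 / 0 = 0\<close>, it is the positivity of \<open>1 / q\<close> that
      rules out \<open>q = 0\<close>.\<close>
    then have iq: "0 < 1 / q" "1 / q \<le> 1" using conj by linarith+
    then have "0 < q" by simp
    then show ?thesis using iq(2) by (simp add: field_simps)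
  qed
  have d0: "0 \<le> d x" for x
    unfolding d_def using metric by (rule Metric_space.nonneg)
  have dc: "continuous_on UNIV d" using d_L by (simp add: class_L_def)
  have dm: "d \<in> borel_measurable lebesgue" by (rule measurable_lebesgue_continuous[OF dc])
  have Wm: "W \<in> borel_measurable lebesgue"
    by (rule measurable_lebesgue_continuous[OF continuous_on_of_differentiable[OF W_diff]])
  have wm: "(\<lambda>x. ennreal (exp (- \<beta> * d x powr p) / Z)) \<in> borel_measurable lebesgue" using dm by measurable
  have sets_p: "sets \<mu>\<^sub>p = sets lebesgue" by (simp add: \<mu>\<^sub>p_def)
  have AE_p: "AE x in \<mu>\<^sub>p. P x" if "AE x in lebesgue. P x" for P
    unfolding \<mu>\<^sub>p_def AE_density[OF wm] using that by eventually_elim simp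
  have grad1: "AE x in lebesgue. norm (weak_grad X d x) \<le> 1" using grad_d by eventually_elim simp
  obtain C1 D1 :: real where C1: "0 < C1" and D1: "0 < D1" and main: "\<And>f. f \<in> class_L X \<Longrightarrow>
        (\<integral>\<^sup>+x. ennreal (\<bar>f x\<bar> powr q * d x powr p * exp (- W x)) \<partial>\<mu>\<^sub>p)
          \<le> ennreal C1 * (\<integral>\<^sup>+x. ennreal (norm (weak_grad X f x) powr q * exp (- W x)) \<partial>\<mu>\<^sub>p)
            + ennreal D1 * (\<integral>\<^sup>+x. ennreal (\<bar>f x\<bar> powr q * exp (- W x)) \<partial>\<mu>\<^sub>p)"
    using perturbed_bound[OF X_smooth X_div_free d_L d0 balls_compact grad1 p0 q sets_p \<mu>\<^sub>p_prob AE_p C D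
        U_bound W_diff \<delta> \<gamma> grad_W \<delta>_small] by blast
  obtain m M where V: "\<And>x. m \<le> V x" "\<And>x. V x \<le> M" using osc_finite_imp_bounded[OF V_osc] by metis
  have meas: "g \<in> borel_measurable \<mu>\<^sub>p \<longleftrightarrow> g \<in> borel_measurable lebesgue" for g :: "real ^ 'n \<Rightarrow> 'b::topological_space"
    using measurable_cong_sets[OF sets_p refl] by blast
  have vm: "(\<lambda>x. ennreal (exp (- W x - V x) / Z')) \<in> borel_measurable \<mu>\<^sub>p"
    unfolding meas using Wm V_meas by measurable
  have \<mu>_int: "(\<integral>\<^sup>+x. ennreal (g x) \<partial>\<mu>) = (\<integral>\<^sup>+x. ennreal (g x * exp (- W x) * (exp (- V x) / Z')) \<partial>\<mu>\<^sub>p)"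
    if g: "g \<in> borel_measurable lebesgue" and g0: "\<And>x. 0 \<le> g x" for g
  proof -
    have gm: "(\<lambda>x. ennreal (g x)) \<in> borel_measurable \<mu>\<^sub>p" unfolding meas using g by measurable
    have "(\<integral>\<^sup>+x. ennreal (g x) \<partial>\<mu>) = (\<integral>\<^sup>+x. ennreal (exp (- W x - V x) / Z') * ennreal (g x) \<partial>\<mu>\<^sub>p)"
      unfolding \<mu>_def by (rule nn_integral_density[OF vm gm])
    also have "\<dots> = (\<integral>\<^sup>+x. ennreal (g x * exp (- W x) * (exp (- V x) / Z')) \<partial>\<mu>\<^sub>p)"
    proof (rule nn_integral_cong)
      fix x
      have "exp (- W x - V x) / Z' * g x = g x * exp (- W x) * (exp (- V x) / Z')"
        by (simp add: exp_diff exp_minus field_simps)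
      then show "ennreal (exp (- W x - V x) / Z') * ennreal (g x) = ennreal (g x * exp (- W x) * (exp (- V x) / Z'))"
        using g0[of x] Z' by (simp add: ennreal_mult[symmetric])
    qed
    finally show ?thesis .
  qed
  \<comment> \<open>The factor \<open>exp (- V x) / Z'\<close> lies between
    \<open>exp (- M) / Z'\<close> and \<open>exp (- m) / Z'\<close>, so integrals against
    \<open>\<mu>\<close> and against the weight \<open>exp (- W)\<close> on
    \<open>\<mu>\<^sub>p\<close> are comparable in both directions.\<close>
  have upper: "(\<integral>\<^sup>+x. ennreal (g x) \<partial>\<mu>) \<le> ennreal (exp (- m) / Z') * (\<integral>\<^sup>+x. ennreal (g x * exp (- W x)) \<partial>\<mu>\<^sub>p)"
    and lower: "(\<integral>\<^sup>+x. ennreal (g x * exp (- W x)) \<partial>\<mu>\<^sub>p) \<le> ennreal (Z' * exp M) * (\<integral>\<^sup>+x. ennreal (g x) \<partial>\<mu>)"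
    if g: "g \<in> borel_measurable lebesgue" and g0: "\<And>x. 0 \<le> g x" for g
  proof -
    let ?P = "\<integral>\<^sup>+x. ennreal (g x * exp (- W x)) \<partial>\<mu>\<^sub>p" and ?Q = "\<integral>\<^sup>+x. ennreal (g x) \<partial>\<mu>"
    let ?v = "\<lambda>x. g x * exp (- W x) * (exp (- V x) / Z')"
    have gW: "(\<lambda>x. ennreal (g x * exp (- W x))) \<in> borel_measurable \<mu>\<^sub>p"
      unfolding meas using g Wm by measurable
    have "?Q \<le> (\<integral>\<^sup>+x. ennreal (exp (- m) / Z') * ennreal (g x * exp (- W x)) \<partial>\<mu>\<^sub>p)"
      unfolding \<mu>_int[OF g g0]
    proof (rule nn_integral_mono)
      fix x
      have "?v x \<le> g x * exp (- W x) * (exp (- m) / Z')"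
        using V(1)[of x] g0[of x] Z' by (intro mult_left_mono divide_right_mono) auto
      then have "ennreal (?v x) \<le> ennreal (g x * exp (- W x) * (exp (- m) / Z'))"
        by (rule ennreal_leI)
      also have "\<dots> = ennreal (exp (- m) / Z') * ennreal (g x * exp (- W x))"
        using g0[of x] Z' by (subst ennreal_mult[symmetric]) (auto simp: mult_ac)
      finally show "ennreal (?v x) \<le> ennreal (exp (- m) / Z') * ennreal (g x * exp (- W x))" .
    qed
    also have "\<dots> = ennreal (exp (- m) / Z') * ?P"
      by (rule nn_integral_cmult[OF gW])
    finally show "?Q \<le> ennreal (exp (- m) / Z') * ?P" .
    have gV: "(\<lambda>x. ennreal (?v x)) \<in> borel_measurable \<mu>\<^sub>p"
      unfolding meas using g Wm V_meas by measurable
    have "?P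
        \<le> (\<integral>\<^sup>+x. ennreal (Z' * exp M) * ennreal (?v x) \<partial>\<mu>\<^sub>p)"
    proof (rule nn_integral_mono)
      fix x
      have "1 \<le> exp M * exp (- V x)" using V(2)[of x] by (simp add: exp_add[symmetric])
      then have "g x * exp (- W x) * 1 \<le> g x * exp (- W x) * (exp M * exp (- V x))"
        using g0[of x] by (intro mult_left_mono) auto
      also have "\<dots> = (Z' * exp M) * (?v x)" using Z' by simp
      finally have "ennreal (g x * exp (- W x)) \<le> ennreal ((Z' * exp M) * (?v x))"
        by (intro ennreal_leI) simp
      also have "\<dots> = ennreal (Z' * exp M) * ennreal (?v x)"
        using g0[of x] Z' by (intro ennreal_mult) auto
      finally show "ennreal (g x * exp (- W x)) \<le> \<dots>" .
    qed
    also have "\<dots> = ennreal (Z' * exp M) * ?Q"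
      unfolding \<mu>_int[OF g g0] by (rule nn_integral_cmult[OF gV])
    finally show "?P \<le> ennreal (Z' * exp M) * ?Q" .
  qed
  \<comment> \<open>\<open>c\<close> is the upper bound of that factor and \<open>b\<close> the
    reciprocal of the lower one. The left-hand side is passed to the weighted integral with
    \<open>c\<close>, the right-hand side back with \<open>b\<close>, so the constants are
    multiplied by \<open>c * b\<close>.\<close>
  define c where "c = exp (- m) / Z'"
  define b where "b = Z' * exp M"
  have c: "0 < c" and b: "0 < b" using Z' by (auto simp: c_def b_def)
  show ?thesis
  proof (intro exI conjI ballI)
    show "0 < c * C1 * b" "0 < c * D1 * b" using c b C1 D1 by auto
    fix f assume f: "f \<in> class_L X"
    have fm: "f \<in> borel_measurable lebesgue"
      using f by (intro measurable_lebesgue_continuous) (simp add: class_L_def)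
    note gm = borel_measurable_weak_grad[OF f]
    have m1: "(\<lambda>x. \<bar>f x\<bar> powr q * d x powr p) \<in> borel_measurable lebesgue"
      and m2: "(\<lambda>x. \<bar>f x\<bar> powr q) \<in> borel_measurable lebesgue"
      and m3: "(\<lambda>x. norm (weak_grad X f x) powr q) \<in> borel_measurable lebesgue"
      using fm dm gm by measurable
    let ?A = "\<integral>\<^sup>+x. ennreal (norm (weak_grad X f x) powr q) \<partial>\<mu>"
    let ?B = "\<integral>\<^sup>+x. ennreal (\<bar>f x\<bar> powr q) \<partial>\<mu>"
    let ?I = "\<lambda>g. \<integral>\<^sup>+x. ennreal (g x * exp (- W x)) \<partial>\<mu>\<^sub>p"
    have "(\<integral>\<^sup>+x. ennreal (\<bar>f x\<bar> powr q * d x powr p) \<partial>\<mu>) \<le> ennreal c * ?I (\<lambda>x. \<bar>f x\<bar> powr q * d x powr p)"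
      unfolding c_def by (rule upper[OF m1]) simp
    also have "\<dots> \<le> ennreal c * (ennreal C1 * ?I (\<lambda>x. norm (weak_grad X f x) powr q) + ennreal D1 * ?I (\<lambda>x. \<bar>f x\<bar> powr q))"
      by (intro mult_left_mono main f) simp
    also have "\<dots> \<le> ennreal c * (ennreal C1 * (ennreal b * ?A)
        + ennreal D1 * (ennreal b * ?B))"
      unfolding b_def
      by (intro mult_left_mono add_mono lower m2 m3) auto
    also have "\<dots> = ennreal (c * C1 * b) * ?A
        + ennreal (c * D1 * b) * ?B"
      using c b C1 D1 by (simp add: ennreal_mult distrib_left mult_ac)
    finally show "(\<integral>\<^sup>+x. ennreal (\<bar>f x\<bar> powr q * d x powr p) \<partial>\<mu>)
          \<le> ennreal (c * C1 * b) * ?A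
        + ennreal (c * D1 * b) * ?B" .
  qed
qed

end
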